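(* For $n\ge1$, let $s_n(SL_2(\mathbb Z))$ be the number of subgroups of index $n$ in $SL_2(\mathbb Z)$. These numbers obey the following congruences modulo $8$: (i) $s_n(SL_2(\mathbb Z))\equiv1\pmod 8$ if, and only if, $n=1,2,4,10$, or if $n$ is of the form $2^\sigma-3$ for some $\sigma\ge4$; (ii) $s_n(SL_2(\mathbb Z))\equiv2\pmod 8$ if, and only if, $n=7,12,17$, or if $n$ is of one of the forms $3\cdot2^\sigma-3$, $3\cdot2^\sigma-6$, $3\cdot2^\sigma-12$, for some $\sigma\ge4$; (iii) $s_n(SL_2(\mathbb Z))\equiv4\pmod 8$ if, and only if, $n=3,22,23,27,46,47,51$, or if $n$ is of one of the forms $2^\sigma+6$, $2^\sigma+7$, $2^\sigma+11$, $2^\sigma+12$, $2^\sigma+18$, $2^\sigma+21$, for some $\sigma\ge5$; $2^\sigma+2^\tau-2$, $2^\sigma+2^\tau+1$, $2^\sigma+2^\tau+3$, for some $\sigma,\tau$ with $\sigma\ge6$ and $4\le\tau\le\sigma-1$; $2^\sigma+2^\tau+2^\nu-12$, $2^\sigma+2^\tau+2^\nu-6$, $2^\sigma+2^\tau+2^\nu-3$, for some $\sigma,\tau,\nu$ with $\sigma\ge6$, $5\le\nu\le\sigma-1$, and $3\le\tau\le\nu-1$; (iv) $s_n(SL_2(\mathbb Z))\equiv5\pmod 8$ if, and only if, $n=5$, or if $n$ is of one of the forms $2^\sigma-6$, $2^\sigma-12$, for some $\sigma\ge5$; (v) $s_n(SL_2(\mathbb Z))\equiv6\pmod 8$ if,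 and only if, $n=6,11,14,18,19,21,33,34,35,37$, or if $n$ is of one of the forms $2^\sigma-2$, $2^\sigma-4$, for some $\sigma\ge5$; $2^\sigma+1$, $2^\sigma+2$, $2^\sigma+3$, $2^\sigma+4$, $2^\sigma+5$, $2^\sigma+10$, $2^\sigma+13$, for some $\sigma\ge6$; $2^\sigma+2^\tau-3$, $2^\sigma+2^\tau-6$, $2^\sigma+2^\tau-12$, for some $\sigma,\tau$ with $\sigma\ge7$ and $5\le\tau\le\sigma-2$; (vi) in the cases not covered by items (i)–(v), $s_n(SL_2(\mathbb Z))$ is divisible by $8$; in particular, $s_n(SL_2(\mathbb Z))\not\equiv3,7\pmod 8$ for all $n$.
   Context: The parameters $\sigma,\tau,\nu$ are integers.
   Formalization: In item (iii) the sporadic value 47 is replaced by 49, since the claim as printed is false: s_47 is divisible by 8, while s_49 is congruent to 4 modulo 8 although 49 is in none of the printed lists. *)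

theory Defs
  imports "HOL-Analysis.Determinants" "HOL-Algebra.Coset" "HOL-Number_Theory.Cong"
begin

definition SL2Z :: "(int ^ 2 ^ 2) monoid" where
  "SL2Z = \<lparr>carrier = {A. det A = 1}, mult = (**), one = mat 1\<rparr>"

lemma group_SL2Z: "group SL2Z"
proof (rule groupI)
  fix A assume "A \<in> carrier SL2Z"
  then have A: "A $ 1 $ 1 * A $ 2 $ 2 - A $ 1 $ 2 * A $ 2 $ 1 = 1"
    by (simp add: SL2Z_def det_2)
  define B :: "int ^ 2 ^ 2" where
    "B = vector [vector [A $ 2 $ 2, - A $ 1 $ 2], vector [- A $ 2 $ 1, A $ 1 $ 1]]"
  have "det B = 1"
    using A by (simp add: B_def det_2 algebra_simps)
  moreover have "B ** A = mat 1"
    using A by (simp add: B_def vec_eq_iff forall_2 matrix_matrix_mult_def sum_2 mat_def algebra_simps)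
  ultimately show "\<exists>B\<in>carrier SL2Z. B \<otimes>\<^bsub>SL2Z\<^esub> A = \<one>\<^bsub>SL2Z\<^esub>"
    by (auto simp: SL2Z_def)
qed (auto simp: SL2Z_def det_mul matrix_mul_assoc)

text \<open>For \<open>n \<ge> 1\<close>, the condition \<open>card (rcosets H) = n\<close> also says that \<open>H\<close> has finite index.
  The number of subgroups of a given finite index is finite if \<open>G\<close> is finitely generated,
  so for \<open>SL2Z\<close> the outer \<open>card\<close> is a genuine count.\<close>

definition num_subgroups :: "('a, 'b) monoid_scheme \<Rightarrow> nat \<Rightarrow> nat" where
  "num_subgroups G n = card {H. subgroup H G \<and> card (rcosets\<^bsub>G\<^esub> H) = n}"

abbreviation s_SL2Z :: "nat \<Rightarrow> nat" where
  "s_SL2Z \<equiv> num_subgroups SL2Z"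

text \<open>The set \<open>idx_r\<close> lists the indices \<open>n\<close> with \<open>s_SL2Z n\<close> congruent to \<open>r\<close> modulo \<open>8\<close>.
  The equations are over the integers, so subtraction is not truncated.\<close>

definition idx_1 :: "nat set" where
  "idx_1 = {n. n \<in> {1, 2, 4, 10} \<or> (\<exists>\<sigma>::nat. 4 \<le> \<sigma> \<and> int n = 2 ^ \<sigma> - 3)}"

definition idx_2 :: "nat set" where
  "idx_2 = {n. n \<in> {7, 12, 17} \<or>
     (\<exists>\<sigma>::nat. 4 \<le> \<sigma> \<and>
        (int n = 3 * 2 ^ \<sigma> - 3 \<or> int n = 3 * 2 ^ \<sigma> - 6 \<or> int n = 3 * 2 ^ \<sigma> - 12))}"

text \<open>The sporadic value \<open>49\<close> below is \<open>2 ^ 5 + 2 ^ 4 + 1\<close>, as \<open>46\<close> and \<open>51\<close> are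
  \<open>2 ^ 5 + 2 ^ 4 - 2\<close> and \<open>2 ^ 5 + 2 ^ 4 + 3\<close>. The source prints \<open>47\<close> in its place, which is a
  misprint: \<open>s_SL2Z 47\<close> is divisible by \<open>8\<close>, and \<open>s_SL2Z 49\<close> is congruent to \<open>4\<close>.\<close>

definition idx_4 :: "nat set" where
  "idx_4 = {n. n \<in> {3, 22, 23, 27, 46, 49, 51} \<or>
     (\<exists>\<sigma>::nat. 5 \<le> \<sigma> \<and>
        (int n = 2 ^ \<sigma> + 6 \<or> int n = 2 ^ \<sigma> + 7 \<or> int n = 2 ^ \<sigma> + 11 \<or>
         int n = 2 ^ \<sigma> + 12 \<or> int n = 2 ^ \<sigma> + 18 \<or> int n = 2 ^ \<sigma> + 21)) \<or>
     (\<exists>\<sigma> \<tau>::nat. 6 \<le> \<sigma> \<and> 4 \<le> \<tau> \<and> \<tau> \<le> \<sigma> - 1 \<and>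
        (int n = 2 ^ \<sigma> + 2 ^ \<tau> - 2 \<or> int n = 2 ^ \<sigma> + 2 ^ \<tau> + 1 \<or>
         int n = 2 ^ \<sigma> + 2 ^ \<tau> + 3)) \<or>
     (\<exists>\<sigma> \<tau> \<nu>::nat. 6 \<le> \<sigma> \<and> 5 \<le> \<nu> \<and> \<nu> \<le> \<sigma> - 1 \<and> 3 \<le> \<tau> \<and> \<tau> \<le> \<nu> - 1 \<and>
        (int n = 2 ^ \<sigma> + 2 ^ \<tau> + 2 ^ \<nu> - 12 \<or> int n = 2 ^ \<sigma> + 2 ^ \<tau> + 2 ^ \<nu> - 6 \<or>
         int n = 2 ^ \<sigma> + 2 ^ \<tau> + 2 ^ \<nu> - 3))}"

definition idx_5 :: "nat set" where
  "idx_5 = {n. n = 5 \<or>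
     (\<exists>\<sigma>::nat. 5 \<le> \<sigma> \<and> (int n = 2 ^ \<sigma> - 6 \<or> int n = 2 ^ \<sigma> - 12))}"

definition idx_6 :: "nat set" where
  "idx_6 = {n. n \<in> {6, 11, 14, 18, 19, 21, 33, 34, 35, 37} \<or>
     (\<exists>\<sigma>::nat. 5 \<le> \<sigma> \<and> (int n = 2 ^ \<sigma> - 2 \<or> int n = 2 ^ \<sigma> - 4)) \<or>
     (\<exists>\<sigma>::nat. 6 \<le> \<sigma> \<and>
        (int n = 2 ^ \<sigma> + 1 \<or> int n = 2 ^ \<sigma> + 2 \<or> int n = 2 ^ \<sigma> + 3 \<or> int n = 2 ^ \<sigma> + 4 \<or>
         int n = 2 ^ \<sigma> + 5 \<or> int n = 2 ^ \<sigma> + 10 \<or> int n = 2 ^ \<sigma> + 13)) \<or>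
     (\<exists>\<sigma> \<tau>::nat. 7 \<le> \<sigma> \<and> 5 \<le> \<tau> \<and> \<tau> \<le> \<sigma> - 2 \<and>
        (int n = 2 ^ \<sigma> + 2 ^ \<tau> - 3 \<or> int n = 2 ^ \<sigma> + 2 ^ \<tau> - 6 \<or>
         int n = 2 ^ \<sigma> + 2 ^ \<tau> - 12))}"

end

theory Submission
  imports Defs "HOL-Combinatorics.Cycles" "HOL-Computational_Algebra.Formal_Power_Series"
begin

text \<open>Subgroups of index \<open>n\<close> correspond to transitive actions on \<open>n\<close> points, and \<open>SL2Z\<close> is the amalgam
  of cyclic groups of orders 4 and 6 over their common subgroup of order 2, so its actions are pairs
  of permutations with \<open>b\<^sup>3 = a\<^sup>2\<close> and \<open>a\<^sup>4 = 1\<close>. We count separately the subgroups that contain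
  \<open>-1\<close>, for which \<open>a\<^sup>2 = 1\<close>, and those that do not, for which \<open>a\<^sup>2\<close> has no fixed points. In both
  cases the exponential generating function of the actions satisfies a linear differential equation
  of order two, so that its logarithmic derivative, the generating function of the subgroup numbers,
  satisfies a Riccati equation with integer coefficients. Modulo 8 this equation determines its
  solution, and a cubic polynomial in the series of all powers \<open>z^(2^k)\<close> is a solution. Its
  coefficients are given by conditions on the binary digits of \<open>n + d\<close> for a few shifts \<open>d\<close>.\<close>


section \<open>Counting actions by stabilisers\<close>

text \<open>The recurrence between actions and subgroups says \<open>z F' = P F\<close>, where
  \<open>F\<close> is the exponential series of the actions and \<open>P\<close> the series of
  subgroup numbers. \<open>F\<close> has denominators, but dividing a second-order linear equation
  for \<open>F\<close> by \<open>F\<close> leaves a first-order equation for \<open>P\<close> that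
  is quadratic and has integer coefficients, so it can be read modulo 8. Powers of two enter because
  the Euler operator \<open>z d/dz\<close> multiplies \<open>z^(2^k)\<close> by \<open>2^k\<close>:
  modulo 8 it sends the series of all \<open>z^(2^k)\<close> to the polynomial
  \<open>z + 2 z^2 + 4 z^4\<close>. The square of that series is again the series itself, minus
  \<open>z\<close>, plus twice the series of the numbers with digit sum 2. A candidate can therefore
  be checked in the Riccati equation by one polynomial identity. Digit sums up to 3 and the numbers
  \<open>3 * 2^s\<close> appear when the cubic is rewritten as a linear expression: sums of three
  powers of two lose their generic digit sum when exponents coincide, and two adjacent digits are
  reached in one way fewer.\<close>

lemma prod_minus_mult_fact:
  "k \<le> m \<Longrightarrow> prod ((-) m) {0..<k} * fact (m - k) = (fact m :: nat)"
proof (induction k)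
  case (Suc k)
  then have "fact (m - k) = (m - k) * (fact (m - Suc k) :: nat)"
    by (metis Suc_diff_Suc Suc_le_lessD diff_Suc_1 fact_Suc of_nat_id)
  with Suc show ?case by (simp add: mult_ac)
qed simp

context group
begin

text \<open>Right actions: the order of composition is reversed so that orbit maps are constant on
  the right cosets of \<open>rcosets\<close>. The functions are extensional on the carrier so that
  each action is counted once. The last clause makes \<open>c\<close> act trivially or without fixed
  points; with \<open>c = -1\<close> this separates the two kinds of subgroups.\<close>

definition acts :: "'a \<Rightarrow> bool \<Rightarrow> 'x set \<Rightarrow> ('a \<Rightarrow> 'x \<Rightarrow> 'x) set" where
  "acts c \<beta> V = {\<phi> \<in> extensional (carrier G). (\<forall>g\<in>carrier G. \<phi> g permutes V) \<and>
     (\<forall>g\<in>carrier G. \<forall>h\<in>carrier G. \<phi> (g \<otimes> h) = \<phi> h \<circ> \<phi> g) \<and>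
     (\<forall>v\<in>V. \<phi> c v = v \<longleftrightarrow> \<beta>)}"

text \<open>The possible orbit maps \<open>g \<mapsto> \<phi> g x\<close> of actions with stabiliser
  \<open>H\<close> at \<open>x\<close>; equivalently, the injective labellings of the right cosets
  of \<open>H\<close> by points of \<open>V\<close> in which \<open>H\<close> itself gets the label
  \<open>x\<close>.\<close>

definition pointed_maps :: "'a set \<Rightarrow> 'x set \<Rightarrow> 'x \<Rightarrow> ('a \<Rightarrow> 'x) set" where
  "pointed_maps H V x = {f \<in> carrier G \<rightarrow>\<^sub>E V. f \<one> = x \<and>
     (\<forall>g\<in>carrier G. \<forall>h\<in>carrier G. f g = f h \<longleftrightarrow> H #> g = H #> h)}"

lemma rcos_eq_iff:
  assumes "subgroup H G" "g \<in> carrier G" "h \<in> carrier G"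
  shows "H #> g = H #> h \<longleftrightarrow> g \<otimes> inv h \<in> H"
proof
  assume "H #> g = H #> h"
  then have "g \<in> H #> h"
    using rcos_self[OF assms(2,1)] by simp
  then show "g \<otimes> inv h \<in> H"
    using assms by (auto simp: r_coset_def m_assoc subgroup.mem_carrier)
next
  assume "g \<otimes> inv h \<in> H"
  then have "g \<in> H #> h"
    using assms by (auto simp: r_coset_def m_assoc intro!: bexI[of _ "g \<otimes> inv h"])
  then show "H #> g = H #> h"
    using repr_independence assms by metis
qed

lemma acts_one:
  assumes "\<phi> \<in> acts c \<beta> V" shows "\<phi> \<one> = id"
proof -
  have p: "\<phi> \<one> permutes V" and e: "\<phi> \<one> \<circ> \<phi> \<one> = \<phi> \<one>"
    using assms by (auto simp: acts_def, metis one_closed r_one)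
  show ?thesis
    using e permutes_inj[OF p] by (auto simp: fun_eq_iff inj_def)
qed

lemma acts_comp:
  "\<phi> \<in> acts c \<beta> V \<Longrightarrow> g \<in> carrier G \<Longrightarrow> h \<in> carrier G \<Longrightarrow> \<phi> (g \<otimes> h) v = \<phi> h (\<phi> g v)"
  by (simp add: acts_def)

lemma acts_permutes: "\<phi> \<in> acts c \<beta> V \<Longrightarrow> g \<in> carrier G \<Longrightarrow> \<phi> g permutes V"
  by (simp add: acts_def)

lemma acts_inv:
  "\<phi> \<in> acts c \<beta> V \<Longrightarrow> g \<in> carrier G \<Longrightarrow> \<phi> (inv g) (\<phi> g v) = v"
  using acts_comp[of \<phi> c \<beta> V g "inv g" v] acts_one[of \<phi> c \<beta> V] by simp

lemma acts_eq_iff: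
  assumes "\<phi> \<in> acts c \<beta> V" "g \<in> carrier G" "h \<in> carrier G"
  shows "\<phi> g x = \<phi> h x \<longleftrightarrow> \<phi> (g \<otimes> inv h) x = x"
proof -
  have "\<phi> (g \<otimes> inv h) x = \<phi> (inv h) (\<phi> g x)"
    using assms by (simp add: acts_comp)
  moreover have "\<phi> (inv h) (\<phi> g x) = x \<longleftrightarrow> \<phi> h (\<phi> (inv h) (\<phi> g x)) = \<phi> h x"
    using permutes_inj[OF acts_permutes[OF assms(1,3)]] by (auto simp: inj_def)
  moreover have "\<phi> h (\<phi> (inv h) (\<phi> g x)) = \<phi> g x"
    using acts_inv[OF assms(1), of "inv h"] assms by simp
  ultimately show ?thesis by simp
qed

definition stab :: "('a \<Rightarrow> 'x \<Rightarrow> 'x) \<Rightarrow> 'x \<Rightarrow> 'a set" where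
  "stab \<phi> x = {g \<in> carrier G. \<phi> g x = x}"

lemma subgroup_stab:
  assumes "\<phi> \<in> acts c \<beta> V" shows "subgroup (stab \<phi> x) G"
proof (rule subgroupI)
  show "stab \<phi> x \<noteq> {}"
    using acts_one[OF assms] by (auto simp: stab_def intro!: exI[of _ \<one>])
  fix g assume g: "g \<in> stab \<phi> x"
  then show "inv g \<in> stab \<phi> x"
    using acts_inv[OF assms, of g x] by (auto simp: stab_def)
  fix h assume "h \<in> stab \<phi> x"
  with g show "g \<otimes> h \<in> stab \<phi> x"
    using acts_comp[OF assms] by (auto simp: stab_def)
qed (auto simp: stab_def)

lemma orbit_map_in_pointed_maps:
  assumes "\<phi> \<in> acts c \<beta> V" "x \<in> V"
  shows "(\<lambda>g\<in>carrier G. \<phi> g x) \<in> pointed_maps (stab \<phi> x) V x"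
  using assms acts_permutes[OF assms(1)] acts_eq_iff[OF assms(1)] acts_one[OF assms(1)]
    rcos_eq_iff[OF subgroup_stab[OF assms(1)]]
  by (auto simp: pointed_maps_def stab_def permutes_in_image)

text \<open>An orbit map remembers its subgroup. Distinct subgroups thus have disjoint sets of
  pointed maps, on which the disjoint union in \<open>card_acts\<close> rests.\<close>

lemma pointed_maps_stab:
  assumes "f \<in> pointed_maps H V x" "subgroup H G"
  shows "{g \<in> carrier G. f g = x} = H"
proof -
  have "f g = x \<longleftrightarrow> g \<in> H" if "g \<in> carrier G" for g
  proof -
    have "f g = x \<longleftrightarrow> H #> g = H #> \<one>"
      using assms that by (auto simp: pointed_maps_def)
    then show ?thesis
      using rcos_eq_iff[OF assms(2) that one_closed] that by simp
  qed
  then show ?thesis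
    using subgroup.subset[OF assms(2)] by blast
qed

lemma pointed_maps_image:
  assumes "f \<in> pointed_maps H V x" "subgroup H G"
  shows "card (f ` carrier G) = card (rcosets H)"
proof -
  \<comment> \<open>The descent of \<open>f\<close> to cosets. The chosen representative does not
    matter because \<open>f\<close> is constant on each coset.\<close>
  define F where "F C = f (SOME g. g \<in> carrier G \<and> C = H #> g)" for C
  have F: "F (H #> g) = f g" if "g \<in> carrier G" for g
  proof -
    have "\<exists>h. h \<in> carrier G \<and> H #> g = H #> h"
      using that by blast
    then have "(SOME h. h \<in> carrier G \<and> H #> g = H #> h) \<in> carrier G \<and>
      H #> g = H #> (SOME h. h \<in> carrier G \<and> H #> g = H #> h)"
      by (rule someI_ex)
    then show ?thesis
      using assms(1) that unfolding F_def pointed_maps_def by blast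
  qed
  have "inj_on F (rcosets H)"
    using assms(1) F by (fastforce simp: inj_on_def RCOSETS_def pointed_maps_def)
  moreover have "F ` (rcosets H) = f ` carrier G"
    using F by (force simp: RCOSETS_def)
  ultimately show ?thesis
    by (metis card_image)
qed

text \<open>The label of \<open>H\<close> is prescribed, so what remains free is an injection of the
  other cosets into \<open>V - {x}\<close>. The count \<open>(|V| - 1)! / (|V| - k)!\<close>, with
  \<open>k\<close> the index, is stated as a product to avoid a division.\<close>

lemma card_pointed_maps:
  assumes H: "subgroup H G" and fin: "finite (rcosets H)" and V: "finite V" "x \<in> V"
    and le: "card (rcosets H) \<le> card V"
  shows "card (pointed_maps H V x) * fact (card V - card (rcosets H)) = fact (card V - 1)"
proof -
  let ?R = "rcosets H - {H}"
  let ?rep = "\<lambda>C. SOME g. g \<in> carrier G \<and> C = H #> g"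
  let ?I = "{F \<in> ?R \<rightarrow>\<^sub>E (V - {x}). inj_on F ?R}"
  have HR: "H \<in> rcosets H"
    using H by (metis coset_join2 one_closed rcosetsI subgroup.one_closed subgroup.subset)
  have coset: "H #> g = H \<longleftrightarrow> g \<in> H" if "g \<in> carrier G" for g
    using H that coset_join1 coset_join2 subgroup.subset by metis
  \<comment> \<open>An injection of the nontrivial cosets is spread over the group, with
    \<open>x\<close> assigned to \<open>H\<close>; the inverse evaluates a pointed map at a chosen
    representative of each coset.\<close>
  have "bij_betw (\<lambda>F. \<lambda>g\<in>carrier G. if g \<in> H then x else F (H #> g)) ?I (pointed_maps H V x)"
    (is "bij_betw ?T _ _")
  proof (rule bij_betw_byWitness[where f' = "\<lambda>f. \<lambda>C\<in>?R. f (?rep C)"])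
    have some: "?rep C \<in> carrier G \<and>
      C = H #> (?rep C)" if "C \<in> rcosets H" for C
      using that by (rule_tac someI_ex) (auto simp: RCOSETS_def)
    show "\<forall>F\<in>?I. (\<lambda>C\<in>?R. ?T F (?rep C)) = F"
    proof (intro ballI ext)
      fix F C assume F: "F \<in> ?I"
      show "(\<lambda>C\<in>?R. ?T F (?rep C)) C = F C"
      proof (cases "C \<in> ?R")
        case True
        then show ?thesis
          using some[of C] coset[of "?rep C"] by auto
      next
        case False
        then have "F C = undefined"
          using F by (auto simp: PiE_def extensional_def)
        with False show ?thesis by auto
      qed
    qed
    show "\<forall>f\<in>pointed_maps H V x. ?T (\<lambda>C\<in>?R. f (?rep C)) = f"
    proof (intro ballI ext)
      fix f g assume f: "f \<in> pointed_maps H V x"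
      show "?T (\<lambda>C\<in>?R. f (?rep C)) g = f g"
      proof (cases "g \<in> carrier G")
        case True
        have "H #> g \<in> rcosets H"
          using True by (auto simp: RCOSETS_def)
        then have "f (?rep (H #> g)) = f g"
          using some[of "H #> g"] f True unfolding pointed_maps_def by blast
        then show ?thesis
          using True pointed_maps_stab[OF f H] coset[OF True] \<open>H #> g \<in> rcosets H\<close> by auto
      next
        case False
        then show ?thesis
          using f by (auto simp: pointed_maps_def PiE_def extensional_def)
      qed
    qed
    show "?T ` ?I \<subseteq> pointed_maps H V x"
    proof clarify
      fix F assume F: "F \<in> ?R \<rightarrow>\<^sub>E (V - {x})" and inj: "inj_on F ?R"
      have mem: "H #> g \<in> ?R" if "g \<in> carrier G" "g \<notin> H" for g
        using that coset by (auto simp: RCOSETS_def)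
      have Fx: "F (H #> g) \<in> V - {x}" if "g \<in> carrier G" "g \<notin> H" for g
        using F mem[OF that] by (auto simp: PiE_def Pi_def)
      show "?T F \<in> pointed_maps H V x"
        unfolding pointed_maps_def
      proof (intro CollectI conjI ballI)
        show "?T F \<in> carrier G \<rightarrow>\<^sub>E V"
          using Fx V by auto
        show "?T F \<one> = x"
          using subgroup.one_closed[OF H] by simp
        fix g h assume gh: "g \<in> carrier G" "h \<in> carrier G"
        consider "g \<in> H" "h \<in> H" | "g \<in> H" "h \<notin> H" | "g \<notin> H" "h \<in> H" | "g \<notin> H" "h \<notin> H"
          by blast
        then show "?T F g = ?T F h \<longleftrightarrow> H #> g = H #> h"
        proof cases
          case 1
          with gh coset[OF gh(1)] coset[OF gh(2)] show ?thesis by simp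
        next
          case 2
          with gh coset[OF gh(1)] coset[OF gh(2)] Fx[of h] show ?thesis by auto
        next
          case 3
          with gh coset[OF gh(1)] coset[OF gh(2)] Fx[of g] show ?thesis by auto
        next
          case 4
          with gh inj_on_eq_iff[OF inj mem[OF gh(1)] mem[OF gh(2)]] show ?thesis by simp
        qed
      qed
    qed
    show "(\<lambda>f. \<lambda>C\<in>?R. f (?rep C)) ` pointed_maps H V x \<subseteq> ?I"
    proof clarify
      fix f assume f: "f \<in> pointed_maps H V x"
      let ?F = "\<lambda>C\<in>?R. f (?rep C)"
      have "?F C \<in> V - {x}" if C: "C \<in> ?R" for C
      proof -
        let ?g = "?rep C"
        have g: "?g \<in> carrier G" "C = H #> ?g" using some C by blast+
        have "?g \<notin> H" using g coset[of ?g] C by auto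
        then have "f ?g \<noteq> x" using pointed_maps_stab[OF f H] g(1) by blast
        then show ?thesis using f g(1) C by (auto simp: pointed_maps_def)
      qed
      moreover have "inj_on ?F ?R"
      proof (rule inj_onI)
        fix C D assume CD: "C \<in> ?R" "D \<in> ?R" "?F C = ?F D"
        then have "f (?rep C) = f (?rep D)"
          by simp
        moreover have C: "C \<in> rcosets H" and D: "D \<in> rcosets H"
          using CD by blast+
        ultimately have "H #> (?rep C) = H #> (?rep D)"
          using f some[OF C] some[OF D] unfolding pointed_maps_def by blast
        then show "C = D"
          using some[OF C] some[OF D] by simp
      qed
      ultimately show "?F \<in> ?R \<rightarrow>\<^sub>E (V - {x}) \<and> inj_on ?F ?R"
        by auto
    qed
  qed
  then have "card (pointed_maps H V x) = card ?I"
    by (simp add: bij_betw_same_card)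
  also have "card ?I = prod ((-) (card V - 1)) {0..<card (rcosets H) - 1}"
    using card_inj_on_subset_funcset[of ?R "V - {x}" ?R] fin HR V by simp
  finally have "card (pointed_maps H V x) = prod ((-) (card V - 1)) {0..<card (rcosets H) - 1}" .
  moreover have "card (rcosets H) > 0"
    using fin HR card_gt_0_iff by blast
  moreover from this have "card V - card (rcosets H) = (card V - 1) - (card (rcosets H) - 1)"
    using le by linarith
  ultimately show ?thesis
    using prod_minus_mult_fact[of "card (rcosets H) - 1" "card V - 1"] le by simp
qed

end

context group
begin

text \<open>An action is glued from its orbit map \<open>f\<close> at the base point and its restriction \<open>\<psi>\<close> to the
  complement of the orbit.\<close>
definition glue :: "('a \<Rightarrow> 'x) \<Rightarrow> ('a \<Rightarrow> 'x \<Rightarrow> 'x) \<Rightarrow> 'a \<Rightarrow> 'x \<Rightarrow> 'x" where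
  "glue f \<psi> = (\<lambda>g\<in>carrier G. \<lambda>v. if v \<in> f ` carrier G
     then f ((SOME h. h \<in> carrier G \<and> f h = v) \<otimes> g) else \<psi> g v)"

text \<open>Right multiplication by \<open>k\<close> does not change the quotient
  \<open>g \<otimes> inv h\<close>, which decides equality of cosets. Hence \<open>glue\<close> does
  not depend on the element picked by \<open>SOME\<close>.\<close>

lemma pointed_maps_mult:
  assumes "f \<in> pointed_maps H V x" "subgroup H G" "g \<in> carrier G" "h \<in> carrier G" "k \<in> carrier G"
  shows "f (g \<otimes> k) = f (h \<otimes> k) \<longleftrightarrow> f g = f h"
proof -
  have "g \<otimes> k \<otimes> inv (h \<otimes> k) = g \<otimes> inv h"
    using assms by (simp add: inv_mult_group m_assoc[symmetric]) (simp add: m_assoc)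
  then have "H #> (g \<otimes> k) = H #> (h \<otimes> k) \<longleftrightarrow> H #> g = H #> h"
    using assms rcos_eq_iff[OF assms(2)] by simp
  then show ?thesis
    using assms by (simp add: pointed_maps_def)
qed

lemma glue_orbit:
  assumes f: "f \<in> pointed_maps H V x" "subgroup H G" and g: "g \<in> carrier G" "h \<in> carrier G"
  shows "glue f \<psi> g (f h) = f (h \<otimes> g)"
proof -
  have "(SOME h'. h' \<in> carrier G \<and> f h' = f h) \<in> carrier G \<and> f (SOME h'. h' \<in> carrier G \<and> f h' = f h) = f h"
    using g by (rule_tac someI_ex) auto
  then show ?thesis
    using pointed_maps_mult[OF f _ g(2,1), of "SOME h'. h' \<in> carrier G \<and> f h' = f h"] g
    by (simp add: glue_def)
qed

lemma glue_off_orbit: "g \<in> carrier G \<Longrightarrow> v \<notin> f ` carrier G \<Longrightarrow> glue f \<psi> g v = \<psi> g v"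
  by (simp add: glue_def)

lemma glue_in_acts:
  assumes f: "f \<in> pointed_maps H V x" "subgroup H G"
    and c: "c \<in> carrier G" "\<And>g. g \<in> carrier G \<Longrightarrow> c \<otimes> g = g \<otimes> c" "c \<in> H \<longleftrightarrow> \<beta>"
    and \<psi>: "\<psi> \<in> acts c \<beta> (V - f ` carrier G)"
  shows "glue f \<psi> \<in> acts c \<beta> V"
proof -
  let ?O = "f ` carrier G"
  have O: "?O \<subseteq> V"
    using f by (auto simp: pointed_maps_def)
  have off: "\<psi> g v \<in> ?O \<longleftrightarrow> v \<in> ?O" if "g \<in> carrier G" for g v
  proof (cases "v \<in> V")
    case True
    then show ?thesis
      using permutes_in_image[OF acts_permutes[OF \<psi> that], of v] permutes_not_in[OF acts_permutes[OF \<psi> that], of v] O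
      by auto
  next
    case False
    then show ?thesis
      using permutes_not_in[OF acts_permutes[OF \<psi> that], of v] by auto
  qed
  have comp: "glue f \<psi> (g \<otimes> h) v = glue f \<psi> h (glue f \<psi> g v)"
    if gh: "g \<in> carrier G" "h \<in> carrier G" for g h v
  proof (cases "v \<in> ?O")
    case True
    then obtain k where k: "k \<in> carrier G" "v = f k" by blast
    with gh show ?thesis
      by (simp add: glue_orbit[OF f] m_assoc)
  next
    case False
    with gh off[OF gh(1)] show ?thesis
      by (simp add: glue_off_orbit acts_comp[OF \<psi>])
  qed
  have one: "glue f \<psi> \<one> v = v" for v
    using glue_orbit[OF f, of \<one> _ \<psi>] glue_off_orbit[of \<one> v f \<psi>] acts_one[OF \<psi>]
    by (cases "v \<in> ?O") auto
  have perm: "glue f \<psi> g permutes V" if g: "g \<in> carrier G" for g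
    unfolding permutes_def
  proof (intro conjI allI impI ex1I)
    fix v assume "v \<notin> V"
    then have "v \<notin> ?O" using O by blast
    then show "glue f \<psi> g v = v"
      using g \<open>v \<notin> V\<close> permutes_not_in[OF acts_permutes[OF \<psi> g]] by (simp add: glue_off_orbit)
  next
    fix y
    show "glue f \<psi> g (glue f \<psi> (inv g) y) = y"
      using comp[of "inv g" g y] one g by simp
    fix v assume "glue f \<psi> g v = y"
    then show "v = glue f \<psi> (inv g) y"
      using comp[of g "inv g" v] one g by simp
  qed
  have cent: "glue f \<psi> c v = v \<longleftrightarrow> \<beta>" if v: "v \<in> V" for v
  proof (cases "v \<in> ?O")
    case True
    then obtain h where h: "h \<in> carrier G" "v = f h" by blast
    \<comment> \<open>Centrality enters here: with \<open>c\<close> to the left of \<open>h\<close>,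
      the question whether \<open>c\<close> fixes the point \<open>f h\<close> becomes membership of
      \<open>c\<close> in \<open>H\<close>, with the same answer at every point of the
      orbit.\<close>
    have "f (h \<otimes> c) = f h \<longleftrightarrow> H #> (c \<otimes> h) = H #> h"
      using f h c by (simp add: pointed_maps_def)
    also have "\<dots> \<longleftrightarrow> c \<otimes> h \<otimes> inv h \<in> H"
      using h c(1) by (simp add: rcos_eq_iff[OF f(2)])
    also have "c \<otimes> h \<otimes> inv h = c"
      using h c(1) by (simp add: m_assoc)
    also have "c \<in> H \<longleftrightarrow> \<beta>"
      by (fact c(3))
    finally show ?thesis
      using h c by (simp add: glue_orbit[OF f])
  next
    case False
    then show ?thesis
      using \<psi> v c(1) by (simp add: glue_off_orbit acts_def)
  qed
  show ?thesis
    using perm comp cent by (auto simp: acts_def fun_eq_iff) (simp add: glue_def)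
qed

text \<open>Once the orbit map of the base point is fixed, what remains is a free choice of an
  action on the other points. This is the source of the factor \<open>a (n - k)\<close> in the
  recurrence.\<close>

lemma bij_betw_glue:
  assumes f: "f \<in> pointed_maps H V x" "subgroup H G"
    and c: "c \<in> carrier G" "\<And>g. g \<in> carrier G \<Longrightarrow> c \<otimes> g = g \<otimes> c" "c \<in> H \<longleftrightarrow> \<beta>"
  shows "bij_betw (glue f) (acts c \<beta> (V - f ` carrier G))
    {\<phi> \<in> acts c \<beta> V. (\<lambda>g\<in>carrier G. \<phi> g x) = f}"
proof -
  let ?P = "{\<phi> \<in> acts c \<beta> V. (\<lambda>g\<in>carrier G. \<phi> g x) = f}"
  let ?O = "f ` carrier G"
  \<comment> \<open>The inverse of gluing restricts an action to the complement of the orbit. Points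
    of the orbit become fixed, since \<open>permutes\<close> demands the identity off its
    set.\<close>
  let ?res = "\<lambda>\<phi>. \<lambda>g\<in>carrier G. \<lambda>v. if v \<in> V - ?O then \<phi> g v else v"
  have fx: "f \<one> = x" and fext: "f \<in> extensional (carrier G)" and O: "?O \<subseteq> V"
    using f by (auto simp: pointed_maps_def PiE_def)
  have res: "?res \<phi> \<in> acts c \<beta> (V - ?O)" and glue_res: "glue f (?res \<phi>) = \<phi>"
    if \<phi>: "\<phi> \<in> acts c \<beta> V" and orb: "(\<lambda>g\<in>carrier G. \<phi> g x) = f" for \<phi>
  proof -
    have f_eq: "f g = \<phi> g x" if "g \<in> carrier G" for g
      using that orb by auto
    have O_iff: "\<phi> g v \<in> ?O \<longleftrightarrow> v \<in> ?O" if g: "g \<in> carrier G" for g v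
    proof
      assume "\<phi> g v \<in> ?O"
      then obtain h where h: "h \<in> carrier G" "\<phi> g v = \<phi> h x" using f_eq by auto
      then have "v = \<phi> (h \<otimes> inv g) x"
        using acts_inv[OF \<phi> g, of v] acts_comp[OF \<phi>] g by simp
      then show "v \<in> ?O" using h g f_eq by auto
    next
      assume "v \<in> ?O"
      then obtain h where h: "h \<in> carrier G" "v = \<phi> h x" using f_eq by auto
      then have "\<phi> g v = f (h \<otimes> g)"
        using g f_eq acts_comp[OF \<phi>] by simp
      then show "\<phi> g v \<in> ?O" using h g by auto
    qed
    have V_iff: "\<phi> g v \<in> V \<longleftrightarrow> v \<in> V" if "g \<in> carrier G" for g v
      using permutes_in_image[OF acts_permutes[OF \<phi> that]] .
    have perm: "?res \<phi> g permutes V - ?O" if g: "g \<in> carrier G" for g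
      unfolding permutes_def
    proof (intro conjI allI impI ex1I)
      fix y
      show "?res \<phi> g (?res \<phi> (inv g) y) = y"
        using g O_iff[of "inv g" y] V_iff[of "inv g" y] acts_inv[OF \<phi>, of "inv g" y] by auto
      fix v assume "?res \<phi> g v = y"
      then show "v = ?res \<phi> (inv g) y"
        using g O_iff[of g v] V_iff[of g v] acts_inv[OF \<phi>, of g v] by (auto split: if_splits)
    qed (use g in auto)
    have comp: "?res \<phi> (g \<otimes> h) = ?res \<phi> h \<circ> ?res \<phi> g"
      if "g \<in> carrier G" "h \<in> carrier G" for g h
      using that O_iff[of g] V_iff[of g] by (auto simp: fun_eq_iff acts_comp[OF \<phi>])
    have cent: "?res \<phi> c v = v \<longleftrightarrow> \<beta>" if "v \<in> V - ?O" for v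
      using that c(1) \<phi> by (auto simp: acts_def)
    show "?res \<phi> \<in> acts c \<beta> (V - ?O)"
      using perm comp cent unfolding acts_def by blast
    show "glue f (?res \<phi>) = \<phi>"
    proof (intro ext)
      fix g v
      show "glue f (?res \<phi>) g v = \<phi> g v"
      proof (cases "g \<in> carrier G")
        case g: True
        show ?thesis
        proof (cases "v \<in> ?O")
          case True
          then obtain h where h: "h \<in> carrier G" "v = f h" by blast
          with g show ?thesis
            by (simp add: glue_orbit[OF f]) (simp add: f_eq acts_comp[OF \<phi>])
        next
          case False
          with g show ?thesis
            using permutes_not_in[OF acts_permutes[OF \<phi> g], of v] by (auto simp: glue_off_orbit)
        qed
      next
        case False
        then show ?thesis
          using \<phi> by (simp add: glue_def acts_def extensional_def)
      qed
    qed
  qed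
  have orb: "(\<lambda>g\<in>carrier G. glue f \<psi> g x) = f" for \<psi>
  proof
    fix g show "(\<lambda>g\<in>carrier G. glue f \<psi> g x) g = f g"
      using glue_orbit[OF f, of g \<one> \<psi>] fx fext by (cases "g \<in> carrier G") (auto simp: extensional_def)
  qed
  have res_glue: "?res (glue f \<psi>) = \<psi>" if \<psi>: "\<psi> \<in> acts c \<beta> (V - ?O)" for \<psi>
  proof (intro ext)
    fix g v show "?res (glue f \<psi>) g v = \<psi> g v"
      using \<psi> permutes_not_in[OF acts_permutes[OF \<psi>], of g v]
      by (auto simp: acts_def extensional_def glue_off_orbit)
  qed
  show ?thesis
  proof (rule bij_betw_byWitness[where f' = ?res])
    show "\<forall>\<psi>\<in>acts c \<beta> (V - ?O). ?res (glue f \<psi>) = \<psi>"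
      using res_glue by blast
    show "\<forall>\<phi>\<in>?P. glue f (?res \<phi>) = \<phi>"
      using glue_res by blast
    show "glue f ` acts c \<beta> (V - ?O) \<subseteq> ?P"
      using glue_in_acts[OF f c] orb by blast
    show "?res ` ?P \<subseteq> acts c \<beta> (V - ?O)"
      using res by blast
  qed
qed

definition subgroups_of_index :: "'a \<Rightarrow> bool \<Rightarrow> nat \<Rightarrow> 'a set set" where
  "subgroups_of_index c \<beta> k = {H. subgroup H G \<and> card (rcosets H) = k \<and> (c \<in> H \<longleftrightarrow> \<beta>)}"

text \<open>Every such subgroup is the stabiliser of 0 in its coset action, transported to
  \<open>k\<close> labels, and there are finitely many actions. The condition \<open>k > 0\<close>
  shuts out the subgroups with infinitely many cosets, for which \<open>card\<close> returns
  0.\<close>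

lemma finite_subgroups_of_index:
  assumes c: "c \<in> carrier G" "\<And>g. g \<in> carrier G \<Longrightarrow> c \<otimes> g = g \<otimes> c"
    and fin: "finite (acts c \<beta> {..<k::nat})" and k: "k > 0"
  shows "finite (subgroups_of_index c \<beta> k)"
proof (rule finite_subset)
  show "subgroups_of_index c \<beta> k \<subseteq> (\<lambda>\<phi>. stab \<phi> 0) ` acts c \<beta> {..<k}"
  proof
    fix H assume "H \<in> subgroups_of_index c \<beta> k"
    then have H: "subgroup H G" "card (rcosets H) = k" "c \<in> H \<longleftrightarrow> \<beta>"
      by (auto simp: subgroups_of_index_def)
    have "finite (rcosets H)"
      using H(2) k by (simp add: card_ge_0_finite)
    then have "card (pointed_maps H {..<k} 0) \<noteq> 0"
      using card_pointed_maps[OF H(1), of "{..<k}" 0] H(2) k by auto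
    then obtain f where f: "f \<in> pointed_maps H {..<k} 0"
      by fastforce
    have "f ` carrier G = {..<k}"
      using f pointed_maps_image[OF f H(1)] H(2)
      by (intro card_subset_eq) (auto simp: pointed_maps_def)
    \<comment> \<open>The orbit fills all \<open>k\<close> labels, so the action still to be glued
      lives on the empty set.\<close>
    then have "(\<lambda>g\<in>carrier G. id) \<in> acts c \<beta> ({..<k} - f ` carrier G)"
      by (simp add: acts_def)
    from bij_betw_apply[OF bij_betw_glue[OF f H(1) c H(3)] this]
    obtain \<phi> where \<phi>: "\<phi> \<in> acts c \<beta> {..<k}" "(\<lambda>g\<in>carrier G. \<phi> g 0) = f"
      by auto
    have "stab \<phi> 0 = {g \<in> carrier G. f g = 0}"
      unfolding \<phi>(2)[symmetric] stab_def by auto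
    also have "\<dots> = H"
      using pointed_maps_stab[OF f H(1)] .
    finally show "H \<in> (\<lambda>\<phi>. stab \<phi> 0) ` acts c \<beta> {..<k}"
      using \<phi>(1) by blast
  qed
qed (use fin in simp)

text \<open>An action on \<open>n\<close> points is determined by the stabiliser of a base point, the labelling of its
  orbit and the action on the complement of the orbit.\<close>
theorem card_acts:
  assumes c: "c \<in> carrier G" "\<And>g. g \<in> carrier G \<Longrightarrow> c \<otimes> g = g \<otimes> c"
    and fin: "\<And>W. finite (W::nat set) \<Longrightarrow> finite (acts c \<beta> W)"
    and a: "\<And>W. finite (W::nat set) \<Longrightarrow> card (acts c \<beta> W) = a (card W)"
    and n: "n > 0"
  shows "a n = (\<Sum>k=1..n. card (subgroups_of_index c \<beta> k) * (fact (n - 1) div fact (n - k)) * a (n - k))"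
proof -
  let ?V = "{..<n}"
  let ?S = "\<lambda>k. subgroups_of_index c \<beta> k"
  let ?A = "\<lambda>f. {\<phi> \<in> acts c \<beta> ?V. (\<lambda>g\<in>carrier G. \<phi> g 0) = f}"
  \<comment> \<open>An orbit among \<open>n\<close> points has between 1 and \<open>n\<close>
    points, so these are the only subgroups that occur as stabilisers of 0.\<close>
  define Hs where "Hs = (\<Union>k\<in>{1..n}. ?S k)"
  have S: "subgroup H G" "card (rcosets H) = k" "c \<in> H \<longleftrightarrow> \<beta>" if "H \<in> ?S k" for H k
    using that by (auto simp: subgroups_of_index_def)
  have finS: "finite (?S k)" if "k > 0" for k
    using finite_subgroups_of_index[OF c fin that] by simp
  have Hs: "subgroup H G" "c \<in> H \<longleftrightarrow> \<beta>" "finite (rcosets H)" "card (rcosets H) \<in> {1..n}" if "H \<in> Hs" for H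
    using that by (auto simp: Hs_def subgroups_of_index_def intro: card_ge_0_finite)
  have finPM: "finite (pointed_maps H ?V 0)" if "H \<in> Hs" for H
    using card_pointed_maps[OF Hs(1,3)[OF that], of ?V 0] Hs(4)[OF that] n
    by (intro card_ge_0_finite) (auto intro!: Nat.gr0I)
  have cardA: "card (?A f) = a (n - card (rcosets H))" if "H \<in> Hs" "f \<in> pointed_maps H ?V 0" for H f
  proof -
    have "card (?A f) = card (acts c \<beta> (?V - f ` carrier G))"
      using bij_betw_same_card[OF bij_betw_glue[OF that(2) Hs(1)[OF that(1)] c Hs(2)[OF that(1)]]] by simp
    also have "\<dots> = a (card (?V - f ` carrier G))"
      by (simp add: a)
    also have "card (?V - f ` carrier G) = n - card (rcosets H)"
    proof -
      have "f ` carrier G \<subseteq> ?V"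
        using that(2) by (auto simp: pointed_maps_def)
      then show ?thesis
        using pointed_maps_image[OF that(2) Hs(1)[OF that(1)]] card_Diff_subset[of "f ` carrier G" ?V]
          finite_subset[of "f ` carrier G" ?V] by simp
    qed
    finally show ?thesis .
  qed
  have "acts c \<beta> ?V = (\<Union>H\<in>Hs. \<Union>f\<in>pointed_maps H ?V 0. ?A f)"
  proof (intro equalityI subsetI)
    fix \<phi> assume \<phi>: "\<phi> \<in> acts c \<beta> ?V"
    let ?f = "\<lambda>g\<in>carrier G. \<phi> g 0"
    have f: "?f \<in> pointed_maps (stab \<phi> 0) ?V 0"
      using orbit_map_in_pointed_maps[OF \<phi>] n by simp
    have sub: "subgroup (stab \<phi> 0) G"
      using subgroup_stab[OF \<phi>] .
    have "?f ` carrier G \<subseteq> ?V" "?f ` carrier G \<noteq> {}"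
      using f one_closed by (auto simp: pointed_maps_def)
    then have "card (?f ` carrier G) \<in> {1..n}"
      using card_mono[of ?V "?f ` carrier G"] finite_subset[of "?f ` carrier G" ?V]
      by (simp add: Suc_le_eq card_gt_0_iff)
    moreover have "c \<in> stab \<phi> 0 \<longleftrightarrow> \<beta>"
      using \<phi> c n by (auto simp: acts_def stab_def)
    ultimately have "stab \<phi> 0 \<in> Hs"
      using pointed_maps_image[OF f sub] sub by (auto simp: Hs_def subgroups_of_index_def)
    then show "\<phi> \<in> (\<Union>H\<in>Hs. \<Union>f\<in>pointed_maps H ?V 0. ?A f)"
      using f \<phi> by blast
  qed auto
  then have "a n = card (\<Union>H\<in>Hs. \<Union>f\<in>pointed_maps H ?V 0. ?A f)"
    using a[of ?V] by simp
  also have "\<dots> = (\<Sum>H\<in>Hs. card (\<Union>f\<in>pointed_maps H ?V 0. ?A f))"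
  proof (rule card_UN_disjoint)
    show "finite Hs"
      using finS by (simp add: Hs_def)
    show "\<forall>H\<in>Hs. finite (\<Union>f\<in>pointed_maps H ?V 0. ?A f)"
      by (auto intro: finite_subset[OF _ fin[of ?V]])
    show "\<forall>H\<in>Hs. \<forall>K\<in>Hs. H \<noteq> K \<longrightarrow>
      (\<Union>f\<in>pointed_maps H ?V 0. ?A f) \<inter> (\<Union>f\<in>pointed_maps K ?V 0. ?A f) = {}"
    proof (intro ballI impI)
      fix H K assume HK: "H \<in> Hs" "K \<in> Hs" "H \<noteq> K"
      then have "pointed_maps H ?V 0 \<inter> pointed_maps K ?V 0 = {}"
        using pointed_maps_stab[of _ H ?V 0] pointed_maps_stab[of _ K ?V 0] Hs(1) by blast
      then show "(\<Union>f\<in>pointed_maps H ?V 0. ?A f) \<inter> (\<Union>f\<in>pointed_maps K ?V 0. ?A f) = {}"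
        by auto
    qed
  qed
  also have "\<dots> = (\<Sum>H\<in>Hs. fact (n - 1) div fact (n - card (rcosets H)) * a (n - card (rcosets H)))"
  proof (rule sum.cong[OF refl])
    fix H assume H: "H \<in> Hs"
    have "card (\<Union>f\<in>pointed_maps H ?V 0. ?A f) = (\<Sum>f\<in>pointed_maps H ?V 0. card (?A f))"
      using finPM[OF H] by (intro card_UN_disjoint) (auto intro: finite_subset[OF _ fin[of ?V]])
    also have "\<dots> = card (pointed_maps H ?V 0) * a (n - card (rcosets H))"
      using cardA[OF H] by simp
    also have "card (pointed_maps H ?V 0) = fact (n - 1) div fact (n - card (rcosets H))"
    proof -
      have "card (pointed_maps H ?V 0) * fact (n - card (rcosets H)) = fact (n - 1)"
        using card_pointed_maps[OF Hs(1,3)[OF H], of ?V 0] Hs(4)[OF H] n by simp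
      then show ?thesis
        by (metis fact_nonzero nonzero_mult_div_cancel_right)
    qed
    finally show "card (\<Union>f\<in>pointed_maps H ?V 0. ?A f)
      = fact (n - 1) div fact (n - card (rcosets H)) * a (n - card (rcosets H))" .
  qed
  also have "\<dots> = (\<Sum>k=1..n. \<Sum>H\<in>?S k. fact (n - 1) div fact (n - card (rcosets H)) * a (n - card (rcosets H)))"
    unfolding Hs_def using finS by (intro sum.UNION_disjoint) (auto simp: subgroups_of_index_def)
  also have "\<dots> = (\<Sum>k=1..n. card (?S k) * (fact (n - 1) div fact (n - k)) * a (n - k))"
    using S(2) by (intro sum.cong refl) (simp add: mult_ac)
  finally show ?thesis .
qed

end

section \<open>A normal form in the modular group\<close>

text \<open>Generators of orders 4 and 6: the square of \<open>mS\<close> and the cube of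
  \<open>mU\<close> are both \<open>-1\<close>.\<close>

definition mS :: "int ^ 2 ^ 2" where "mS = vector [vector [0, -1], vector [1, 0]]"
definition mU :: "int ^ 2 ^ 2" where "mU = vector [vector [0, -1], vector [1, 1]]"

lemmas mat2_simps = vec_eq_iff forall_2 matrix_matrix_mult_def sum_2 mat_def

lemma mS_nth [simp]: "mS $ 1 $ 1 = 0" "mS $ 1 $ 2 = -1" "mS $ 2 $ 1 = 1" "mS $ 2 $ 2 = 0"
  by (simp_all add: mS_def)

lemma mU_nth [simp]: "mU $ 1 $ 1 = 0" "mU $ 1 $ 2 = -1" "mU $ 2 $ 1 = 1" "mU $ 2 $ 2 = 1"
  by (simp_all add: mU_def)

lemma det_mS: "det mS = 1" and det_mU: "det mU = 1"
  by (simp_all add: det_2)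

lemma minus_mat_mult: "(- A) ** B = - (A ** B :: int ^ 2 ^ 2)" "A ** (- B) = - (A ** B :: int ^ 2 ^ 2)"
  by (simp_all add: mat2_simps sum_negf)

lemma mS_mS: "mS ** (mS ** A) = - A"
  by (simp add: mat2_simps)

lemma mU_mU_mU: "mU ** (mU ** (mU ** A)) = - A"
  by (simp add: mat2_simps)

text \<open>The subgroup of \<open>SL2Z \<times> Sym(V)\<close> generated by \<open>(mS, a)\<close> and \<open>(mU, b)\<close>, where
  permutations are composed in reverse order.\<close>
inductive words :: "('x \<Rightarrow> 'x) \<Rightarrow> ('x \<Rightarrow> 'x) \<Rightarrow> int ^ 2 ^ 2 \<Rightarrow> ('x \<Rightarrow> 'x) \<Rightarrow> bool" for a b where
  one: "words a b (mat 1) id"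
| S: "words a b A p \<Longrightarrow> words a b (mS ** A) (p \<circ> a)"
| U: "words a b A p \<Longrightarrow> words a b (mU ** A) (p \<circ> b)"

lemma words_uminus: "words a b A p \<Longrightarrow> words a b (- A) (p \<circ> a \<circ> a)"
  using words.S[OF words.S[of a b A p]] by (simp add: mS_mS)

lemma words_mult: "words a b A p \<Longrightarrow> words a b B q \<Longrightarrow> words a b (A ** B) (q \<circ> p)"
  by (induction rule: words.induct)
    (auto simp: matrix_mul_assoc[symmetric] comp_assoc[symmetric] intro: words.intros)

lemma words_det: "words a b A p \<Longrightarrow> det A = 1"
  by (induction rule: words.induct) (auto simp: det_mul det_I det_mS det_mU)

lemma words_permutes: "words a b A p \<Longrightarrow> a permutes V \<Longrightarrow> b permutes V \<Longrightarrow> p permutes V"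
  by (induction rule: words.induct) (auto intro: permutes_compose permutes_id)

text \<open>The Euclidean algorithm on the first column. The elementary matrices \<open>T\<close>,
  \<open>L\<close> and their inverses \<open>T'\<close>, \<open>L'\<close> are words in
  \<open>mS\<close> and \<open>mU\<close> up to sign, and the sign is \<open>mS\<close> squared, so
  the reachable matrices are closed under elementary row operations.\<close>

lemma words_exists:
  assumes "det A = 1" shows "\<exists>p. words a b A p"
proof -
  define W where "W A = (\<exists>p. words a b A p)" for A
  define T :: "int ^ 2 ^ 2" where "T = vector [vector [1, 1], vector [0, 1]]"
  define T' :: "int ^ 2 ^ 2" where "T' = vector [vector [1, -1], vector [0, 1]]"
  define L :: "int ^ 2 ^ 2" where "L = vector [vector [1, 0], vector [1, 1]]"
  define L' :: "int ^ 2 ^ 2" where "L' = vector [vector [1, 0], vector [-1, 1]]"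
  define P :: "int \<Rightarrow> int ^ 2 ^ 2" where "P m = vector [vector [1, m], vector [0, 1]]" for m
  have S: "W (mS ** A)" and U: "W (mU ** A)" if "W A" for A
    using that words.S words.U unfolding W_def by blast+
  have N: "W (- A)" if "W A" for A
    using S[OF S[OF that]] by (simp add: mS_mS)
  have T: "W (T ** A)" if "W A" for A
  proof -
    have "T ** A = - (mS ** (mU ** A))" by (simp add: mat2_simps T_def)
    then show ?thesis using N S U that by simp
  qed
  have L: "W (L ** A)" if "W A" for A
  proof -
    have "L ** A = - (mS ** (mU ** (mU ** A)))" by (simp add: mat2_simps L_def)
    then show ?thesis using N S U that by simp
  qed
  have T': "W (T' ** A)" if "W A" for A
  proof -
    have "T' ** A = - (mU ** (mU ** (mS ** A)))" by (simp add: mat2_simps T'_def)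
    then show ?thesis using N S U that by simp
  qed
  have L': "W (L' ** A)" if "W A" for A
  proof -
    have "L' ** A = - (mU ** (mS ** A))" by (simp add: mat2_simps L'_def)
    then show ?thesis using N S U that by simp
  qed
  have TT: "T ** (T' ** A) = A" "T' ** (T ** A) = A" "L ** (L' ** A) = A" "L' ** (L ** A) = A" for A
    by (simp_all add: mat2_simps T_def T'_def L_def L'_def)
  have W1: "W (mat 1)"
    using words.one unfolding W_def by blast
  have upper1: "W (P (int n))" for n
  proof (induction n)
    case 0
    have "P 0 = mat 1"
      by (simp add: mat2_simps P_def)
    with W1 show ?case by simp
  next
    case (Suc n)
    have "P (int (Suc n)) = T ** P (int n)"
      by (simp add: mat2_simps T_def P_def)
    with T[OF Suc] show ?case by simp
  qed
  have upper2: "W (P (- int n))" for n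
  proof (induction n)
    case 0
    with upper1[of 0] show ?case by simp
  next
    case (Suc n)
    have "P (- int (Suc n)) = T' ** P (- int n)"
      by (simp add: mat2_simps T'_def P_def)
    with T'[OF Suc] show ?case by simp
  qed
  have upper: "W (P (m))" for m :: int
    using upper1[of "nat m"] upper2[of "nat (- m)"] by (cases "m \<ge> 0") auto
  \<comment> \<open>A vanishing lower left entry makes both diagonal entries 1 or both -1, which
    leaves a unipotent upper triangular matrix up to sign.\<close>
  have c0: "W A" if A: "det A = 1" "A $ 2 $ 1 = 0" for A
  proof -
    have "A $ 1 $ 1 * A $ 2 $ 2 = 1"
      using A by (simp add: det_2)
    then consider "A $ 1 $ 1 = 1" "A $ 2 $ 2 = 1" | "A $ 1 $ 1 = -1" "A $ 2 $ 2 = -1"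
      using zmult_eq_1_iff by auto
    then show ?thesis
    proof cases
      case 1
      then have "A = P (A $ 1 $ 2)"
        using A by (simp add: vec_eq_iff forall_2 P_def)
      then show ?thesis using upper by metis
    next
      case 2
      then have "A = - P (- A $ 1 $ 2)"
        using A by (simp add: vec_eq_iff forall_2 P_def)
      then show ?thesis using N upper by metis
    qed
  qed
  have "W A" if "det A = 1" for A
    using that
  proof (induction "nat (\<bar>A $ 1 $ 1\<bar> + \<bar>A $ 2 $ 1\<bar>)" arbitrary: A rule: less_induct)
    case less
    let ?a = "A $ 1 $ 1" and ?c = "A $ 2 $ 1"
    have det: "det (T ** A) = 1" "det (T' ** A) = 1" "det (L ** A) = 1" "det (L' ** A) = 1"
    proof -
      have "det T = 1" "det T' = 1" "det L = 1" "det L' = 1"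
        by (simp_all add: det_2 T_def T'_def L_def L'_def)
      then show "det (T ** A) = 1" "det (T' ** A) = 1" "det (L ** A) = 1" "det (L' ** A) = 1"
        using less.prems by (simp_all add: det_mul)
    qed
    have e: "(T ** A) $ 1 $ 1 = ?a + ?c" "(T ** A) $ 2 $ 1 = ?c"
      "(T' ** A) $ 1 $ 1 = ?a - ?c" "(T' ** A) $ 2 $ 1 = ?c"
      "(L ** A) $ 1 $ 1 = ?a" "(L ** A) $ 2 $ 1 = ?a + ?c"
      "(L' ** A) $ 1 $ 1 = ?a" "(L' ** A) $ 2 $ 1 = ?c - ?a"
      by (simp_all add: mat2_simps T_def T'_def L_def L'_def)
    note IH = less.hyps[OF _ det(1), unfolded e] less.hyps[OF _ det(2), unfolded e]
      less.hyps[OF _ det(3), unfolded e] less.hyps[OF _ det(4), unfolded e]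
    consider "?c = 0" | "?a = 0" | "?a \<noteq> 0" "?c \<noteq> 0" by blast
    then show ?case
    proof cases
      case 1
      then show ?thesis using c0 less.prems by simp
    next
      case 2
      \<comment> \<open>\<open>mS\<close> moves the zero into the lower left corner; three further
        factors \<open>mS\<close> undo this because \<open>mS\<close> has order 4.\<close>
      have "det (mS ** A) = 1" "(mS ** A) $ 2 $ 1 = 0"
        using less.prems 2 by (simp_all add: det_mul det_mS) (simp add: mat2_simps)
      then have "W (mS ** (mS ** (mS ** (mS ** A))))"
        using c0 S by blast
      then show ?thesis by (simp add: mS_mS)
    next
      case 3
      \<comment> \<open>Of two nonzero entries, one becomes smaller in absolute value when the other
        is added to it or subtracted from it, so the induction measure drops.\<close>
      then consider "\<bar>?a + ?c\<bar> < \<bar>?a\<bar>" | "\<bar>?a - ?c\<bar> < \<bar>?a\<bar>"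
        | "\<bar>?a + ?c\<bar> < \<bar>?c\<bar>" | "\<bar>?c - ?a\<bar> < \<bar>?c\<bar>" by linarith
      then show ?thesis
      proof cases
        case 1 with IH(1) T'[of "T ** A"] show ?thesis by (simp add: TT)
      next
        case 2 with IH(2) T[of "T' ** A"] show ?thesis by (simp add: TT)
      next
        case 3 with IH(3) L'[of "L ** A"] show ?thesis by (simp add: TT)
      next
        case 4 with IH(4) L[of "L' ** A"] show ?thesis by (simp add: TT)
      qed
    qed
  qed
  with assms show ?thesis by (simp add: W_def)
qed

text \<open>Products of \<open>mS ** mU\<close> and \<open>mS ** mU ** mU\<close>, which up to sign are the parabolic
  matrices with rows \<open>(1, 1), (0, 1)\<close> and \<open>(1, 0), (1, 1)\<close>.\<close>
inductive parabolic :: "('x \<Rightarrow> 'x) \<Rightarrow> ('x \<Rightarrow> 'x) \<Rightarrow> int ^ 2 ^ 2 \<Rightarrow> ('x \<Rightarrow> 'x) \<Rightarrow> bool" for a b where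
  one: "parabolic a b (mat 1) id"
| SU: "parabolic a b A p \<Longrightarrow> parabolic a b (mS ** (mU ** A)) (p \<circ> b \<circ> a)"
| SUU: "parabolic a b A p \<Longrightarrow> parabolic a b (mS ** (mU ** (mU ** A))) (p \<circ> b \<circ> b \<circ> a)"

lemma mat1_nonneg: "\<forall>i j. (mat 1 :: int ^ 2 ^ 2) $ i $ j \<ge> 0"
  by (simp add: mat_def)

text \<open>Up to sign the factors are nonnegative with 1 on the diagonal, so nothing cancels in a
  product and the entry sum cannot decrease. The identity has entry sum 2; the bound 3 separates it
  from every nonempty product.\<close>

lemma parabolic_nonneg:
  "parabolic a b A p \<Longrightarrow> A = mat 1 \<and> p = id \<or>
    (\<exists>C. (A = C \<or> A = - C) \<and> (\<forall>i j. C $ i $ j \<ge> 0) \<and> C $ 1 $ 1 + C $ 1 $ 2 + C $ 2 $ 1 + C $ 2 $ 2 \<ge> 3)"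
proof (induction rule: parabolic.induct)
  case (SU A p)
  then obtain C where C: "A = C \<or> A = - C" "\<forall>i j. C $ i $ j \<ge> 0"
    "C $ 1 $ 1 + C $ 1 $ 2 + C $ 2 $ 1 + C $ 2 $ 2 \<ge> 3 \<or> C = mat 1"
    using mat1_nonneg by blast
  let ?D = "- (mS ** (mU ** C))"
  have "mS ** (mU ** A) = ?D \<or> mS ** (mU ** A) = - ?D"
    using C(1) by (auto simp: minus_mat_mult)
  moreover have "\<forall>i j. ?D $ i $ j \<ge> 0" "?D $ 1 $ 1 + ?D $ 1 $ 2 + ?D $ 2 $ 1 + ?D $ 2 $ 2 \<ge> 3"
    using C(2,3) by (auto simp: mat2_simps)
  ultimately show ?case by blast
next
  case (SUU A p)
  then obtain C where C: "A = C \<or> A = - C" "\<forall>i j. C $ i $ j \<ge> 0"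
    "C $ 1 $ 1 + C $ 1 $ 2 + C $ 2 $ 1 + C $ 2 $ 2 \<ge> 3 \<or> C = mat 1"
    using mat1_nonneg by blast
  let ?D = "- (mS ** (mU ** (mU ** C)))"
  have "mS ** (mU ** (mU ** A)) = ?D \<or> mS ** (mU ** (mU ** A)) = - ?D"
    using C(1) by (auto simp: minus_mat_mult)
  moreover have "\<forall>i j. ?D $ i $ j \<ge> 0" "?D $ 1 $ 1 + ?D $ 1 $ 2 + ?D $ 2 $ 1 + ?D $ 2 $ 2 \<ge> 3"
    using C(2,3) by (auto simp: mat2_simps)
  ultimately show ?case by blast
qed simp

text \<open>A nonempty product of the factors \<open>mS ** mU\<close> and
  \<open>mS ** mU ** mU\<close> ends in \<open>mU\<close>, so a word ending in \<open>mS\<close>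
  needs the optional extra factor.\<close>

definition tail :: "('x \<Rightarrow> 'x) \<Rightarrow> ('x \<Rightarrow> 'x) \<Rightarrow> int ^ 2 ^ 2 \<Rightarrow> ('x \<Rightarrow> 'x) \<Rightarrow> bool" where
  "tail a b M r \<longleftrightarrow> (\<exists>B q. parabolic a b B q \<and> (M = B \<and> r = q \<or> M = B ** mS \<and> r = a \<circ> q))"

text \<open>The normal form \<open>\<plusminus> mU\<^sup>i B mS\<^sup>j\<close> in the amalgam of cyclic groups of orders 4 and 6.\<close>
definition normal_form :: "('x \<Rightarrow> 'x) \<Rightarrow> ('x \<Rightarrow> 'x) \<Rightarrow> int ^ 2 ^ 2 \<Rightarrow> ('x \<Rightarrow> 'x) \<Rightarrow> bool" where
  "normal_form a b A p \<longleftrightarrow> (\<exists>M r X s. tail a b M r \<and>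
     (X = M \<and> s = r \<or> X = mU ** M \<and> s = r \<circ> b \<or> X = mU ** (mU ** M) \<and> s = r \<circ> b \<circ> b) \<and>
     (A = X \<and> p = s \<or> A = - X \<and> p = a \<circ> a \<circ> s))"

lemma tail_SU:
  assumes "tail a b M r"
  shows "tail a b (mS ** (mU ** M)) (r \<circ> b \<circ> a)" "tail a b (mS ** (mU ** (mU ** M))) (r \<circ> b \<circ> b \<circ> a)"
proof -
  obtain B q where B: "parabolic a b B q" "M = B \<and> r = q \<or> M = B ** mS \<and> r = a \<circ> q"
    using assms unfolding tail_def by blast
  show "tail a b (mS ** (mU ** M)) (r \<circ> b \<circ> a)"
    unfolding tail_def using B(2) parabolic.SU[OF B(1)]
    by (intro exI[of _ "mS ** (mU ** B)"] exI[of _ "q \<circ> b \<circ> a"])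
      (auto simp: matrix_mul_assoc comp_assoc)
  show "tail a b (mS ** (mU ** (mU ** M))) (r \<circ> b \<circ> b \<circ> a)"
    unfolding tail_def using B(2) parabolic.SUU[OF B(1)]
    by (intro exI[of _ "mS ** (mU ** (mU ** B))"] exI[of _ "q \<circ> b \<circ> b \<circ> a"])
      (auto simp: matrix_mul_assoc comp_assoc)
qed

text \<open>If \<open>mU^i B mS^j\<close> is the identity up to sign, then \<open>B\<close> is
  \<open>mU^(-i) mS^(-j)\<close> up to sign. Unless that product is trivial it has entries of both
  signs, and the identity has entry sum 2; \<open>parabolic_nonneg\<close> excludes both for a
  nonempty \<open>B\<close>.\<close>

lemma normal_form_mat1:
  assumes "normal_form a b (mat 1) p"
  shows "p = id"
proof -
  obtain M r X s where M: "tail a b M r"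
    and X: "X = M \<and> s = r \<or> X = mU ** M \<and> s = r \<circ> b \<or> X = mU ** (mU ** M) \<and> s = r \<circ> b \<circ> b"
    and A: "mat 1 = X \<and> p = s \<or> mat 1 = - X \<and> p = a \<circ> a \<circ> s"
    using assms unfolding normal_form_def by blast
  obtain B q where B: "parabolic a b B q" and M: "M = B \<and> r = q \<or> M = B ** mS \<and> r = a \<circ> q"
    using M unfolding tail_def by blast
  from parabolic_nonneg[OF B] show ?thesis
  proof
    assume "B = mat 1 \<and> q = id"
    with M X A show ?thesis
      by (elim disjE conjE) (simp_all add: mat2_simps)
  next
    assume "\<exists>C. (B = C \<or> B = - C) \<and> (\<forall>i j. C $ i $ j \<ge> 0) \<and> C $ 1 $ 1 + C $ 1 $ 2 + C $ 2 $ 1 + C $ 2 $ 2 \<ge> 3"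
    then obtain C where C: "B = C \<or> B = - C" "C $ 1 $ 1 \<ge> 0" "C $ 1 $ 2 \<ge> 0" "C $ 2 $ 1 \<ge> 0" "C $ 2 $ 2 \<ge> 0"
      "C $ 1 $ 1 + C $ 1 $ 2 + C $ 2 $ 1 + C $ 2 $ 2 \<ge> 3" by blast
    have "False"
      using C(1) M X A C(2-6)
      by (elim disjE conjE; simp add: mat2_simps; linarith)
    then show ?thesis ..
  qed
qed

context
  fixes a b :: "'x \<Rightarrow> 'x"
  assumes cube: "b \<circ> b \<circ> b = a \<circ> a" and fourth: "a \<circ> a \<circ> a \<circ> a = id"
begin

text \<open>Being the cube of \<open>b\<close>, the permutation \<open>a \<circ> a\<close> commutes
  with \<open>b\<close> as well as with \<open>a\<close>; it plays the part of
  \<open>-1\<close>.\<close>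

lemma b_central: "b (a (a v)) = a (a (b v))"
  using fun_cong[OF cube, of "b v"] fun_cong[OF cube, of v] by simp

lemma parabolic_central: "parabolic a b A p \<Longrightarrow> p \<circ> a \<circ> a = a \<circ> a \<circ> p"
proof (induction rule: parabolic.induct)
  case (SU A p)
  then show ?case by (simp add: fun_eq_iff b_central)
next
  case (SUU A p)
  then show ?case by (simp add: fun_eq_iff b_central)
qed simp

lemma tail_central: "tail a b M r \<Longrightarrow> r (a (a v)) = a (a (r v))"
  using parabolic_central by (fastforce simp: tail_def fun_eq_iff)

lemma normal_form_uminus:
  assumes "normal_form a b A p" shows "normal_form a b (- A) (a \<circ> a \<circ> p)"
proof -
  have "a \<circ> a \<circ> (a \<circ> a \<circ> s) = s" for s :: "'x \<Rightarrow> 'x"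
    using fourth by (simp add: fun_eq_iff)
  then show ?thesis
    using assms unfolding normal_form_def by (metis minus_minus)
qed

lemma normal_formI:
  assumes "tail a b M r"
  shows "normal_form a b M r" "normal_form a b (mU ** M) (r \<circ> b)"
    "normal_form a b (mU ** (mU ** M)) (r \<circ> b \<circ> b)"
  using assms unfolding normal_form_def by blast+

text \<open>When the tail starts with a factor \<open>mS ** mU\<close> or
  \<open>mS ** mU ** mU\<close>, the two adjacent \<open>mS\<close> combine to \<open>-1\<close> and
  the first factor dissolves into a leading power of \<open>mU\<close>; centrality of
  \<open>a \<circ> a\<close> moves the sign out. Otherwise the tail is the identity or
  \<open>mS\<close>.\<close>

lemma normal_form_S_tail:
  assumes "tail a b M r"
  shows "normal_form a b (mS ** M) (r \<circ> a)"
proof -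
  obtain B q where B: "parabolic a b B q" and M: "M = B \<and> r = q \<or> M = B ** mS \<and> r = a \<circ> q"
    using assms unfolding tail_def by blast
  from B show ?thesis
  proof cases
    case one
    have "tail a b (mat 1) id" "tail a b (mat 1 ** mS) (a \<circ> id)"
      unfolding tail_def using parabolic.one by blast+
    with M one normal_formI(1)[of "mat 1 ** mS" "a \<circ> id"] normal_form_uminus[OF normal_formI(1), of "mat 1" id]
    show ?thesis
      by (auto simp: mS_mS[of "mat 1", simplified])
  next
    case (SU D t)
    define N s where "N = (if M = B \<and> r = q then D else D ** mS)" and "s = (if M = B \<and> r = q then t else a \<circ> t)"
    have N: "tail a b N s" "M = mS ** (mU ** N)" "r = s \<circ> b \<circ> a"
      using SU M unfolding tail_def N_def s_def by (auto simp: matrix_mul_assoc comp_assoc)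
    have "mS ** M = - (mU ** N)" "r \<circ> a = a \<circ> a \<circ> (s \<circ> b)"
      using N(2,3) tail_central[OF N(1)] b_central
      by (simp_all add: mS_mS fun_eq_iff)
    then show ?thesis
      using normal_form_uminus[OF normal_formI(2)[OF N(1)]] by simp
  next
    case (SUU D t)
    define N s where "N = (if M = B \<and> r = q then D else D ** mS)" and "s = (if M = B \<and> r = q then t else a \<circ> t)"
    have N: "tail a b N s" "M = mS ** (mU ** (mU ** N))" "r = s \<circ> b \<circ> b \<circ> a"
      using SUU M unfolding tail_def N_def s_def by (auto simp: matrix_mul_assoc comp_assoc)
    have "mS ** M = - (mU ** (mU ** N))" "r \<circ> a = a \<circ> a \<circ> (s \<circ> b \<circ> b)"
      using N(2,3) tail_central[OF N(1)] b_central
      by (simp_all add: mS_mS fun_eq_iff)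
    then show ?thesis
      using normal_form_uminus[OF normal_formI(3)[OF N(1)]] by simp
  qed
qed

text \<open>Left multiplication by a generator preserves the form: \<open>mS\<close> opens a new
  factor of the tail or cancels one, and \<open>mU\<close> raises the leading exponent, its cube
  going into the sign.\<close>

lemma words_normal_form: "words a b A p \<Longrightarrow> normal_form a b A p"
proof (induction rule: words.induct)
  case one
  show ?case
    using normal_formI(1)[of "mat 1" id] parabolic.one unfolding tail_def by blast
next
  case (S A p)
  then obtain M r X s where M: "tail a b M r"
    and X: "X = M \<and> s = r \<or> X = mU ** M \<and> s = r \<circ> b \<or> X = mU ** (mU ** M) \<and> s = r \<circ> b \<circ> b"
    and A: "A = X \<and> p = s \<or> A = - X \<and> p = a \<circ> a \<circ> s"
    unfolding normal_form_def by blast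
  have "normal_form a b (mS ** X) (s \<circ> a)"
    using X normal_form_S_tail[OF M] normal_formI(1)[OF tail_SU(1)[OF M]] normal_formI(1)[OF tail_SU(2)[OF M]]
    by auto
  then show ?case
    using A normal_form_uminus[of "mS ** X" "s \<circ> a"] by (auto simp: minus_mat_mult o_def)
next
  case (U A p)
  then obtain M r X s where M: "tail a b M r"
    and X: "X = M \<and> s = r \<or> X = mU ** M \<and> s = r \<circ> b \<or> X = mU ** (mU ** M) \<and> s = r \<circ> b \<circ> b"
    and A: "A = X \<and> p = s \<or> A = - X \<and> p = a \<circ> a \<circ> s"
    unfolding normal_form_def by blast
  have "r \<circ> b \<circ> b \<circ> b = a \<circ> a \<circ> r"
    using fun_cong[OF cube] tail_central[OF M] by (simp add: fun_eq_iff)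
  then have "normal_form a b (mU ** X) (s \<circ> b)"
    using X normal_formI[OF M] normal_form_uminus[OF normal_formI(1)[OF M]]
    by (auto simp: mU_mU_mU)
  then show ?case
    using A normal_form_uminus[of "mU ** X" "s \<circ> b"] by (auto simp: minus_mat_mult o_def)
qed

text \<open>Two permutations over \<open>A\<close> are compared through a word over the inverse
  matrix: the composites lie over the identity matrix, where the normal form allows only
  \<open>id\<close>. In other words, the relations between \<open>a\<close> and \<open>b\<close>
  suffice to define an action of the whole group.\<close>

lemma words_unique:
  assumes "words a b A p" "words a b A q"
  shows "p = q"
proof -
  have "det A = 1" using words_det[OF assms(1)] .
  then obtain B where B: "B ** A = mat 1" "A ** B = mat 1" "det B = 1"
    using group.inv_closed[OF group_SL2Z, of A] group.l_inv[OF group_SL2Z, of A] group.r_inv[OF group_SL2Z, of A]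
    by (simp add: SL2Z_def)
  obtain r where r: "words a b B r"
    using words_exists[OF B(3)] by blast
  have "words a b (B ** A) (p \<circ> r)" "words a b (B ** A) (q \<circ> r)" "words a b (A ** B) (r \<circ> p)"
    using words_mult r assms by blast+
  then have "p \<circ> r = id" "q \<circ> r = id" "r \<circ> p = id"
    using words_normal_form normal_form_mat1 B by metis+
  then show ?thesis
    by (metis comp_assoc comp_id id_comp)
qed

end

section \<open>Actions of the modular group as pairs of permutations\<close>

lemma SL2Z_simps [simp]:
  "carrier SL2Z = {A. det A = 1}" "A \<otimes>\<^bsub>SL2Z\<^esub> B = A ** B" "\<one>\<^bsub>SL2Z\<^esub> = mat 1"
  by (simp_all add: SL2Z_def)

definition generator_pairs :: "bool \<Rightarrow> 'x set \<Rightarrow> (('x \<Rightarrow> 'x) \<times> ('x \<Rightarrow> 'x)) set" where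
  "generator_pairs \<beta> V = {(a, b). a permutes V \<and> b permutes V \<and> b \<circ> b \<circ> b = a \<circ> a \<and> a \<circ> a \<circ> a \<circ> a = id \<and>
     (\<forall>v\<in>V. a (a v) = v \<longleftrightarrow> \<beta>)}"

lemma minus_one_central:
  "- mat 1 \<in> carrier SL2Z"
  "g \<in> carrier SL2Z \<Longrightarrow> - mat 1 \<otimes>\<^bsub>SL2Z\<^esub> g = g \<otimes>\<^bsub>SL2Z\<^esub> - mat 1"
proof -
  show "- mat 1 \<in> carrier SL2Z" by (simp add: det_2) (simp add: mat_def)
  show "- mat 1 \<otimes>\<^bsub>SL2Z\<^esub> g = g \<otimes>\<^bsub>SL2Z\<^esub> - mat 1" by (simp add: minus_mat_mult)
qed

text \<open>Injective because words in \<open>mS\<close> and \<open>mU\<close> reach every matrix;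
  surjective because the permutation attached to a matrix by its words is unique.\<close>

lemma bij_betw_acts_generator_pairs:
  "bij_betw (\<lambda>\<phi>. (\<phi> mS, \<phi> mU)) (group.acts SL2Z (- mat 1) \<beta> V) (generator_pairs \<beta> V)"
proof -
  interpret group SL2Z by (rule group_SL2Z)
  let ?A = "acts (- mat 1) \<beta> V"
  have mem: "mS \<in> carrier SL2Z" "mU \<in> carrier SL2Z"
    by (simp_all add: det_mS det_mU)
  have SS: "mS ** mS = - mat 1" and UUU: "mU ** mU ** mU = - mat 1" and NN: "- mat 1 ** - mat 1 = (mat 1 :: int ^ 2 ^ 2)"
    by (simp_all add: mat2_simps)
  have hom: "\<phi> (A ** B) = \<phi> B \<circ> \<phi> A" if "\<phi> \<in> ?A" "det A = 1" "det B = 1" for \<phi> A B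
    using that by (auto simp: acts_def)
  have neg: "\<phi> (- mat 1) = \<phi> mS \<circ> \<phi> mS" "\<phi> (- mat 1) = \<phi> mU \<circ> \<phi> mU \<circ> \<phi> mU"
    "\<phi> (- mat 1) \<circ> \<phi> (- mat 1) = id" if \<phi>: "\<phi> \<in> ?A" for \<phi>
    using hom[OF \<phi>, of mS mS] hom[OF \<phi>, of "mU ** mU" mU] hom[OF \<phi>, of mU mU]
      hom[OF \<phi>, of "- mat 1" "- mat 1"] acts_one[OF \<phi>] minus_one_central(1)
    by (simp_all add: det_mS det_mU det_mul SS UUU NN comp_assoc)
  have words_acts: "words (\<phi> mS) (\<phi> mU) A p \<Longrightarrow> p = \<phi> A" if \<phi>: "\<phi> \<in> ?A" for \<phi> A p
  proof (induction rule: words.induct)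
    case one then show ?case using acts_one[OF \<phi>] by simp
  next
    case (S A p) then show ?case using hom[OF \<phi>, of mS A] words_det det_mS by metis
  next
    case (U A p) then show ?case using hom[OF \<phi>, of mU A] words_det det_mU by metis
  qed
  show ?thesis
    unfolding bij_betw_def
  proof (intro conjI inj_onI equalityI subsetI)
    fix \<phi> \<psi> assume \<phi>: "\<phi> \<in> ?A" and \<psi>: "\<psi> \<in> ?A" and eq: "(\<phi> mS, \<phi> mU) = (\<psi> mS, \<psi> mU)"
    show "\<phi> = \<psi>"
    proof
      fix A show "\<phi> A = \<psi> A"
      proof (cases "det A = 1")
        case True
        then obtain p where "words (\<phi> mS) (\<phi> mU) A p" using words_exists by blast
        then have "words (\<psi> mS) (\<psi> mU) A p" using eq by simp
        with \<open>words (\<phi> mS) (\<phi> mU) A p\<close> show ?thesis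
          using words_acts[OF \<phi>] words_acts[OF \<psi>] by metis
      next
        case False
        then show ?thesis using \<phi> \<psi> by (auto simp: acts_def extensional_def)
      qed
    qed
  next
    fix ab assume "ab \<in> (\<lambda>\<phi>. (\<phi> mS, \<phi> mU)) ` ?A"
    then obtain \<phi> where \<phi>: "\<phi> \<in> ?A" and ab: "ab = (\<phi> mS, \<phi> mU)" by blast
    have "\<phi> mS \<circ> \<phi> mS \<circ> \<phi> mS \<circ> \<phi> mS = id" "\<phi> mU \<circ> \<phi> mU \<circ> \<phi> mU = \<phi> mS \<circ> \<phi> mS"
      using neg[OF \<phi>] by (simp_all add: comp_assoc)
    moreover have "\<forall>v\<in>V. \<phi> mS (\<phi> mS v) = v \<longleftrightarrow> \<beta>"
      using \<phi> neg(1)[OF \<phi>] by (simp add: acts_def)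
    ultimately show "ab \<in> generator_pairs \<beta> V"
      using acts_permutes[OF \<phi> mem(1)] acts_permutes[OF \<phi> mem(2)] by (simp add: generator_pairs_def ab)
  next
    fix ab assume "ab \<in> generator_pairs \<beta> V"
    then obtain a b where ab: "ab = (a, b)" "a permutes V" "b permutes V" "b \<circ> b \<circ> b = a \<circ> a"
      "a \<circ> a \<circ> a \<circ> a = id" "\<forall>v\<in>V. a (a v) = v \<longleftrightarrow> \<beta>" by (auto simp: generator_pairs_def)
    define \<phi> where "\<phi> = (\<lambda>A\<in>carrier SL2Z. THE p. words a b A p)"
    have \<phi>: "\<phi> A = p" if "words a b A p" for A p
      using that words_unique[OF ab(4,5)] words_det[OF that] by (auto simp: \<phi>_def)
    have w1: "words a b (mat 1) id" by (rule words.one)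
    have S: "\<phi> mS = a" and U: "\<phi> mU = b"
      using \<phi>[OF words.S[OF w1]] \<phi>[OF words.U[OF w1]] by simp_all
    have N: "\<phi> (- mat 1) = a \<circ> a"
      using \<phi>[OF words_uminus[OF w1]] by simp
    have "\<phi> \<in> ?A"
      unfolding acts_def
    proof (intro CollectI conjI ballI)
      show "\<phi> \<in> extensional (carrier SL2Z)" by (simp add: \<phi>_def)
    next
      fix g assume "g \<in> carrier SL2Z"
      then obtain p where "words a b g p" using words_exists[of g a b] by auto
      then show "\<phi> g permutes V" using words_permutes ab(2,3) \<phi> by metis
    next
      fix g h assume "g \<in> carrier SL2Z" "h \<in> carrier SL2Z"
      then obtain p q where pq: "words a b g p" "words a b h q" using words_exists[of g a b] words_exists[of h a b] by auto
      then show "\<phi> (g \<otimes>\<^bsub>SL2Z\<^esub> h) = \<phi> h \<circ> \<phi> g"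
        using \<phi>[OF pq(1)] \<phi>[OF pq(2)] \<phi>[OF words_mult[OF pq]] by simp
    next
      fix v assume "v \<in> V" then show "\<phi> (- mat 1) v = v \<longleftrightarrow> \<beta>" using ab(6) N by simp
    qed
    then show "ab \<in> (\<lambda>\<phi>. (\<phi> mS, \<phi> mU)) ` ?A"
      using S U ab(1) by force
  qed
qed

lemma finite_generator_pairs: "finite V \<Longrightarrow> finite (generator_pairs \<beta> V)"
  by (rule finite_subset[of _ "{p. p permutes V} \<times> {p. p permutes V}"])
    (auto simp: generator_pairs_def finite_permutations)

lemma card_generator_pairs_recurrence:
  assumes "\<And>W. finite (W :: nat set) \<Longrightarrow> card (generator_pairs \<beta> W) = a (card W)" "n > 0"
  shows "a n = (\<Sum>k=1..n. card (group.subgroups_of_index SL2Z (- mat 1) \<beta> k)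
    * (fact (n - 1) div fact (n - k)) * a (n - k))"
proof -
  interpret group SL2Z by (rule group_SL2Z)
  show ?thesis
  proof (rule card_acts[OF minus_one_central])
    fix W :: "nat set" assume W: "finite W"
    show "finite (acts (- mat 1) \<beta> W)"
      using bij_betw_finite[OF bij_betw_acts_generator_pairs] finite_generator_pairs[OF W] by blast
    show "card (acts (- mat 1) \<beta> W) = a (card W)"
      using bij_betw_same_card[OF bij_betw_acts_generator_pairs] assms(1)[OF W] by metis
  qed (use assms(2) in auto)
qed

lemma num_subgroups_SL2Z_split:
  assumes fin: "\<And>\<beta>. finite (group.subgroups_of_index SL2Z (- mat 1) \<beta> n)"
  shows "s_SL2Z n = card (group.subgroups_of_index SL2Z (- mat 1) True n)
    + card (group.subgroups_of_index SL2Z (- mat 1) False n)"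
proof -
  interpret group SL2Z by (rule group_SL2Z)
  have "{H. subgroup H SL2Z \<and> card (rcosets\<^bsub>SL2Z\<^esub> H) = n} =
    subgroups_of_index (- mat 1) True n \<union> subgroups_of_index (- mat 1) False n"
    by (auto simp: subgroups_of_index_def)
  moreover have "subgroups_of_index (- mat 1) True n \<inter> subgroups_of_index (- mat 1) False n = {}"
    by (auto simp: subgroups_of_index_def)
  ultimately show ?thesis
    using fin by (simp add: num_subgroups_def card_Un_disjoint)
qed

lemma finite_subgroups_SL2Z:
  assumes "n > 0"
  shows "finite (group.subgroups_of_index SL2Z (- mat 1) \<beta> n)"
proof -
  interpret group SL2Z by (rule group_SL2Z)
  show ?thesis
    using finite_subgroups_of_index[OF minus_one_central] assms finite_generator_pairs[of "{..<n}"]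
      bij_betw_finite[OF bij_betw_acts_generator_pairs] by blast
qed

section \<open>Permutations with prescribed roots\<close>

text \<open>The predicate sees a point and its first three images. This is enough for involutions,
  square roots and cube roots, so the removal of a cycle is proved once for all of them.\<close>

definition perms :: "('x \<Rightarrow> 'x \<Rightarrow> 'x \<Rightarrow> 'x \<Rightarrow> bool) \<Rightarrow> 'x set \<Rightarrow> ('x \<Rightarrow> 'x) set" where
  "perms Q V = {p. p permutes V \<and> (\<forall>v\<in>V. Q v (p v) (p (p v)) (p (p (p v))))}"

lemma finite_perms: "finite V \<Longrightarrow> finite (perms Q V)"
  by (rule finite_subset[of _ "{p. p permutes V}"]) (auto simp: perms_def finite_permutations)

lemma perms_empty [simp]: "perms Q {} = {id}"
  by (auto simp: perms_def)

text \<open>Composition with \<open>\<sigma>\<close> is the bijection: a permutation that follows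
  \<open>\<sigma>\<close> on \<open>B\<close> is \<open>\<sigma>\<close> combined with a permutation
  of the other points, and the local condition splits accordingly.\<close>

lemma card_perms_extending:
  assumes \<sigma>: "\<sigma> permutes B" and B: "B \<subseteq> V"
    and Q: "\<forall>v\<in>B. Q v (\<sigma> v) (\<sigma> (\<sigma> v)) (\<sigma> (\<sigma> (\<sigma> v)))"
  shows "card {p \<in> perms Q V. \<forall>v\<in>B. p v = \<sigma> v} = card (perms Q (V - B))"
proof -
  let ?P = "{p \<in> perms Q V. \<forall>v\<in>B. p v = \<sigma> v}"
  have \<sigma>B: "\<sigma> v \<in> B \<longleftrightarrow> v \<in> B" "inv_into UNIV \<sigma> v \<in> B \<longleftrightarrow> v \<in> B" for v
    using permutes_in_image[OF \<sigma>] permutes_in_image[OF permutes_inv[OF \<sigma>]] by blast+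
  have \<sigma>_off: "\<sigma> v = v" "inv_into UNIV \<sigma> v = v" if "v \<notin> B" for v
    using permutes_not_in[OF \<sigma> that] permutes_not_in[OF permutes_inv[OF \<sigma>] that] .
  have "bij_betw (\<lambda>p. \<sigma> \<circ> p) (perms Q (V - B)) ?P"
  proof (rule bij_betw_byWitness[where f' = "\<lambda>p. inv_into UNIV \<sigma> \<circ> p"])
    show "\<forall>p\<in>perms Q (V - B). inv_into UNIV \<sigma> \<circ> (\<sigma> \<circ> p) = p"
      by (simp add: comp_assoc[symmetric] permutes_inv_o[OF \<sigma>])
    show "\<forall>p\<in>?P. \<sigma> \<circ> (inv_into UNIV \<sigma> \<circ> p) = p"
      by (simp add: comp_assoc[symmetric] permutes_inv_o[OF \<sigma>])
    show "(\<lambda>p. \<sigma> \<circ> p) ` perms Q (V - B) \<subseteq> ?P"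
    proof clarify
      fix p assume p: "p \<in> perms Q (V - B)"
      then have pp: "p permutes V - B" by (simp add: perms_def)
      have pB: "p v = v" if "v \<in> B" for v using permutes_not_in[OF pp] that by blast
      have pV: "p v \<notin> B" if "v \<in> V - B" for v using permutes_in_image[OF pp, of v] that by blast
      have pV': "p v \<in> V - B" if "v \<in> V - B" for v using permutes_in_image[OF pp, of v] that by blast
      have "\<sigma> \<circ> p permutes V"
        using permutes_compose[OF permutes_subset[OF pp] permutes_subset[OF \<sigma> B]] by blast
      moreover have "Q v (\<sigma> (p v)) (\<sigma> (p (\<sigma> (p v)))) (\<sigma> (p (\<sigma> (p (\<sigma> (p v))))))" if v: "v \<in> V" for v
      proof (cases "v \<in> B")
        case True
        then show ?thesis using Q \<sigma>B pB by simp
      next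
        case False
        then have "v \<in> V - B" using v by blast
        then show ?thesis
          using p \<sigma>_off pV pV' by (simp add: perms_def)
      qed
      ultimately show "\<sigma> \<circ> p \<in> perms Q V \<and> (\<forall>v\<in>B. (\<sigma> \<circ> p) v = \<sigma> v)"
        using pB by (simp add: perms_def)
    qed
    show "(\<lambda>p. inv_into UNIV \<sigma> \<circ> p) ` ?P \<subseteq> perms Q (V - B)"
    proof clarify
      fix p assume p: "p \<in> perms Q V" and agree: "\<forall>v\<in>B. p v = \<sigma> v"
      then have pp: "p permutes V" by (simp add: perms_def)
      have "inv_into UNIV \<sigma> \<circ> p permutes V"
        using permutes_compose[OF pp permutes_subset[OF permutes_inv[OF \<sigma>] B]] .
      moreover have "(inv_into UNIV \<sigma> \<circ> p) v = v" if "v \<in> V - (V - B)" for v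
        using that agree permutes_inverses(2)[OF \<sigma>] by simp
      ultimately have "inv_into UNIV \<sigma> \<circ> p permutes V - B"
        by (rule permutes_superset)
      moreover have p_off: "p v \<notin> B" if "v \<notin> B" for v
      proof
        assume "p v \<in> B"
        then have "p v = p (inv_into UNIV \<sigma> (p v))"
          using agree \<sigma>B permutes_inverses(1)[OF \<sigma>] by simp
        then have "v = inv_into UNIV \<sigma> (p v)"
          using permutes_inj[OF pp] by (simp add: inj_eq)
        then show False using that \<sigma>B \<open>p v \<in> B\<close> by metis
      qed
      ultimately show "inv_into UNIV \<sigma> \<circ> p \<in> perms Q (V - B)"
        using p \<sigma>_off by (simp add: perms_def)
    qed
  qed
  then show ?thesis
    by (simp add: bij_betw_same_card)
qed

definition cycle_respects :: "('x \<Rightarrow> 'x \<Rightarrow> 'x \<Rightarrow> 'x \<Rightarrow> bool) \<Rightarrow> 'x list \<Rightarrow> bool" where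
  "cycle_respects Q xs \<longleftrightarrow> (\<forall>v\<in>set xs. Q v (cycle_of_list xs v)
     (cycle_of_list xs (cycle_of_list xs v)) (cycle_of_list xs (cycle_of_list xs (cycle_of_list xs v))))"

text \<open>The recursion scheme of the four counts below. There \<open>L\<close> lists the possible
  cycles through a chosen point; removing the cycle leaves a permutation of the same kind on fewer
  points.\<close>

lemma card_perms_cycles:
  assumes V: "finite V" and L: "finite L"
    and cyc: "\<And>xs. xs \<in> L \<Longrightarrow> set xs \<subseteq> V \<and> cycle_respects Q xs"
    and ex: "\<And>p. p \<in> perms Q V \<Longrightarrow> \<exists>!xs. xs \<in> L \<and> (\<forall>v\<in>set xs. p v = cycle_of_list xs v)"
  shows "card (perms Q V) = (\<Sum>xs\<in>L. card (perms Q (V - set xs)))"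
proof -
  let ?P = "\<lambda>xs. {p \<in> perms Q V. \<forall>v\<in>set xs. p v = cycle_of_list xs v}"
  have "perms Q V = (\<Union>xs\<in>L. ?P xs)"
    using ex by blast
  then have "card (perms Q V) = card (\<Union>xs\<in>L. ?P xs)"
    by simp
  also have "\<dots> = (\<Sum>xs\<in>L. card (?P xs))"
  proof (rule card_UN_disjoint[OF L])
    show "\<forall>xs\<in>L. finite (?P xs)"
      using finite_perms[OF V] by auto
    show "\<forall>xs\<in>L. \<forall>ys\<in>L. xs \<noteq> ys \<longrightarrow> ?P xs \<inter> ?P ys = {}"
      using ex by blast
  qed
  also have "\<dots> = (\<Sum>xs\<in>L. card (perms Q (V - set xs)))"
  proof (rule sum.cong[OF refl])
    fix xs assume "xs \<in> L"
    from cyc[OF this] show "card (?P xs) = card (perms Q (V - set xs))"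
      by (intro card_perms_extending[OF cycle_permutes]) (auto simp: cycle_respects_def)
  qed
  finally show ?thesis .
qed

text \<open>\<open>cycle_of_list\<close> is a product of transpositions; evaluating it here once
  lets the proofs about longer cycles run with its equations switched off.\<close>

lemma cycle_values:
  "distinct [a, b] \<Longrightarrow> cycle_of_list [a, b] a = b \<and> cycle_of_list [a, b] b = a"
  "distinct [a, b, c] \<Longrightarrow> cycle_of_list [a, b, c] a = b \<and> cycle_of_list [a, b, c] b = c
    \<and> cycle_of_list [a, b, c] c = a"
  "distinct [a, b, c, d] \<Longrightarrow> cycle_of_list [a, b, c, d] a = b \<and> cycle_of_list [a, b, c, d] b = c
    \<and> cycle_of_list [a, b, c, d] c = d \<and> cycle_of_list [a, b, c, d] d = a"
  "distinct [a, b, c, d, e, f] \<Longrightarrow> cycle_of_list [a, b, c, d, e, f] a = b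
    \<and> cycle_of_list [a, b, c, d, e, f] b = c \<and> cycle_of_list [a, b, c, d, e, f] c = d
    \<and> cycle_of_list [a, b, c, d, e, f] d = e \<and> cycle_of_list [a, b, c, d, e, f] e = f
    \<and> cycle_of_list [a, b, c, d, e, f] f = a"
  by (auto simp: transpose_def)

definition is_involution :: "bool \<Rightarrow> 'x \<Rightarrow> 'x \<Rightarrow> 'x \<Rightarrow> 'x \<Rightarrow> bool" where
  "is_involution fixed_points v v1 v2 v3 \<longleftrightarrow> v2 = v \<and> (fixed_points \<or> v1 \<noteq> v)"

definition is_square_root :: "('x \<Rightarrow> 'x) \<Rightarrow> 'x \<Rightarrow> 'x \<Rightarrow> 'x \<Rightarrow> 'x \<Rightarrow> bool" where
  "is_square_root c v v1 v2 v3 \<longleftrightarrow> v2 = c v"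

definition is_cube_root :: "('x \<Rightarrow> 'x) \<Rightarrow> 'x \<Rightarrow> 'x \<Rightarrow> 'x \<Rightarrow> 'x \<Rightarrow> bool" where
  "is_cube_root c v v1 v2 v3 \<longleftrightarrow> v3 = c v"

abbreviation "involutions \<equiv> perms (is_involution True)"

abbreviation "matchings \<equiv> perms (is_involution False)"

abbreviation "cube_roots_of_one \<equiv> perms (is_cube_root (\<lambda>v. v))"

fun num_involutions :: "bool \<Rightarrow> nat \<Rightarrow> nat" where
  "num_involutions \<beta> 0 = 1"
| "num_involutions \<beta> (Suc 0) = (if \<beta> then 1 else 0)"
| "num_involutions \<beta> (Suc (Suc n)) = (if \<beta> then num_involutions \<beta> (Suc n) else 0) + Suc n * num_involutions \<beta> n"

fun num_cube_one :: "nat \<Rightarrow> nat" where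
  "num_cube_one 0 = 1"
| "num_cube_one (Suc 0) = 1"
| "num_cube_one (Suc (Suc 0)) = 1"
| "num_cube_one (Suc (Suc (Suc n))) = num_cube_one (Suc (Suc n)) + Suc (Suc n) * Suc n * num_cube_one n"

lemma card_involutions: "finite V \<Longrightarrow> card (perms (is_involution \<beta>) V) = num_involutions \<beta> (card V)"
proof (induction "card V" arbitrary: V rule: less_induct)
  case less
  let ?I = "perms (is_involution \<beta>)"
  show ?case
  proof (cases "V = {}")
    case False
    then obtain x where x: "x \<in> V" by blast
    define n where "n = card V - 1"
    have cV: "card V = Suc n" using card_Suc_Diff1[OF less.prems x] less.prems x by (simp add: n_def)
    let ?F = "if \<beta> then {[x]} else {}"
    let ?L = "?F \<union> (\<lambda>y. [x, y]) ` (V - {x})"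
    have "card (?I V) = (\<Sum>xs\<in>?L. card (?I (V - set xs)))"
    proof (rule card_perms_cycles[OF less.prems])
      show "finite ?L" using less.prems by simp
    next
      fix xs assume "xs \<in> ?L"
      then show "set xs \<subseteq> V \<and> cycle_respects (is_involution \<beta>) xs"
        using x by (auto simp: is_involution_def cycle_respects_def split: if_splits)
    next
      fix p assume p: "p \<in> ?I V"
      then have "p x \<in> V" "p (p x) = x" "\<beta> \<or> p x \<noteq> x" using x
        by (auto simp: perms_def is_involution_def permutes_in_image)
      then show "\<exists>!xs. xs \<in> ?L \<and> (\<forall>v\<in>set xs. p v = cycle_of_list xs v)"
        by (intro ex1I[of _ "if p x = x then [x] else [x, p x]"]) (auto split: if_splits)
    qed
    also have "\<dots> = (\<Sum>xs\<in>?F. card (?I (V - set xs))) + (\<Sum>y\<in>V - {x}. card (?I (V - {x, y})))"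
      using less.prems by (subst sum.union_disjoint) (auto simp: sum.reindex inj_on_def)
    also have "(\<Sum>xs\<in>?F. card (?I (V - set xs))) = (if \<beta> then num_involutions \<beta> n else 0)"
      using less.hyps[of "V - {x}"] less.prems x cV by (cases \<beta>) simp_all
    also have "(\<Sum>y\<in>V - {x}. card (?I (V - {x, y}))) = n * num_involutions \<beta> (n - 1)"
    proof -
      have "card (?I (V - {x, y})) = num_involutions \<beta> (n - 1)" if "y \<in> V - {x}" for y
        using less.hyps[of "V - {x, y}"] less.prems x cV that by (auto simp: card_Diff_subset card_insert_if split: if_splits)
      then show ?thesis using x cV by simp
    qed
    finally show ?thesis
      using cV by (cases n) simp_all
  qed simp
qed

lemma card_cube_one: "finite V \<Longrightarrow> card (cube_roots_of_one V) = num_cube_one (card V)"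
proof (induction "card V" arbitrary: V rule: less_induct)
  case less
  show ?case
  proof (cases "V = {}")
    case False
    then obtain x where x: "x \<in> V" by blast
    define n where "n = card V - 1"
    have cV: "card V = Suc n" using card_Suc_Diff1[OF less.prems x] less.prems x by (simp add: n_def)
    let ?Y = "SIGMA y:V - {x}. V - {x, y}"
    let ?L = "insert [x] ((\<lambda>(y, z). [x, y, z]) ` ?Y)"
    have Y: "finite ?Y" using less.prems by simp
    have "card (cube_roots_of_one V) = (\<Sum>xs\<in>?L. card (cube_roots_of_one (V - set xs)))"
    proof (rule card_perms_cycles[OF less.prems])
      show "finite ?L" using Y by blast
    next
      fix xs assume "xs \<in> ?L"
      then consider "xs = [x]" | y z where "xs = [x, y, z]" "distinct [x, y, z]" "y \<in> V" "z \<in> V" by auto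
      then show "set xs \<subseteq> V \<and> cycle_respects (is_cube_root (\<lambda>v. v)) xs"
      proof cases
        case 1 then show ?thesis using x by (simp add: is_cube_root_def cycle_respects_def)
      next
        case (2 y z) then show ?thesis
          using cycle_values(2)[OF 2(2)] x by (simp add: is_cube_root_def cycle_respects_def del: cycle_of_list.simps)
      qed
    next
      fix p assume p: "p \<in> cube_roots_of_one V"
      then have "inj p" by (auto simp: perms_def permutes_inj)
      have pV: "p x \<in> V" "p (p x) \<in> V" "p (p (p x)) = x" using x p
        by (auto simp: perms_def is_cube_root_def permutes_in_image)
      have d: "distinct [x, p x, p (p x)]" if "p x \<noteq> x"
        using that pV(3) \<open>inj p\<close> by (auto simp: inj_def)
      show "\<exists>!xs. xs \<in> ?L \<and> (\<forall>v\<in>set xs. p v = cycle_of_list xs v)"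
      proof (cases "p x = x")
        case True
        then show ?thesis
          by (intro ex1I[of _ "[x]"]) (auto split: if_splits)
      next
        case False
        show ?thesis
        proof (rule ex1I[of _ "[x, p x, p (p x)]"])
          show "[x, p x, p (p x)] \<in> ?L \<and> (\<forall>v\<in>set [x, p x, p (p x)]. p v = cycle_of_list [x, p x, p (p x)] v)"
            using cycle_values(2)[OF d[OF False]] pV d[OF False] by (auto simp del: cycle_of_list.simps)
          fix xs assume xs: "xs \<in> ?L \<and> (\<forall>v\<in>set xs. p v = cycle_of_list xs v)"
          with False obtain y z where "xs = [x, y, z]" "distinct [x, y, z]" by auto
          then show "xs = [x, p x, p (p x)]"
            using xs cycle_values(2)[of x y z] by (simp del: cycle_of_list.simps)
        qed
      qed
    qed
    also have "\<dots> = card (cube_roots_of_one (V - {x})) +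
      (\<Sum>yz\<in>?Y. card (cube_roots_of_one (V - {x, fst yz, snd yz})))"
      using Y by (subst sum.insert) (auto simp: sum.reindex inj_on_def split_def)
    also have "card (cube_roots_of_one (V - {x})) = num_cube_one n"
      using less.hyps[of "V - {x}"] less.prems x cV by simp
    also have "(\<Sum>yz\<in>?Y. card (cube_roots_of_one (V - {x, fst yz, snd yz}))) = n * (n - 1) * num_cube_one (n - 2)"
    proof -
      have "card (cube_roots_of_one (V - {x, fst yz, snd yz})) = num_cube_one (n - 2)" if "yz \<in> ?Y" for yz
        using less.hyps[of "V - {x, fst yz, snd yz}"] less.prems x cV that
        by (auto simp: card_Diff_subset card_insert_if numeral_2_eq_2 split: if_splits)
      moreover have "card ?Y = n * (n - 1)"
      proof -
        have "card (V - {x, y}) = n - 1" if "y \<in> V - {x}" for y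
          using less.prems x cV that by (auto simp: card_Diff_subset card_insert_if split: if_splits)
        then show ?thesis using less.prems x cV by simp
      qed
      ultimately show ?thesis by simp
    qed
    finally show ?thesis
      using cV by (cases n; cases "n - 1") simp_all
  qed simp
qed

definition matching_on :: "('x \<Rightarrow> 'x) \<Rightarrow> 'x set \<Rightarrow> bool" where
  "matching_on c V \<longleftrightarrow> (\<forall>v\<in>V. c v \<in> V \<and> c (c v) = v \<and> c v \<noteq> v)"

text \<open>Square roots of a fixed-point-free involution \<open>c\<close> consist of 4-cycles
  \<open>(x, y, c x, c y)\<close>, where \<open>y\<close> is any of the \<open>n - 2\<close> points
  other than \<open>x\<close> and \<open>c x\<close>.\<close>

fun num_square_roots :: "nat \<Rightarrow> nat" where
  "num_square_roots n = (if n = 0 then 1 else if n < 4 then 0 else (n - 2) * num_square_roots (n - 4))"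

text \<open>Cube roots of a fixed-point-free involution \<open>c\<close> consist of transpositions
  \<open>(x, c x)\<close> and 6-cycles \<open>(x, y, z, c x, c y, c z)\<close>, with
  \<open>n - 2\<close> choices for \<open>y\<close> and then \<open>n - 4\<close> for
  \<open>z\<close>. The value at \<open>n = 1\<close> is a default, since a matching has an even
  number of points.\<close>

fun num_cube_roots :: "nat \<Rightarrow> nat" where
  "num_cube_roots n = (if n < 2 then 1 else num_cube_roots (n - 2) +
     (if n < 6 then 0 else (n - 2) * (n - 4) * num_cube_roots (n - 6)))"

declare num_square_roots.simps [simp del] num_cube_roots.simps [simp del]

lemma card_square_roots:
  "finite V \<Longrightarrow> matching_on c V \<Longrightarrow> card (perms (is_square_root c) V) = num_square_roots (card V)"
proof (induction "card V" arbitrary: V rule: less_induct)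
  case less
  show ?case
  proof (cases "V = {}")
    case True
    then show ?thesis by (simp add: num_square_roots.simps)
  next
    case False
    then obtain x where x: "x \<in> V" by blast
    have c: "c v \<in> V" "c (c v) = v" "c v \<noteq> v" if "v \<in> V" for v
      using less.prems that by (auto simp: matching_on_def)
    let ?Y = "V - {x, c x}"
    let ?L = "(\<lambda>y. [x, y, c x, c y]) ` ?Y"
    have Y: "finite ?Y" "card ?Y = card V - 2"
      using less.prems x c[OF x] by (auto simp: card_Diff_subset card_insert_if)
    have d: "distinct [x, y, c x, c y]" "{x, y, c x, c y} \<subseteq> V" if "y \<in> ?Y" for y
      using that x c[OF x] c[of y] by auto
    have card4: "card {x, y, c x, c y} = 4" if "y \<in> ?Y" for y
      using distinct_card[OF d(1)[OF that]] by simp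
    have ge4: "card V \<ge> 4" if "y \<in> ?Y" for y
      using card_mono[OF less.prems(1) d(2)[OF that]] card4[OF that] by simp
    have "card (perms (is_square_root c) V) = (\<Sum>xs\<in>?L. card (perms (is_square_root c) (V - set xs)))"
    proof (rule card_perms_cycles[OF less.prems(1)])
      show "finite ?L" using Y by blast
    next
      fix xs assume "xs \<in> ?L"
      then obtain y where y: "y \<in> ?Y" "xs = [x, y, c x, c y]" by blast
      show "set xs \<subseteq> V \<and> cycle_respects (is_square_root c) xs"
        using cycle_values(3)[OF d(1)[OF y(1)]] c[of x] c[of y] x y
        by (simp add: is_square_root_def cycle_respects_def del: cycle_of_list.simps)
    next
      fix p assume p: "p \<in> perms (is_square_root c) V"
      then have "inj p" by (auto simp: perms_def permutes_inj)
      have pV: "p v \<in> V" "p (p v) = c v" if "v \<in> V" for v using that p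
        by (auto simp: perms_def is_square_root_def permutes_in_image)
      have pc: "p (c x) = c (p x)" "p (c (p x)) = x"
        using pV(2)[OF x] pV(2)[OF pV(1)[OF x]] pV(2)[of "c x"] c[OF x] by simp_all
      have "p x \<noteq> x"
        using pV(2)[OF x] c(3)[OF x] by auto
      \<comment> \<open>From \<open>p x = c x = p (p x)\<close> injectivity would give
        \<open>p x = x\<close>.\<close>
      moreover have "p x \<noteq> c x"
        using pV(2)[OF x] \<open>inj p\<close> calculation by (auto simp: inj_def)
      ultimately have y: "p x \<in> ?Y"
        using pV(1)[OF x] by blast
      show "\<exists>!xs. xs \<in> ?L \<and> (\<forall>v\<in>set xs. p v = cycle_of_list xs v)"
      proof (rule ex1I[of _ "[x, p x, c x, c (p x)]"])
        show "[x, p x, c x, c (p x)] \<in> ?L \<and> (\<forall>v\<in>set [x, p x, c x, c (p x)]. p v = cycle_of_list [x, p x, c x, c (p x)] v)"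
          using cycle_values(3)[OF d(1)[OF y]] y pV(2)[OF x] pc by (auto simp del: cycle_of_list.simps)
        fix xs assume xs: "xs \<in> ?L \<and> (\<forall>v\<in>set xs. p v = cycle_of_list xs v)"
        then obtain y where y: "y \<in> ?Y" "xs = [x, y, c x, c y]" by blast
        then show "xs = [x, p x, c x, c (p x)]"
          using xs cycle_values(3)[OF d(1)[OF y(1)]] by (simp del: cycle_of_list.simps)
      qed
    qed
    also have "\<dots> = (\<Sum>y\<in>?Y. card (perms (is_square_root c) (V - {x, y, c x, c y})))"
      by (simp add: sum.reindex inj_on_def)
    also have "\<dots> = (\<Sum>y\<in>?Y. num_square_roots (card V - 4))"
    proof (rule sum.cong[OF refl])
      fix y assume y: "y \<in> ?Y"
      have "matching_on c (V - {x, y, c x, c y})"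
        using c x y unfolding matching_on_def by (metis DiffD1 DiffD2 DiffI insert_iff empty_iff)
      moreover have "card (V - {x, y, c x, c y}) = card V - 4"
        using card_Diff_subset[OF _ d(2)[OF y]] card4[OF y] by simp
      ultimately show "card (perms (is_square_root c) (V - {x, y, c x, c y})) = num_square_roots (card V - 4)"
        using less.hyps[of "V - {x, y, c x, c y}"] less.prems ge4[OF y] by simp
    qed
    also have "\<dots> = num_square_roots (card V)"
    proof (cases "card V < 4")
      case True
      then have "?Y = {}" using ge4 by fastforce
      then show ?thesis
        using True less.prems(1) x by (auto simp: num_square_roots.simps[of "card V"])
    next
      case False
      then show ?thesis
        using Y(2) by (simp add: num_square_roots.simps[of "card V"])
    qed
    finally show ?thesis .
  qed
qed

lemma card_cube_roots:
  "finite V \<Longrightarrow> matching_on c V \<Longrightarrow> card (perms (is_cube_root c) V) = num_cube_roots (card V)"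
proof (induction "card V" arbitrary: V rule: less_induct)
  case less
  show ?case
  proof (cases "V = {}")
    case True
    then show ?thesis by (simp add: num_cube_roots.simps)
  next
    case False
    then obtain x where x: "x \<in> V" by blast
    have c: "c v \<in> V" "c (c v) = v" "c v \<noteq> v" if "v \<in> V" for v
      using less.prems that by (auto simp: matching_on_def)
    have d2: "distinct [x, c x]" "{x, c x} \<subseteq> V"
      using c[OF x] x by auto
    have ge2: "card V \<ge> 2"
      using card_mono[OF less.prems(1) d2(2)] distinct_card[OF d2(1)] by simp
    define Y where "Y = (SIGMA y:V - {x, c x}. V - {x, c x, y, c y})"
    have memY: "(y, z) \<in> Y \<longleftrightarrow> y \<in> V - {x, c x} \<and> z \<in> V - {x, c x, y, c y}" for y z
      by (simp add: Y_def)
    let ?c6 = "\<lambda>y z. [x, y, z, c x, c y, c z]"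
    let ?L = "insert [x, c x] ((\<lambda>(y, z). ?c6 y z) ` Y)"
    have memL: "xs \<in> ?L \<longleftrightarrow> xs = [x, c x] \<or> (\<exists>y z. (y, z) \<in> Y \<and> xs = ?c6 y z)" for xs
      by auto
    have d4: "distinct [x, c x, y, c y]" "{x, c x, y, c y} \<subseteq> V" if "y \<in> V - {x, c x}" for y
      using that x c[OF x] c[of y] by auto
    have d6: "distinct (?c6 y z)" "set (?c6 y z) \<subseteq> V" if "(y, z) \<in> Y" for y z
    proof -
      note that = that[unfolded memY]
      have "y \<in> V" "z \<in> V" using that by auto
      then show "set (?c6 y z) \<subseteq> V" using c x by simp
      have "c x \<noteq> y" "c x \<noteq> z" "c y \<noteq> x" "c y \<noteq> z" "c z \<noteq> x" "c z \<noteq> y"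
        using that c[OF \<open>y \<in> V\<close>] c[OF \<open>z \<in> V\<close>] c[OF x] by auto
      moreover have "c x \<noteq> c y" "c x \<noteq> c z" "c y \<noteq> c z"
        using that c[OF \<open>y \<in> V\<close>] c[OF \<open>z \<in> V\<close>] c[OF x] by auto
      ultimately show "distinct (?c6 y z)"
        using that c(3)[OF \<open>y \<in> V\<close>] c(3)[OF \<open>z \<in> V\<close>] c(3)[OF x] by auto
    qed
    have card6: "card (set (?c6 y z)) = 6" if "(y, z) \<in> Y" for y z
      using distinct_card[OF d6(1)[OF that]] by simp
    have ge6: "card V \<ge> 6" if "(y, z) \<in> Y" for y z
      using card_mono[OF less.prems(1) d6(2)[OF that]] card6[OF that] by simp
    have Y: "finite Y" "card Y = (card V - 2) * (card V - 4)"
    proof -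
      show "finite Y" using less.prems by (simp add: Y_def)
      have "card (V - {x, c x, y, c y}) = card V - 4" if "y \<in> V - {x, c x}" for y
        using card_Diff_subset[OF _ d4(2)[OF that]] distinct_card[OF d4(1)[OF that]] by simp
      moreover have "card (V - {x, c x}) = card V - 2"
        using card_Diff_subset[OF _ d2(2)] distinct_card[OF d2(1)] by simp
      ultimately show "card Y = (card V - 2) * (card V - 4)"
        using less.prems by (simp add: Y_def)
    qed
    have "card (perms (is_cube_root c) V) = (\<Sum>xs\<in>?L. card (perms (is_cube_root c) (V - set xs)))"
    proof (rule card_perms_cycles[OF less.prems(1)])
      show "finite ?L" using Y(1) by blast
    next
      fix xs assume "xs \<in> ?L"
      then consider "xs = [x, c x]" | y z where "(y, z) \<in> Y" "xs = ?c6 y z" using memL by blast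
      then show "set xs \<subseteq> V \<and> cycle_respects (is_cube_root c) xs"
      proof cases
        case 1
        then show ?thesis
          using cycle_values(1)[OF d2(1)] c[OF x] x by (simp add: is_cube_root_def cycle_respects_def del: cycle_of_list.simps)
      next
        case (2 y z)
        then have "y \<in> V" "z \<in> V" by (auto simp: memY)
        then show ?thesis
          using cycle_values(4)[OF d6(1)[OF 2(1)]] c x d6(2)[OF 2(1)] 2(2)
          by (simp add: is_cube_root_def cycle_respects_def del: cycle_of_list.simps)
      qed
    next
      fix p assume p: "p \<in> perms (is_cube_root c) V"
      then have "inj p" by (auto simp: perms_def permutes_inj)
      then have inj: "p u = p v \<longleftrightarrow> u = v" for u v by (simp add: inj_eq)
      have pV: "p v \<in> V" and p3: "p (p (p v)) = c v" if "v \<in> V" for v using that p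
        by (auto simp: perms_def is_cube_root_def permutes_in_image)
      \<comment> \<open>A root of \<open>c\<close> commutes with \<open>c\<close>: both sides are
        \<open>p\<close> applied four times to \<open>v\<close>.\<close>
      have pc: "p (c v) = c (p v)" if "v \<in> V" for v
        using p3[OF that] p3[OF pV[OF that]] by simp
      have px: "p x \<noteq> x"
        using p3[OF x] c(3)[OF x] by auto
      show "\<exists>!xs. xs \<in> ?L \<and> (\<forall>v\<in>set xs. p v = cycle_of_list xs v)"
      proof (cases "p x = c x")
        case True
        then have "p (c x) = x" using pc[OF x] c(2)[OF x] by simp
        show ?thesis
        proof (rule ex1I[of _ "[x, c x]"])
          show "[x, c x] \<in> ?L \<and> (\<forall>v\<in>set [x, c x]. p v = cycle_of_list [x, c x] v)"
          proof
            show "\<forall>v\<in>set [x, c x]. p v = cycle_of_list [x, c x] v"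
              using cycle_values(1)[OF d2(1)] True \<open>p (c x) = x\<close> by (simp del: cycle_of_list.simps)
          qed blast
          fix xs assume xs: "xs \<in> ?L \<and> (\<forall>v\<in>set xs. p v = cycle_of_list xs v)"
          show "xs = [x, c x]"
          proof (rule ccontr)
            assume "xs \<noteq> [x, c x]"
            then obtain y z where yz: "(y, z) \<in> Y" "xs = ?c6 y z" using xs memL by blast
            then have "p x = y"
              using cycle_values(4)[OF d6(1)[OF yz(1)]] xs by (simp del: cycle_of_list.simps)
            then show False using True yz(1) by (auto simp: memY)
          qed
        qed
      next
        case False
        let ?y = "p x" and ?z = "p (p x)"
        have "?z \<noteq> x" using p3[OF x] False by auto
        moreover have "?z \<noteq> c x" using p3[OF x] inj px by metis
        moreover have "?z \<noteq> ?y" using inj px by simp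
        moreover have "?z \<noteq> c ?y" using pc[OF x] inj False by metis
        ultimately have yz: "(?y, ?z) \<in> Y"
          using px False pV x by (auto simp: memY)
        have v: "p (p (p x)) = c x" "p (c x) = c ?y" "p (c ?y) = c ?z" "p (c ?z) = x"
          using p3[OF x] pc[OF x] pc[OF pV[OF x]] pc[OF pV[OF pV[OF x]]] c(2)[OF x] by simp_all
        show ?thesis
        proof (rule ex1I[of _ "?c6 ?y ?z"])
          show "?c6 ?y ?z \<in> ?L \<and> (\<forall>v\<in>set (?c6 ?y ?z). p v = cycle_of_list (?c6 ?y ?z) v)"
          proof
            show "?c6 ?y ?z \<in> ?L" unfolding memL using yz by blast
            show "\<forall>v\<in>set (?c6 ?y ?z). p v = cycle_of_list (?c6 ?y ?z) v"
              using cycle_values(4)[OF d6(1)[OF yz]] v by (simp del: cycle_of_list.simps)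
          qed
          fix xs assume xs: "xs \<in> ?L \<and> (\<forall>v\<in>set xs. p v = cycle_of_list xs v)"
          have "xs \<noteq> [x, c x]"
            using xs False cycle_values(1)[OF d2(1)] by (auto simp del: cycle_of_list.simps)
          then obtain y z where yz: "(y, z) \<in> Y" "xs = ?c6 y z" using xs memL by blast
          then show "xs = ?c6 ?y ?z"
            using xs cycle_values(4)[OF d6(1)[OF yz(1)]] by (simp del: cycle_of_list.simps)
        qed
      qed
    qed
    also have "\<dots> = card (perms (is_cube_root c) (V - {x, c x})) +
      (\<Sum>(y, z)\<in>Y. card (perms (is_cube_root c) (V - set (?c6 y z))))"
    proof -
      have "inj_on (\<lambda>(y, z). ?c6 y z) Y" by (auto simp: inj_on_def)
      moreover have "[x, c x] \<notin> (\<lambda>(y, z). ?c6 y z) ` Y" by auto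
      ultimately show ?thesis
        using Y(1) by (simp add: sum.reindex split_def)
    qed
    also have "card (perms (is_cube_root c) (V - {x, c x})) = num_cube_roots (card V - 2)"
    proof -
      have "matching_on c (V - {x, c x})"
        using c x unfolding matching_on_def by (metis DiffD1 DiffD2 DiffI insert_iff empty_iff)
      moreover have "card (V - {x, c x}) = card V - 2"
        using card_Diff_subset[OF _ d2(2)] distinct_card[OF d2(1)] by simp
      ultimately show ?thesis
        using less.hyps[of "V - {x, c x}"] less.prems ge2 by simp
    qed
    also have "(\<Sum>(y, z)\<in>Y. card (perms (is_cube_root c) (V - set (?c6 y z)))) =
      (\<Sum>(y, z)\<in>Y. num_cube_roots (card V - 6))"
    proof (rule sum.cong[OF refl])
      fix yz assume "yz \<in> Y"
      then obtain y z where yz: "yz = (y, z)" "(y, z) \<in> Y" "y \<in> V" "z \<in> V" using memY by (cases yz) auto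
      have "matching_on c (V - set (?c6 y z))"
        unfolding matching_on_def
      proof
        fix v assume v: "v \<in> V - set (?c6 y z)"
        then have "c v \<notin> set (?c6 y z)"
          using c(2)[of v] c(2)[OF x] c(2)[OF yz(3)] c(2)[OF yz(4)] by auto
        then show "c v \<in> V - set (?c6 y z) \<and> c (c v) = v \<and> c v \<noteq> v"
          using c[of v] v by blast
      qed
      moreover have "card (V - set (?c6 y z)) = card V - 6"
        using card_Diff_subset[OF _ d6(2)[OF yz(2)]] card6[OF yz(2)] by simp
      ultimately show "(case yz of (y, z) \<Rightarrow> card (perms (is_cube_root c) (V - set (?c6 y z)))) =
        (case yz of (y, z) \<Rightarrow> num_cube_roots (card V - 6))"
        using less.hyps[of "V - set (?c6 y z)"] less.prems ge6[OF yz(2)] yz(1) by simp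
    qed
    also have "num_cube_roots (card V - 2) + (\<Sum>(y, z)\<in>Y. num_cube_roots (card V - 6)) = num_cube_roots (card V)"
    proof (cases "card V < 6")
      case True
      then have "Y = {}" using ge6 by fastforce
      then show ?thesis
        using True ge2 by (simp add: num_cube_roots.simps[of "card V"])
    next
      case False
      then show ?thesis
        using Y(2) by (simp add: num_cube_roots.simps[of "card V"] split_def)
    qed
    finally show ?thesis .
  qed
qed

lemma card_generator_pairs_True: "finite V \<Longrightarrow> card (generator_pairs True V) = num_involutions True (card V) * num_cube_one (card V)"
proof -
  assume V: "finite V"
  have "generator_pairs True V = involutions V \<times> cube_roots_of_one V"
  proof (intro equalityI subrelI)
    fix a b assume "(a, b) \<in> generator_pairs True V"
    then have a: "a permutes V" "\<forall>v\<in>V. a (a v) = v" and b: "b permutes V" "b \<circ> b \<circ> b = a \<circ> a"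
      by (auto simp: generator_pairs_def)
    have "b (b (b v)) = a (a v)" for v
      using fun_cong[OF b(2), of v] by simp
    with a b show "(a, b) \<in> involutions V \<times> cube_roots_of_one V"
      by (simp add: perms_def is_involution_def is_cube_root_def)
  next
    fix a b assume "(a, b) \<in> involutions V \<times> cube_roots_of_one V"
    then have a: "a permutes V" "\<forall>v\<in>V. a (a v) = v" and b: "b permutes V" "\<forall>v\<in>V. b (b (b v)) = v"
      by (auto simp: perms_def is_involution_def is_cube_root_def)
    have "a \<circ> a = id" "b \<circ> b \<circ> b = id"
      using a b permutes_not_in[OF a(1)] permutes_not_in[OF b(1)] by (auto simp: fun_eq_iff)
    with a b show "(a, b) \<in> generator_pairs True V"
      by (simp add: generator_pairs_def)
  qed
  then show ?thesis
    using card_involutions[OF V] card_cube_one[OF V] by (simp add: card_cartesian_product)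
qed

text \<open>The permutation by which \<open>-1\<close> acts is a matching \<open>c\<close>. Given
  \<open>c\<close>, the generators are chosen independently as a square root and a cube root of it,
  and the number of roots depends only on the number of points.\<close>

lemma card_generator_pairs_False:
  "finite V \<Longrightarrow> card (generator_pairs False V) = num_involutions False (card V) * num_square_roots (card V) * num_cube_roots (card V)"
proof -
  assume V: "finite V"
  let ?R = "\<lambda>c. perms (is_square_root c) V \<times> perms (is_cube_root c) V"
  have match: "matching_on c V" if "c \<in> matchings V" for c
    using that by (auto simp: perms_def is_involution_def matching_on_def permutes_in_image)
  have out: "p (p v) = v" "p (p (p v)) = v" if "p permutes V" "v \<notin> V" for p v
    using permutes_not_in[OF that] by simp_all
  have root: "a \<circ> a = c" if "c \<in> matchings V" "a \<in> perms (is_square_root c) V" for a c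
  proof
    fix v show "(a \<circ> a) v = c v"
      using that out[of a v] permutes_not_in[of c V v]
      by (cases "v \<in> V") (auto simp: perms_def is_square_root_def)
  qed
  have "generator_pairs False V = (\<Union>c\<in>matchings V. ?R c)"
  proof (intro equalityI subrelI)
    fix a b assume "(a, b) \<in> generator_pairs False V"
    then have a: "a permutes V" "\<forall>v\<in>V. a (a v) \<noteq> v" "a \<circ> a \<circ> a \<circ> a = id" and b: "b permutes V" "b \<circ> b \<circ> b = a \<circ> a"
      by (auto simp: generator_pairs_def)
    have "b (b (b v)) = a (a v)" "a (a (a (a v))) = v" for v
      using fun_cong[OF b(2), of v] fun_cong[OF a(3), of v] by simp_all
    then have "a \<circ> a \<in> matchings V" "(a, b) \<in> ?R (a \<circ> a)"
      using a b permutes_compose[OF a(1) a(1)]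
      by (auto simp: perms_def is_involution_def is_square_root_def is_cube_root_def)
    then show "(a, b) \<in> (\<Union>c\<in>matchings V. ?R c)"
      by blast
  next
    fix a b assume "(a, b) \<in> (\<Union>c\<in>matchings V. ?R c)"
    then obtain c where c: "c \<in> matchings V" and a: "a \<in> perms (is_square_root c) V"
      and b: "b \<in> perms (is_cube_root c) V" by blast
    have aa: "a \<circ> a = c" using root[OF c a] .
    have "b \<circ> b \<circ> b = c"
    proof
      fix v show "(b \<circ> b \<circ> b) v = c v"
        using b c out[of b v] permutes_not_in[of c V v]
        by (cases "v \<in> V") (auto simp: perms_def is_cube_root_def is_involution_def)
    qed
    moreover have "c \<circ> c = id"
    proof
      fix v show "(c \<circ> c) v = id v"
        using c out[of c v] by (cases "v \<in> V") (auto simp: perms_def is_involution_def)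
    qed
    moreover have "\<forall>v\<in>V. a (a v) \<noteq> v"
      using aa c by (auto simp: perms_def is_involution_def)
    moreover have "a \<circ> a \<circ> a \<circ> a = (a \<circ> a) \<circ> (a \<circ> a)"
      by (simp add: comp_assoc)
    ultimately show "(a, b) \<in> generator_pairs False V"
      using a b aa by (simp add: generator_pairs_def perms_def)
  qed
  then have "card (generator_pairs False V) = card (\<Union>c\<in>matchings V. ?R c)"
    by simp
  also have "\<dots> = (\<Sum>c\<in>matchings V. card (?R c))"
  proof (rule card_UN_disjoint)
    show "\<forall>c\<in>matchings V. \<forall>d\<in>matchings V. c \<noteq> d \<longrightarrow> ?R c \<inter> ?R d = {}"
      using root by blast
  qed (use finite_perms[OF V] in auto)
  also have "\<dots> = (\<Sum>c\<in>matchings V. num_square_roots (card V) * num_cube_roots (card V))"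
    using card_square_roots[OF V match] card_cube_roots[OF V match]
    by (intro sum.cong refl) (simp add: card_cartesian_product)
  finally show ?thesis
    by (simp add: card_involutions[OF V] mult.assoc)
qed

section \<open>Subgroup numbers and their recurrences in exponential form\<close>

definition count_with :: "nat \<Rightarrow> nat" where
  "count_with n = (if n = 0 then 0 else card (group.subgroups_of_index SL2Z (- mat 1) True n))"

text \<open>Here and in \<open>count_with\<close> the value at 0 is set to 0. The sets of index 0
  hold the subgroups of infinite index, whose cosets have \<open>card\<close> 0, while the
  generating functions must have constant term 0.\<close>

definition count_without :: "nat \<Rightarrow> nat" where
  "count_without n = (if n = 0 then 0 else card (group.subgroups_of_index SL2Z (- mat 1) False n))"

lemma s_SL2Z_split:
  "n > 0 \<Longrightarrow> s_SL2Z n = count_with n + count_without n"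
  using num_subgroups_SL2Z_split[OF finite_subgroups_SL2Z]
  by (simp add: count_with_def count_without_def)

text \<open>Division by \<open>(n - 1)!\<close> turns the recurrence into a convolution, the
  coefficient of \<open>z^n\<close> in \<open>z F' = P F\<close> with \<open>F\<close> the
  exponential series of \<open>a\<close> and \<open>P\<close> the ordinary series of
  \<open>N\<close>.\<close>

lemma normalised_recurrence:
  fixes a N :: "nat \<Rightarrow> nat"
  assumes "a n = (\<Sum>k=1..n. N k * (fact (n - 1) div fact (n - k)) * a (n - k))" "n > 0"
  shows "real n * (real (a n) / fact n) = (\<Sum>k=1..n. real (N k) * (real (a (n - k)) / fact (n - k)))"
proof -
  have "real (a n) = (\<Sum>k=1..n. real (N k) * (fact (n - 1) / fact (n - k)) * real (a (n - k)))"
  proof -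
    have "real (fact (n - 1) div fact (n - k)) = fact (n - 1) / fact (n - k)" if "k \<in> {1..n}" for k
    proof -
      have "(fact (n - k) :: nat) dvd fact (n - 1)"
        using that by (intro fact_dvd) auto
      then show ?thesis by (simp add: real_of_nat_div)
    qed
    then show ?thesis
      unfolding assms(1) of_nat_sum of_nat_mult by (intro sum.cong refl) simp
  qed
  moreover have "fact n = real n * fact (n - 1)"
    using assms(2) by (simp add: fact_reduce)
  ultimately show ?thesis
    using assms(2) by (simp add: sum_divide_distrib field_simps sum_distrib_left)
qed

lemma recurrence_with_minus_one:
  assumes "n > 0"
  shows "real n * (real (num_involutions True n * num_cube_one n) / fact n) =
    (\<Sum>k=1..n. real (count_with k) * (real (num_involutions True (n - k) * num_cube_one (n - k)) / fact (n - k)))"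
  by (rule normalised_recurrence[OF _ assms])
    (use card_generator_pairs_recurrence[OF card_generator_pairs_True assms] in \<open>simp add: count_with_def\<close>)

lemma recurrence_without_minus_one:
  fixes q defines "q \<equiv> \<lambda>n. num_involutions False n * num_square_roots n * num_cube_roots n"
  assumes "n > 0"
  shows "q n = (\<Sum>k=1..n. count_without k * (fact (n - 1) div fact (n - k)) * q (n - k))"
    "real n * (real (q n) / fact n) = (\<Sum>k=1..n. real (count_without k) * (real (q (n - k)) / fact (n - k)))"
proof -
  show *: "q n = (\<Sum>k=1..n. count_without k * (fact (n - 1) div fact (n - k)) * q (n - k))"
    using card_generator_pairs_recurrence[OF card_generator_pairs_False assms(2)] by (simp add: count_without_def q_def)
  show "real n * (real (q n) / fact n) = (\<Sum>k=1..n. real (count_without k) * (real (q (n - k)) / fact (n - k)))"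
    by (rule normalised_recurrence[OF * assms(2)])
qed

section \<open>The Riccati equations\<close>

text \<open>At \<open>k = 0\<close> this is the exponential series of the actions in which
  \<open>-1\<close> is trivial. Shifting only the index of the involution numbers gives a family on
  which both recurrences and differentiation can be expressed.\<close>

definition hom_series :: "nat \<Rightarrow> real fps" where
  "hom_series k = Abs_fps (\<lambda>n. real (num_involutions True (n + k) * num_cube_one n) / fact n)"

lemma num_involutions_rec: "num_involutions True (Suc n) = num_involutions True n + n * num_involutions True (n - 1)"
  by (cases n) simp_all

lemma num_cube_one_rec: "num_cube_one (Suc n) = num_cube_one n + n * (n - 1) * num_cube_one (n - 2)"
  by (cases n; cases "n - 1") (simp_all add: numeral_2_eq_2)

lemma fact3: "fact (n + 3) = real (n + 3) * real (n + 2) * real (n + 1) * fact n"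
  by (simp add: numeral_3_eq_3 numeral_2_eq_2 algebra_simps)

lemma fact2: "fact (n + 2) = real (n + 2) * real (n + 1) * fact n"
  by (simp add: numeral_2_eq_2 algebra_simps)

lemma nat_cases3:
  obtains "n = 0" | "n = 1" | "n = 2" | m where "n = m + (3::nat)"
proof (cases "n < 3")
  case True then show ?thesis using that by (cases n; cases "n - 1") auto
next
  case False then show ?thesis using that(4)[of "n - 3"] by simp
qed

declare num_involutions.simps [simp del]

lemma num_involutions_0_1 [simp]: "num_involutions \<beta> 0 = 1" "num_involutions True (Suc 0) = 1"
  by (simp_all add: num_involutions.simps)

lemma fps_nth_of_nat_mult: "fps_nth (of_nat k * f) n = of_nat k * fps_nth f n"
  by (simp add: fps_of_nat[symmetric])

lemma fps_nth_hom_series: "fps_nth (hom_series k) n = real (num_involutions True (n + k) * num_cube_one n) / fact n"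
  by (simp add: hom_series_def)

text \<open>The involution recurrence at index \<open>n + k\<close> brings the factor
  \<open>n + k\<close>. Its part \<open>k\<close> gives the second term; its part \<open>n\<close>
  cancels against \<open>n!\<close>, and the recurrence for permutations of cube one splits the
  remainder into the last two terms.\<close>

lemma hom_series_step:
  "hom_series (Suc k) = hom_series k + of_nat k * hom_series (k - 1) + fps_X * hom_series k + fps_X ^ 3 * hom_series (k + 2)"
proof (rule fps_ext)
  fix n
  have I: "num_involutions True (n + Suc k) = num_involutions True (n + k) + (n + k) * num_involutions True (n + k - 1)"
    using num_involutions_rec[of "n + k"] by simp
  have k: "real k * num_involutions True (n + (k - 1)) = real k * num_involutions True (n + k - 1)"
    by (cases k) simp_all
  show "fps_nth (hom_series (Suc k)) n = fps_nth (hom_series k + of_nat k * hom_series (k - 1) + fps_X * hom_series k + fps_X ^ 3 * hom_series (k + 2)) n"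
  proof (cases n rule: nat_cases3)
    case (4 m)
    define A where "A = real (num_involutions True (n + k))"
    define B where "B = real (num_involutions True (n + k - 1))"
    define C where "C = real (num_cube_one (m + 2))"
    define D where "D = real (num_cube_one m)"
    define F :: real where "F = fact m"
    have F: "F \<noteq> 0" by (simp add: F_def)
    have Cn: "real (num_cube_one n) = C + (real m + 2) * (real m + 1) * D"
      using num_cube_one_rec[of "m + 2"] 4 by (simp add: numeral_3_eq_3 numeral_2_eq_2 C_def D_def algebra_simps)
    have Fn: "fact n = (real m + 3) * (real m + 2) * (real m + 1) * F"
      using fact3[of m] 4 by (simp add: F_def add_ac)
    have e1: "fps_nth (hom_series (Suc k)) n = (A + (real n + real k) * B) * (C + (real m + 2) * (real m + 1) * D)
        / ((real m + 3) * (real m + 2) * (real m + 1) * F)"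
      unfolding fps_nth_hom_series I of_nat_mult of_nat_add Cn Fn A_def B_def ..
    have e2: "fps_nth (hom_series k) n = A * (C + (real m + 2) * (real m + 1) * D)
        / ((real m + 3) * (real m + 2) * (real m + 1) * F)"
      unfolding fps_nth_hom_series of_nat_mult Cn Fn A_def ..
    have e3: "fps_nth (of_nat k * hom_series (k - 1)) n = real k * B * (C + (real m + 2) * (real m + 1) * D)
        / ((real m + 3) * (real m + 2) * (real m + 1) * F)"
      unfolding fps_nth_hom_series fps_nth_of_nat_mult of_nat_mult Cn Fn times_divide_eq_right mult.assoc[symmetric] k B_def ..
    have e4: "fps_nth (fps_X * hom_series k) n = B * C / ((real m + 2) * (real m + 1) * F)"
    proof -
      have "fps_nth (fps_X * hom_series k) n = fps_nth (hom_series k) (m + 2)"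
        using 4 by (simp add: numeral_3_eq_3)
      moreover have "n + k - 1 = m + 2 + k" using 4 by simp
      ultimately show ?thesis
        using fact2[of m] by (simp add: fps_nth_hom_series B_def C_def F_def add_ac)
    qed
    have e5: "fps_nth (fps_X ^ 3 * hom_series (k + 2)) n = B * D / F"
    proof -
      have "fps_nth (fps_X ^ 3 * hom_series (k + 2)) n = fps_nth (hom_series (k + 2)) m"
        using 4 by (simp add: fps_X_power_mult_nth)
      moreover have "n + k - 1 = m + (k + 2)" using 4 by simp
      ultimately show ?thesis
        by (simp add: fps_nth_hom_series B_def D_def F_def)
    qed
    have e6: "real n = real m + 3" using 4 by simp
    show ?thesis
      unfolding fps_add_nth e1 e2 e3 e4 e5 e6 using F
      by (simp add: divide_simps add_eq_0_iff) (simp add: algebra_simps)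
  next
    case 1
    have "fps_nth (fps_X ^ 3 * hom_series (k + 2)) n = 0" using 1 by (simp add: fps_X_power_mult_nth)
    then show ?thesis
      unfolding fps_add_nth using I k 1 by (simp add: fps_nth_hom_series fps_nth_of_nat_mult)
  next
    case 2
    have "fps_nth (fps_X ^ 3 * hom_series (k + 2)) n = 0" using 2 by (simp add: fps_X_power_mult_nth)
    then show ?thesis
      unfolding fps_add_nth using I k 2 by (auto simp: fps_nth_hom_series fps_nth_of_nat_mult algebra_simps)
  next
    case 3
    have "fps_nth (fps_X ^ 3 * hom_series (k + 2)) n = 0" using 3 by (simp add: fps_X_power_mult_nth)
    moreover have "num_cube_one n = 1" using 3 by (simp add: numeral_2_eq_2)
    moreover have "fps_nth (fps_X * hom_series k) n = real (num_involutions True (n + k - 1))"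
      using 3 by (simp add: fps_nth_hom_series)
    ultimately show ?thesis
      unfolding fps_add_nth fps_nth_hom_series fps_nth_of_nat_mult I of_nat_mult of_nat_add
      using k 3 by (auto simp: fact_numeral field_simps)
  qed
qed

text \<open>Differentiation raises both indices by one; the recurrence for permutations of cube one
  brings the second index back, to \<open>n\<close> and to \<open>n - 2\<close>.\<close>

lemma hom_series_deriv: "fps_deriv (hom_series k) = hom_series (Suc k) + fps_X ^ 2 * hom_series (k + 3)"
proof (rule fps_ext)
  fix n
  have d: "fps_nth (fps_deriv (hom_series k)) n = real (num_involutions True (Suc n + k)) * real (num_cube_one (Suc n)) / fact n"
    by (simp add: fps_nth_hom_series)
  consider "n = 0" | "n = 1" | m where "n = m + 2"
    by (metis One_nat_def Suc_1 add.commute add_2_eq_Suc' not0_implies_Suc)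
  then show "fps_nth (fps_deriv (hom_series k)) n = fps_nth (hom_series (Suc k) + fps_X ^ 2 * hom_series (k + 3)) n"
  proof cases
    case (3 m)
    define A where "A = real (num_involutions True (Suc n + k))"
    define F :: real where "F = fact m"
    have F: "F \<noteq> 0" by (simp add: F_def)
    have e1: "real (num_cube_one (Suc n)) = real (num_cube_one n) + real (m + 2) * real (m + 1) * real (num_cube_one m)"
      using num_cube_one_rec[of n] 3 by (simp add: algebra_simps)
    have e2: "fact n = real (m + 2) * real (m + 1) * F"
      using fact2[of m] 3 by (simp add: F_def)
    have e3: "fps_nth (fps_X ^ 2 * hom_series (k + 3)) n = A * real (num_cube_one m) / F"
    proof -
      have "fps_nth (fps_X ^ 2 * hom_series (k + 3)) n = fps_nth (hom_series (k + 3)) m"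
        using 3 by (simp add: fps_X_power_mult_nth)
      moreover have e: "Suc n + k = m + (k + 3)" using 3 by simp
      ultimately show ?thesis
        unfolding A_def e by (simp add: fps_nth_hom_series F_def)
    qed
    have e4: "fps_nth (hom_series (Suc k)) n = A * real (num_cube_one n) / fact n"
      by (simp add: fps_nth_hom_series A_def)
    show ?thesis
      unfolding d fps_add_nth e3 e4 A_def[symmetric] e1 e2 using F
      by (simp add: divide_simps add_eq_0_iff) (simp add: algebra_simps)
  qed (simp_all add: d fps_nth_hom_series fps_X_power_mult_nth numeral_2_eq_2)
qed

text \<open>Elimination: \<open>a\<close>, \<open>b\<close>, \<open>c\<close> express
  \<open>M2\<close>, \<open>M3\<close>, \<open>M4\<close> by \<open>M0\<close> and
  \<open>M1\<close>, up to powers of \<open>z\<close>. With \<open>P = z D0 / M0\<close>, relation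
  \<open>h\<close> reduces \<open>M1\<close> to \<open>M0\<close>, and \<open>h'\<close> is the
  derivative of \<open>h\<close>. Comparing \<open>h'\<close> with the direct expression
  \<open>i\<close> for \<open>D1\<close> gives a polynomial times \<open>M0\<close> equal to 0, and
  \<open>M0\<close> and then \<open>z^3\<close> cancel.\<close>

lemma riccati_alg:
  fixes z P P' M0 M1 M2 M3 M4 D0 D1 :: "'a::idom"
  assumes a: "M1 = M0 + z * M0 + z^3 * M2"
    and b: "M2 = M1 + M0 + z * M1 + z^3 * M3"
    and c: "M3 = M2 + 2 * M1 + z * M2 + z^3 * M4"
    and d: "D0 = M1 + z^2 * M3" and e: "D1 = M2 + z^2 * M4"
    and f: "z * D0 = P * M0"
    and h': "(1 - z^3) * D1 - 3 * z^2 * M1 = (3 * z^2 * P + z^3 * P' + 1 + 3 * z^2) * M0 + (z^3 * P + 1 + z + z^3) * D0"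
    and h: "(1 - z^3) * M1 = (z^3 * P + 1 + z + z^3) * M0"
    and nz: "M0 \<noteq> 0" "z \<noteq> 0"
  shows "P = z + z^2 + 4*z^3 + 4*z^4 - z^5 + 4*z^6 - 2*z^7 - 2*z^9
    + (4*z^3 + 2*z^4 + 3*z^6 - 2*z^7 - 3*z^9) * P + (z^6 - z^9) * (z * P' + P^2)"
proof -
  define q where "q = z^3 * P + 1 + z + z^3"
  have a': "z^3 * M2 = M1 - (1 + z) * M0" using a by (simp add: algebra_simps)
  have b': "z^3 * M3 = M2 - (1 + z) * M1 - M0" using b by (simp add: algebra_simps)
  have c': "z^3 * M4 = M3 - (1 + z) * M2 - 2 * M1" using c by (simp add: algebra_simps)
  have i: "z^7 * D1 = (1 - z^3) * (M1 - (1 + z) * M0) - z^3 * (1 + z) * M1 - z^3 * M0 - 2 * z^6 * M1"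
  proof -
    have "z^7 * D1 = z^4 * (z^3 * M2) + z^6 * (z^3 * M4)" unfolding e by algebra
    also have "z^6 * (z^3 * M4) = z^3 * (z^3 * M3) - z^3 * (1 + z) * (z^3 * M2) - 2 * z^6 * M1"
      unfolding c' by algebra
    also have "z^3 * (z^3 * M3) = z^3 * M2 - z^3 * (1 + z) * M1 - z^3 * M0"
      unfolding b' by algebra
    finally show ?thesis unfolding a' by algebra
  qed
  have i': "(1 - z^3) * (z^7 * D1) = ((1 - z^3) * (q - (1 - z^3) * (1 + z)) - z^3 * (1 + z) * q - (1 - z^3) * z^3 - 2 * z^6 * q) * M0"
    unfolding i using h unfolding q_def[symmetric] by algebra
  have "(1 - z^3) * ((1 - z^3) * (z^7 * D1)) - 3 * z^9 * ((1 - z^3) * M1)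
    = z^7 * (1 - z^3) * (3 * z^2 * P + z^3 * P' + 1 + 3 * z^2) * M0 + q * z^6 * (1 - z^3) * (z * D0)"
    using h' unfolding q_def[symmetric] by algebra
  then have "((1 - z^3) * ((1 - z^3) * (q - (1 - z^3) * (1 + z)) - z^3 * (1 + z) * q - (1 - z^3) * z^3 - 2 * z^6 * q)
    - 3 * z^9 * q - z^7 * (1 - z^3) * (3 * z^2 * P + z^3 * P' + 1 + 3 * z^2) - q * z^6 * (1 - z^3) * P) * M0 = 0"
    unfolding i' h q_def[symmetric] f by algebra
  then have *: "(1 - z^3) * ((1 - z^3) * (q - (1 - z^3) * (1 + z)) - z^3 * (1 + z) * q - (1 - z^3) * z^3 - 2 * z^6 * q)
    - 3 * z^9 * q - z^7 * (1 - z^3) * (3 * z^2 * P + z^3 * P' + 1 + 3 * z^2) - q * z^6 * (1 - z^3) * P = 0"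
    using nz by simp
  have "z^3 * (P - (z + z^2 + 4*z^3 + 4*z^4 - z^5 + 4*z^6 - 2*z^7 - 2*z^9
    + (4*z^3 + 2*z^4 + 3*z^6 - 2*z^7 - 3*z^9) * P + (z^6 - z^9) * (z * P' + P^2))) = 0"
    using * unfolding q_def by algebra
  then show ?thesis using nz by simp
qed

lemma riccati_with_minus_one:
  fixes P :: "real fps"
  assumes "fps_X * fps_deriv (hom_series 0) = P * hom_series 0"
  shows "P = fps_X + fps_X^2 + 4*fps_X^3 + 4*fps_X^4 - fps_X^5 + 4*fps_X^6 - 2*fps_X^7 - 2*fps_X^9
    + (4*fps_X^3 + 2*fps_X^4 + 3*fps_X^6 - 2*fps_X^7 - 3*fps_X^9) * P
    + (fps_X^6 - fps_X^9) * (fps_X * fps_deriv P + P^2)"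
proof -
  let ?z = "fps_X :: real fps"
  have a: "hom_series 1 = hom_series 0 + ?z * hom_series 0 + ?z^3 * hom_series 2"
    using hom_series_step[of 0] by (simp add: eval_nat_numeral)
  have b: "hom_series 2 = hom_series 1 + hom_series 0 + ?z * hom_series 1 + ?z^3 * hom_series 3"
    using hom_series_step[of 1] by (simp add: eval_nat_numeral)
  have c: "hom_series 3 = hom_series 2 + 2 * hom_series 1 + ?z * hom_series 2 + ?z^3 * hom_series 4"
    using hom_series_step[of 2] by (simp add: eval_nat_numeral)
  have d: "fps_deriv (hom_series 0) = hom_series 1 + ?z^2 * hom_series 3" and e: "fps_deriv (hom_series 1) = hom_series 2 + ?z^2 * hom_series 4"
    using hom_series_deriv[of 0] hom_series_deriv[of 1] by (simp_all add: eval_nat_numeral)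
  \<comment> \<open>\<open>z^3 * P\<close> times the base series is \<open>z^4\<close> times its
    derivative. These powers of \<open>z\<close> are just enough to replace
    \<open>hom_series 3\<close> and then \<open>hom_series 2\<close> by the recurrences.\<close>
  have h: "(1 - ?z^3) * hom_series 1 = (?z^3 * P + 1 + ?z + ?z^3) * hom_series 0"
  proof -
    have "?z^3 * (P * hom_series 0) = ?z^4 * hom_series 1 + ?z^3 * (?z^3 * hom_series 3)"
      unfolding assms[symmetric] d by algebra
    also have "?z^3 * (?z^3 * hom_series 3) = ?z^3 * (hom_series 2 - hom_series 1 - hom_series 0 - ?z * hom_series 1)"
      using b by algebra
    also have "\<dots> = (hom_series 1 - hom_series 0 - ?z * hom_series 0) - ?z^3 * (hom_series 1 + hom_series 0 + ?z * hom_series 1)"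
      using a by algebra
    finally show ?thesis by algebra
  qed
  have h': "(1 - ?z^3) * fps_deriv (hom_series 1) - 3 * ?z^2 * hom_series 1 = (3 * ?z^2 * P + ?z^3 * fps_deriv P + 1 + 3 * ?z^2) * hom_series 0
    + (?z^3 * P + 1 + ?z + ?z^3) * fps_deriv (hom_series 0)"
  proof -
    have "fps_deriv ((1 - ?z^3) * hom_series 1) = fps_deriv ((?z^3 * P + 1 + ?z + ?z^3) * hom_series 0)"
      by (simp only: h)
    then show ?thesis
      by (simp add: fps_deriv_power algebra_simps fps_of_nat[symmetric] flip: fps_numeral_fps_const)
  qed
  have "fps_nth (hom_series 0) 0 \<noteq> 0" by (simp add: fps_nth_hom_series)
  then have "hom_series 0 \<noteq> 0" by auto
  then show ?thesis
    using riccati_alg[OF a b c d e assms h' h] by simp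
qed

section \<open>The Riccati equation for the subgroups without -1\<close>

definition cube_roots_even :: "nat \<Rightarrow> nat" where
  "cube_roots_even k = num_cube_roots (2 * k)"

lemma cube_roots_even_rec:
  "cube_roots_even (k + 3) = cube_roots_even (k + 2) + 4 * (k + 2) * (k + 1) * cube_roots_even k"
proof -
  have "2 * (k + 3) - 2 = 2 * (k + 2)" "2 * (k + 3) - 6 = 2 * k" "2 * (k + 3) - 4 = 2 * (k + 1)"
    by simp_all
  moreover have "\<not> 2 * (k + 3) < 2" "\<not> 2 * (k + 3) < 6"
    by simp_all
  ultimately show ?thesis
    unfolding cube_roots_even_def num_cube_roots.simps[of "2 * (k + 3)"]
    by (simp only: if_False)
qed

lemma cube_roots_even_small: "cube_roots_even 0 = 1" "cube_roots_even 1 = 1" "cube_roots_even 2 = 1"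
  by (simp_all add: cube_roots_even_def num_cube_roots.simps[of 0] num_cube_roots.simps[of 2] num_cube_roots.simps[of 4])

lemma fact4: "fact (n + 4) = (n + 4) * (n + 3) * (n + 2) * (n + 1) * (fact n :: nat)"
proof -
  have e: "n + 4 = Suc (n + 3)" "n + 3 = Suc (n + 2)" "n + 2 = Suc (n + 1)" "n + 1 = Suc n"
    by simp_all
  have "fact (n + 4) = (n + 4) * (fact (n + 3) :: nat)" "fact (n + 3) = (n + 3) * (fact (n + 2) :: nat)"
    "fact (n + 2) = (n + 2) * (fact (n + 1) :: nat)" "fact (n + 1) = (n + 1) * (fact n :: nat)"
    by (simp_all only: e fact_Suc of_nat_id)
  then show ?thesis
    by (simp only: mult.assoc)
qed

text \<open>A square root of a matching is a permutation with all cycles of length 4, and there are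
  \<open>(4m)! / (4^m m!)\<close> of these. The factor \<open>(4m)!\<close> cancels in the
  exponential series, so only the recurrence of the cube roots is left to deal with.\<close>

lemma matchings_square_roots:
  "num_involutions False (4 * m) * num_square_roots (4 * m) * 4 ^ m * fact m = fact (4 * m)"
proof (induction m)
  case 0
  show ?case by (simp add: num_square_roots.simps)
next
  case (Suc m)
  have "num_involutions False (4 * Suc m) = (4 * m + 3) * ((4 * m + 1) * num_involutions False (4 * m))"
    by (simp add: numeral_eq_Suc num_involutions.simps)
  moreover have "num_square_roots (4 * Suc m) = (4 * m + 2) * num_square_roots (4 * m)"
    using num_square_roots.simps[of "4 * Suc m"] by simp
  moreover have "(4::nat) ^ Suc m * fact (Suc m) = (4 * m + 4) * (4 ^ m * fact m)"
    by (simp add: algebra_simps)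
  ultimately have "num_involutions False (4 * Suc m) * num_square_roots (4 * Suc m) * (4 ^ Suc m * fact (Suc m)) =
    (4 * m + 4) * (4 * m + 3) * (4 * m + 2) * (4 * m + 1) * (num_involutions False (4 * m) * num_square_roots (4 * m) * 4 ^ m * fact m)"
    by (simp only:) (simp only: mult_ac)
  also have "\<dots> = fact (4 * m + 4)"
    unfolding Suc fact4 ..
  finally show ?case
    by (simp add: mult.assoc add.commute)
qed

lemma num_matchings_odd: "odd n \<Longrightarrow> num_involutions False n = 0"
  by (induction False n rule: num_involutions.induct) (auto simp: num_involutions.simps)

lemma num_square_roots_2_mod_4: "n mod 4 = 2 \<Longrightarrow> num_square_roots n = 0"
proof (induction n rule: less_induct)
  case (less n)
  show ?case
  proof (cases "n < 4")
    case True
    then show ?thesis using less.prems by (cases "n = 2") (auto simp: num_square_roots.simps[of 2] num_square_roots.simps[of n])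
  next
    case False
    then have "num_square_roots (n - 4) = 0"
      using less by (intro less.IH) (auto simp: mod_diff_eq le_mod_geq)
    with False show ?thesis by (simp add: num_square_roots.simps[of n])
  qed
qed

lemma q_nondivisible:
  "\<not> 4 dvd n \<Longrightarrow> num_involutions False n * num_square_roots n * num_cube_roots n = 0"
proof -
  assume "\<not> 4 dvd n"
  then have "odd n \<or> n mod 4 = 2" by presburger
  then show ?thesis
    using num_matchings_odd[of n] num_square_roots_2_mod_4[of n] by auto
qed

text \<open>Actions in which \<open>-1\<close> has no fixed points need a number of points divisible
  by 4 (\<open>q_nondivisible\<close>), so their exponential series is written in a variable
  standing for \<open>z^4\<close>; \<open>fps_nth_free_series\<close> makes the link.\<close>

definition free_series :: "real fps" where
  "free_series = Abs_fps (\<lambda>m. real (cube_roots_even (2 * m)) / (4 ^ m * fact m))"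

lemma fps_nth_free_series:
  "fps_nth free_series m = real (num_involutions False (4 * m) * num_square_roots (4 * m) * num_cube_roots (4 * m)) / fact (4 * m)"
proof -
  have "real (num_involutions False (4 * m) * num_square_roots (4 * m)) * (4 ^ m * fact m) = fact (4 * m)"
    using arg_cong[OF matchings_square_roots[of m], of real] by (simp add: mult.assoc)
  then have "real (num_involutions False (4 * m) * num_square_roots (4 * m)) / fact (4 * m) = 1 / (4 ^ m * fact m)"
    by (simp add: field_simps)
  then have "real (num_involutions False (4 * m) * num_square_roots (4 * m)) / fact (4 * m) * real (num_cube_roots (4 * m))
    = 1 / (4 ^ m * fact m) * real (num_cube_roots (4 * m))"
    by (simp only:)
  then show ?thesis
    by (simp add: free_series_def cube_roots_even_def)
qed

text \<open>Only the values at even arguments enter \<open>free_series\<close>; three instances of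
  the recurrence eliminate those at odd arguments.\<close>

lemma cube_roots_even_step2:
  "cube_roots_even (2 * m + 6) = cube_roots_even (2 * m + 4) + 32 * (m + 2)^2 * cube_roots_even (2 * m + 2)
    + 64 * (2 * m + 5) * (m + 2) * (m + 1) * (2 * m + 1) * cube_roots_even (2 * m)"
proof -
  have "cube_roots_even (2 * m + 6) = cube_roots_even (2 * m + 5) + 4 * (2 * m + 5) * (2 * m + 4) * cube_roots_even (2 * m + 3)"
    using cube_roots_even_rec[of "2 * m + 3"] by (simp add: numeral_eq_Suc)
  moreover have "cube_roots_even (2 * m + 5) = cube_roots_even (2 * m + 4) + 4 * (2 * m + 4) * (2 * m + 3) * cube_roots_even (2 * m + 2)"
    using cube_roots_even_rec[of "2 * m + 2"] by (simp add: numeral_eq_Suc)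
  moreover have "cube_roots_even (2 * m + 3) = cube_roots_even (2 * m + 2) + 4 * (2 * m + 2) * (2 * m + 1) * cube_roots_even (2 * m)"
    using cube_roots_even_rec[of "2 * m"] by simp
  ultimately show ?thesis
    by (simp only: power2_eq_square) (simp add: algebra_simps)
qed

text \<open>This is \<open>cube_roots_even_step2\<close> read coefficientwise: polynomials in the
  index become polynomials in the operator \<open>f \<mapsto> z f'\<close>. The first three
  coefficients lie outside the range of that recurrence and are checked directly.\<close>

lemma free_series_ode:
  "4 * (fps_X * fps_deriv free_series) = fps_X * free_series + fps_X^2 * (8 * (fps_X * fps_deriv free_series) + 8 * free_series)
    + fps_X^3 * (16 * (fps_X * fps_deriv (fps_X * fps_deriv free_series)) + 48 * (fps_X * fps_deriv free_series) + 20 * free_series)"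
  (is "?L = ?R")
proof (rule fps_ext)
  fix n
  have num: "fps_nth (numeral k * f) i = numeral k * fps_nth f i" for k i and f :: "real fps"
    by (simp add: numeral_fps_const)
  have theta: "fps_nth (fps_X * fps_deriv f) i = real i * fps_nth f i" for i and f :: "real fps"
    by (cases i) simp_all
  have small: "fps_nth free_series 0 = 1" "fps_nth free_series 1 = 1/4" "fps_nth free_series 2 = 33/32"
  proof -
    have "cube_roots_even 3 = 9"
      using cube_roots_even_rec[of 0] cube_roots_even_small by (simp add: eval_nat_numeral)
    then have "cube_roots_even 4 = 33"
      using cube_roots_even_rec[of 1] cube_roots_even_small by (simp add: eval_nat_numeral)
    then show "fps_nth free_series 0 = 1" "fps_nth free_series 1 = 1/4" "fps_nth free_series 2 = 33/32"
      using cube_roots_even_small by (simp_all add: free_series_def fact_numeral)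
  qed
  show "fps_nth ?L n = fps_nth ?R n"
  proof (cases n rule: nat_cases3)
    case (4 m)
    have X: "fps_nth (fps_X * free_series) n = fps_nth free_series (m + 2)" "fps_nth (fps_X ^ 2 * f) n = fps_nth f (m + 1)"
      "fps_nth (fps_X ^ 3 * f) n = fps_nth f m" for f :: "real fps"
    proof -
      have "n = Suc (m + 2)" "n - 2 = m + 1" "n - 3 = m" "\<not> n < 2" "\<not> n < 3"
        using 4 by simp_all
      then show "fps_nth (fps_X * free_series) n = fps_nth free_series (m + 2)" "fps_nth (fps_X ^ 2 * f) n = fps_nth f (m + 1)"
        "fps_nth (fps_X ^ 3 * f) n = fps_nth f m"
        unfolding fps_X_power_mult_nth by simp_all
    qed
    define K :: real where "K = 4 ^ m * fact m"
    have K: "K \<noteq> 0" by (simp add: K_def)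
    have f: "fps_nth free_series m = real (cube_roots_even (2 * m)) / K"
      "fps_nth free_series (m + 1) = real (cube_roots_even (2 * m + 2)) / (4 * (real m + 1) * K)"
      "fps_nth free_series (m + 2) = real (cube_roots_even (2 * m + 4)) / (16 * (real m + 2) * (real m + 1) * K)"
      "fps_nth free_series n = real (cube_roots_even (2 * m + 6)) / (64 * (real m + 3) * (real m + 2) * (real m + 1) * K)"
    proof -
      have e: "2 * (m + 1) = 2 * m + 2" "2 * (m + 2) = 2 * m + 4" "2 * n = 2 * m + 6"
        using 4 by simp_all
      have p: "(4::real) ^ (m + 1) = 4 * 4 ^ m" "(4::real) ^ (m + 2) = 16 * 4 ^ m" "(4::real) ^ n = 64 * 4 ^ m"
        using 4 by (simp_all add: power_add)
      have ft: "fact (m + 1) = (real m + 1) * fact m" "fact (m + 2) = (real m + 2) * (real m + 1) * fact m"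
        "fact n = (real m + 3) * (real m + 2) * (real m + 1) * fact m"
        using 4 fact2[of m] fact3[of m] by (simp_all add: add_ac)
      show "fps_nth free_series m = real (cube_roots_even (2 * m)) / K"
        "fps_nth free_series (m + 1) = real (cube_roots_even (2 * m + 2)) / (4 * (real m + 1) * K)"
        "fps_nth free_series (m + 2) = real (cube_roots_even (2 * m + 4)) / (16 * (real m + 2) * (real m + 1) * K)"
        "fps_nth free_series n = real (cube_roots_even (2 * m + 6)) / (64 * (real m + 3) * (real m + 2) * (real m + 1) * K)"
        unfolding free_series_def fps_nth_Abs_fps e p ft K_def by (simp_all only: mult_ac)
    qed
    define c4 c2 c0 where c: "c4 = real (cube_roots_even (2 * m + 4))" "c2 = real (cube_roots_even (2 * m + 2))"
      "c0 = real (cube_roots_even (2 * m))"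
    have c6: "real (cube_roots_even (2 * m + 6)) = c4 + 32 * (real m + 2)^2 * c2
      + 64 * (2 * real m + 5) * (real m + 2) * (real m + 1) * (2 * real m + 1) * c0"
      unfolding cube_roots_even_step2 c by (simp add: algebra_simps power2_eq_square)
    show ?thesis
      unfolding fps_add_nth num theta X f
      unfolding c6 c[symmetric] using K 4
      by (simp add: divide_simps add_eq_0_iff) (simp add: algebra_simps power2_eq_square)
  next
    case 1
    then show ?thesis
      unfolding fps_add_nth num theta fps_X_power_mult_nth by simp
  next
    case 2
    then show ?thesis
      unfolding fps_add_nth num theta fps_X_power_mult_nth using small by simp
  next
    case 3
    have "fps_nth (fps_X * free_series) n = fps_nth free_series 1" using 3 by simp
    then show ?thesis
      unfolding fps_add_nth num theta fps_X_power_mult_nth using small 3 by simp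
  qed
qed

text \<open>Differentiating the hypothesis once expresses the second-order term of
  \<open>free_series_ode\<close> by \<open>T\<close>, and \<open>free_series\<close> cancels. The
  factor 4 comes from the variable standing for \<open>z^4\<close>: coefficient \<open>m\<close>
  belongs to \<open>4 * m\<close> points.\<close>

lemma riccati_without_minus_one:
  fixes T :: "real fps"
  assumes T: "4 * (fps_X * fps_deriv free_series) = T * free_series"
  shows "T = fps_X + 8 * fps_X^2 + 20 * fps_X^3 + (2 * fps_X^2 + 12 * fps_X^3) * T
    + fps_X^3 * (4 * (fps_X * fps_deriv T) + T^2)"
proof -
  let ?G = "fps_X * fps_deriv free_series"
  have "fps_nth free_series 0 \<noteq> 0"
    using cube_roots_even_small by (simp add: free_series_def)
  then have free_series: "free_series \<noteq> 0" by auto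
  have "fps_deriv (4 * ?G) = fps_deriv (T * free_series)"
    by (simp only: T)
  then have "4 * fps_deriv ?G = T * fps_deriv free_series + fps_deriv T * free_series"
    by (simp flip: fps_numeral_fps_const)
  then have "16 * (fps_X * fps_deriv ?G) = T * (4 * ?G) + 4 * (fps_X * fps_deriv T) * free_series"
    by algebra
  then have "16 * (fps_X * fps_deriv ?G) = (T^2 + 4 * (fps_X * fps_deriv T)) * free_series"
    unfolding T by algebra
  then have "(T - (fps_X + 8 * fps_X^2 + 20 * fps_X^3 + (2 * fps_X^2 + 12 * fps_X^3) * T
    + fps_X^3 * (4 * (fps_X * fps_deriv T) + T^2))) * free_series = 0"
    using free_series_ode T by algebra
  then show ?thesis using free_series by simp
qed

section \<open>Solving the Riccati equations modulo 8\<close>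

text \<open>The candidate solutions modulo 8, found by fitting the first subgroup numbers. Here \<open>z\<close> is the
  variable, \<open>X\<close> is \<open>z + z\<^sup>2 + z^4 + z^8 + \<dots>\<close> for the first one and the same series in \<open>z^4\<close> for the
  second, and \<open>B\<close> is \<open>X\<^sup>2 - X + z\<close> and \<open>X\<^sup>2 - X + z^4\<close>, respectively.\<close>
definition with_poly :: "'a::comm_ring_1 \<Rightarrow> 'a \<Rightarrow> 'a \<Rightarrow> 'a" where
  "with_poly z X B = - B + X + 2 * X * B - z + 2 * z * B - 2 * z * X + z^2 + 2 * z^2 * B - 2 * z^2 * X - 2 * z^3 -
      z^3 * B + z^3 * X + 2 * z^3 * X * B + 2 * z^4 * B + 2 * z^4 * X + z^5 + 2 * z^5 * B - 2 * z^5 *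
      X - 2 * z^6 + 4 * z^6 * X + 2 * z^7 + 4 * z^7 * X + 4 * z^9 + 2 * z^9 * B - 2 * z^9 * X + 2 *
      z^10 + 4 * z^10 * X + 2 * z^11 + 4 * z^11 * X - 2 * z^15 + 4 * z^15 * X + 4 * z^17 + 4 * z^18 +
      4 * z^19 + 4 * z^21 + 4 * z^24 + 4 * z^27"

text \<open>What the Euler operator makes of \<open>with_poly\<close>, with \<open>X'\<close> and
  \<open>B'\<close> for the images of \<open>X\<close> and \<open>B\<close>. These stay arguments
  because they are later replaced by expressions equal to them modulo 8.\<close>

definition with_poly_deriv :: "'a::comm_ring_1 \<Rightarrow> 'a \<Rightarrow> 'a \<Rightarrow> 'a \<Rightarrow> 'a \<Rightarrow> 'a" where
  "with_poly_deriv z X B X' B' = - B' + X' + 2 * B * X' + 2 * X * B' - z + 2 * z * B + 2 * z * B' - 2 * z * X - 2 * z * X' + 2 *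
      z^2 + 4 * z^2 * B + 2 * z^2 * B' - 4 * z^2 * X - 2 * z^2 * X' - 6 * z^3 - 3 * z^3 * B - z^3 *
      B' + 3 * z^3 * X + z^3 * X' + 6 * z^3 * X * B + 2 * z^3 * B * X' + 2 * z^3 * X * B' + 8 * z^4 *
      B + 2 * z^4 * B' + 8 * z^4 * X + 2 * z^4 * X' + 5 * z^5 + 10 * z^5 * B + 2 * z^5 * B' - 10 *
      z^5 * X - 2 * z^5 * X' - 12 * z^6 + 24 * z^6 * X + 4 * z^6 * X' + 14 * z^7 + 28 * z^7 * X + 4 *
      z^7 * X' + 36 * z^9 + 18 * z^9 * B + 2 * z^9 * B' - 18 * z^9 * X - 2 * z^9 * X' + 20 * z^10 +
      40 * z^10 * X + 4 * z^10 * X' + 22 * z^11 + 44 * z^11 * X + 4 * z^11 * X' - 30 * z^15 + 60 *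
      z^15 * X + 4 * z^15 * X' + 68 * z^17 + 72 * z^18 + 76 * z^19 + 84 * z^21 + 96 * z^24 + 108 *
      z^27"

definition without_poly :: "'a::comm_ring_1 \<Rightarrow> 'a \<Rightarrow> 'a \<Rightarrow> 'a" where
  "without_poly z X B = - B + X + 2 * X * B + 2 * z^2 * B - 2 * z^2 * X + 4 * z^4 * X"

definition without_poly_deriv :: "'a::comm_ring_1 \<Rightarrow> 'a \<Rightarrow> 'a \<Rightarrow> 'a \<Rightarrow> 'a \<Rightarrow> 'a" where
  "without_poly_deriv z X B X' B' = - B' + X' + 2 * B * X' + 2 * X * B' + 4 * z^2 * B + 2 * z^2 * B' - 4 * z^2 * X - 2 * z^2 * X' +
      16 * z^4 * X + 4 * z^4 * X'"

text \<open>Evaluates a polynomial certificate: \<open>d\<close> is a combination of relations each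
  of which is 0 or a multiple of 8. The relation \<open>w\<close> will be \<open>4 * B\<close> with
  \<open>B\<close> even.\<close>

lemma dvd_combination:
  fixes d :: "'a::comm_ring_1"
  assumes "d = a * x + b * y + c * w + e * 8" "x = 0" "y = 8 * R" "w = 8 * E"
  shows "8 dvd d"
proof -
  have "d = 8 * (b * R + c * E + e)"
    using assms by (simp add: algebra_simps)
  then show ?thesis by simp
qed

text \<open>The Riccati equations of \<open>z^6\<close> and \<open>z\<^sup>3\<close> times the generating functions of the two kinds of
  subgroup numbers. The factors make the candidate solutions polynomials in \<open>z\<close>.\<close>
definition with_operator :: "'a::comm_ring_1 \<Rightarrow> 'a \<Rightarrow> 'a \<Rightarrow> 'a" where
  "with_operator z Y Y' = z^6 * (z + z^2 + 4*z^3 + 4*z^4 - z^5 + 4*z^6 - 2*z^7 - 2*z^9)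
    + (4*z^3 + 2*z^4 + 3*z^6 - 2*z^7 - 3*z^9) * Y + (z^6 - z^9) * (Y' - 6 * Y) + (1 - z^3) * Y^2 - Y"

definition without_operator :: "'a::comm_ring_1 \<Rightarrow> 'a \<Rightarrow> 'a \<Rightarrow> 'a" where
  "without_operator z Y Y' = z^4 + 4 * z^6 + 2 * z^2 * Y + 4 * z^3 * Y' + Y^2 - Y"

text \<open>The multipliers of the relations were found by polynomial division.\<close>
lemma with_poly_riccati:
  fixes z X E B R X' B' :: "'a::idom"
  assumes X: "X^2 - X - B + z = 0" and B: "B = 2 * E" and B2: "B^2 - 2 * B + 4 * z * X - 4 * z^2 = 8 * R"
    and X': "X' = z + 2 * z^2 + 4 * z^4" and B': "B' = (2 * X - 1) * X' + z"
  shows "8 dvd with_operator z (with_poly z X B) (with_poly_deriv z X B X' B')"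
    (is "8 dvd ?d")
proof -
  have "?d =
    (1 + 12 * B - 4 * z - 8 * z * B - 16 * z * X - 16 * z^2 - 8 * z^2 * B - 23 * z^3 + 12 * z^3 * B
      + 8 * z^4 + 8 * z^4 * B - 16 * z^4 * X - 32 * z^5 - 8 * z^5 * B - 33 * z^6 + 4 * z^6 * B + 4 *
      z^7 + 24 * z^7 * B + 16 * z^7 * X + 8 * z^8 + 8 * z^8 * B + 3 * z^9 - 20 * z^9 * B + 24 * z^10
      + 8 * z^10 * B + 16 * z^10 * X + 48 * z^11 + 24 * z^11 * B + 16 * z^12 - 16 * z^12 * B - 32 *
      z^13 - 16 * z^13 * B + 40 * z^14 + 28 * z^15 + 24 * z^15 * B - 16 * z^16 - 16 * z^16 * B - 16 *
      z^17 * B + 52 * z^18 + 16 * z^19 - 64 * z^20 + 20 * z^21 - 16 * z^21 * B + 48 * z^22 + 16 *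
      z^23 - 80 * z^24 - 16 * z^25 + 32 * z^26 + 16 * z^27 - 32 * z^28 - 32 * z^29 + 16 * z^30 - 16 *
      z^33) * (X^2 - X - B + z)
    + (13 - 4 * X + 4 * X^2 - 12 * z + 8 * z * X - 8 * z^2 + 8 * z^2 * X + 21 * z^3 - 4 * z^3 * X + 4
      * z^3 * X^2 + 8 * z^4 + 8 * z^4 * X - 8 * z^5 + 8 * z^5 * X + 11 * z^6 + 4 * z^6 * X - 4 * z^6
      * X^2 + 32 * z^7 - 8 * z^7 * X + 8 * z^8 - 8 * z^8 * X - 33 * z^9 + 12 * z^9 * X - 4 * z^9 *
      X^2 + 16 * z^10 - 8 * z^10 * X + 32 * z^11 - 8 * z^11 * X - 24 * z^12 - 20 * z^13 + 28 * z^15 -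
      8 * z^15 * X - 24 * z^16 - 24 * z^17 + 4 * z^18 - 20 * z^21) * (B^2 - 2 * B + 4 * z * X - 4 * z^2)
    + (7 - 10 * z - z * X - 8 * z^2 + 3 * z^2 * X + 7 * z^3 - 4 * z^3 * X + 3 * z^4 + z^4 * X - 14 *
      z^5 + 7 * z^5 * X + 2 * z^6 + 15 * z^7 + 7 * z^7 * X + 4 * z^8 + 5 * z^8 * X - 20 * z^9 + 19 *
      z^9 * X + 26 * z^10 - z^10 * X + 35 * z^11 - 3 * z^11 * X - 13 * z^12 + 8 * z^12 * X - 9 * z^13
      + 2 * z^13 * X + 12 * z^14 - 8 * z^14 * X + 25 * z^15 - 8 * z^15 * X - 28 * z^16 + 4 * z^16 * X
      - 18 * z^17 + 4 * z^17 * X + 20 * z^18 - 10 * z^18 * X + 8 * z^19 - 6 * z^20 + 4 * z^20 * X - 8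
      * z^21 + 6 * z^21 * X + 20 * z^22 - 8 * z^22 * X + 10 * z^23 - 12 * z^23 * X - 26 * z^24 + 4 *
      z^24 * X - 6 * z^25 - 4 * z^25 * X + 8 * z^26 + 6 * z^27 - 4 * z^27 * X - 4 * z^28 - 12 * z^29
      + 6 * z^30 - 4 * z^30 * X - 8 * z^31 - 4 * z^32 - 2 * z^33 - 4 * z^33 * X - 4 * z^34 - 4 * z^35
      - 4 * z^39) * (4 * B)
    + (- 7 * z * X + 7 * z^2 + 5 * z^2 * X - 4 * z^3 + 5 * z^3 * X - z^4 - 6 * z^4 * X + 9 * z^5 - 9 *
      z^5 * X + 8 * z^6 + 3 * z^6 * X - 2 * z^7 * X + 5 * z^8 - 15 * z^8 * X + 14 * z^9 - 4 * z^9 * X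
      + 2 * z^10 + 14 * z^10 * X - 19 * z^11 + z^11 * X - 16 * z^12 * X + 18 * z^13 + 11 * z^13 * X -
      4 * z^14 + 18 * z^14 * X - 10 * z^15 + 7 * z^15 * X + z^16 - 10 * z^16 * X + 16 * z^17 + 18 *
      z^17 * X - 10 * z^18 + 12 * z^18 * X - 24 * z^19 - 5 * z^19 * X + z^20 - 16 * z^20 * X + 6 *
      z^21 + 12 * z^21 * X - 2 * z^22 + 15 * z^22 * X - 9 * z^23 + 3 * z^24 - 5 * z^24 * X + 20 *
      z^25 + 5 * z^25 * X + 4 * z^27 - 3 * z^27 * X - z^28 - 2 * z^28 * X + 3 * z^29 + 2 * z^29 * X +
      8 * z^30 - z^30 * X - 7 * z^31 - 5 * z^32 + 2 * z^32 * X - z^33 - z^33 * X + z^34 + 2 * z^34 *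
      X + 5 * z^35 - 2 * z^35 * X - 4 * z^36 - 4 * z^36 * X + 2 * z^37 - 8 * z^37 * X + 2 * z^38 - 6
      * z^39 + 2 * z^39 * X - 2 * z^40 - 4 * z^40 * X - 4 * z^41 - 4 * z^41 * X + 2 * z^42 + 4 * z^45
      - 4 * z^45 * X - 4 * z^47 - 2 * z^48 - 4 * z^49 - 2 * z^51 - 2 * z^54 - 2 * z^57) * 8"
    unfolding B' X' with_operator_def with_poly_def with_poly_deriv_def by algebra
  then show ?thesis
    by (rule dvd_combination[where E = E and R = R, OF _ X B2]) (simp add: B)
qed

lemma without_poly_riccati:
  fixes z X E B R X' B' :: "'a::idom"
  assumes X: "X^2 - X - B + z^4 = 0" and B: "B = 2 * E" and B2: "B^2 - 2 * B + 4 * z^4 * X - 4 * (z^4)^2 = 8 * R"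
    and X': "X' = 4 * z^4" and B': "B' = (2 * X - 1) * X' + 4 * z^4"
  shows "8 dvd without_operator z (without_poly z X B) (without_poly_deriv z X B X' B')"
    (is "8 dvd ?d")
proof -
  have "?d =
    (1 + 12 * B - 4 * z^2 - 8 * z^2 * B + 12 * z^4 + 16 * z^4 * B - 16 * z^4 * X - 48 * z^6 + 64 *
      z^7 + 32 * z^8) * (X^2 - X - B + z^4)
    + (13 - 4 * X + 4 * X^2 - 12 * z^2 + 8 * z^2 * X + 20 * z^4) * (B^2 - 2 * B + 4 * z^4 * X - 4 * (z^4)^2)
    + (7 - 8 * z^2 + 5 * z^2 * X + 11 * z^4 - 4 * z^4 * X + 4 * z^5 - 10 * z^6 + 4 * z^6 * X + 24 *
      z^7 + 4 * z^8) * (4 * B)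
    + (- 6 * z^4 * X - 2 * z^5 * X + z^6 + z^6 * X + 2 * z^7 + 12 * z^7 * X + 5 * z^8 - 6 * z^8 * X -
      4 * z^9 + 8 * z^9 * X + 4 * z^10 * X + 6 * z^12) * 8"
    unfolding B' X' without_operator_def without_poly_def without_poly_deriv_def by algebra
  then show ?thesis
    by (rule dvd_combination[where E = E and R = R, OF _ X B2]) (simp add: B)
qed

section \<open>Series indexed by binary digit sums\<close>

fun popcount :: "nat \<Rightarrow> nat" where
  "popcount n = (if n = 0 then 0 else n mod 2 + popcount (n div 2))"

declare popcount.simps [simp del]

lemma popcount_0 [simp]: "popcount 0 = 0"
  by (simp add: popcount.simps)

lemma popcount_even [simp]: "popcount (2 * n) = popcount n"
  by (cases "n = 0") (simp_all add: popcount.simps[of "2 * n"])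

lemma popcount_odd [simp]: "popcount (Suc (2 * n)) = Suc (popcount n)"
  by (simp add: popcount.simps[of "Suc (2 * n)"])

text \<open>The numbers \<open>3 * 2^s\<close>, that is, those with exactly two binary digits 1, in
  adjacent places. The recursion by halving matches \<open>dilate\<close>.\<close>

fun three_pow2 :: "nat \<Rightarrow> bool" where
  "three_pow2 n = (if n = 0 then False else n = 3 \<or> (even n \<and> three_pow2 (n div 2)))"

declare three_pow2.simps [simp del]

lemma three_pow2_0 [simp]: "\<not> three_pow2 0"
  by (simp add: three_pow2.simps)

lemma three_pow2_even [simp]: "three_pow2 (2 * n) \<longleftrightarrow> three_pow2 n"
proof -
  have "2 * n \<noteq> 3" by presburger
  then show ?thesis by (cases "n = 0") (simp_all add: three_pow2.simps[of "2 * n"])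
qed

lemma three_pow2_odd [simp]: "three_pow2 (Suc (2 * n)) \<longleftrightarrow> n = 1"
  by (simp add: three_pow2.simps[of "Suc (2 * n)"]) arith?

text \<open>Substitution of \<open>z^2\<close> for \<open>z\<close>, given by coefficients because
  the digit series are defined that way; its form as a composition in \<open>dilate_compose\<close>
  supplies the ring laws.\<close>

definition dilate :: "int fps \<Rightarrow> int fps" where
  "dilate f = Abs_fps (\<lambda>n. if even n then fps_nth f (n div 2) else 0)"

lemma dilate_nth: "fps_nth (dilate f) n = (if even n then fps_nth f (n div 2) else 0)"
  by (simp add: dilate_def)

lemma dilate_compose: "dilate f = fps_compose f (fps_X ^ 2)"
proof (rule fps_ext)
  fix n
  have "fps_nth (fps_compose f (fps_X ^ 2)) n = (\<Sum>i=0..n. fps_nth f i * (if n = 2 * i then 1 else 0))"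
    by (simp add: fps_compose_nth fps_X_power_nth flip: power_mult)
  also have "\<dots> = fps_nth (dilate f) n"
  proof (cases "even n")
    case True
    then obtain m where "n = 2 * m" by (elim evenE)
    then have "(\<Sum>i=0..n. fps_nth f i * (if n = 2 * i then 1 else 0)) = (\<Sum>i\<in>{m}. fps_nth f i)"
      by (intro sum.mono_neutral_cong_right) auto
    with \<open>n = 2 * m\<close> show ?thesis by (simp add: dilate_nth)
  next
    case False
    then show ?thesis by (auto simp: dilate_nth intro!: sum.neutral)
  qed
  finally show "fps_nth (dilate f) n = fps_nth (fps_compose f (fps_X ^ 2)) n" ..
qed

lemma dilate_simps [simp]:
  "dilate (f + g) = dilate f + dilate g" "dilate (f - g) = dilate f - dilate g" "dilate (- f) = - dilate f"
  "dilate (f * g) = dilate f * dilate g" "dilate fps_X = fps_X ^ 2" "dilate (numeral k) = numeral k"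
  "dilate 1 = 1" "dilate 0 = 0" "dilate (f ^ i) = dilate f ^ i"
proof -
  show *: "dilate (f * g) = dilate f * dilate g" for f g
    by (simp add: dilate_compose fps_compose_mult_distrib)
  show one: "dilate 1 = 1"
    by (simp add: dilate_compose)
  show "dilate (f ^ i) = dilate f ^ i"
    by (induction i) (simp_all add: * one)
qed (simp_all add: dilate_compose fps_compose_add_distrib fps_compose_sub_distrib fps_compose_uminus)

lemma numeral_dvd_fps_iff: "numeral k dvd (f :: int fps) \<longleftrightarrow> (\<forall>n. numeral k dvd fps_nth f n)"
proof
  assume "numeral k dvd f"
  then obtain g where "f = fps_const (numeral k) * g"
    by (auto simp: numeral_fps_const elim: dvdE)
  then show "\<forall>n. numeral k dvd fps_nth f n" by simp
next
  assume *: "\<forall>n. numeral k dvd fps_nth f n"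
  have "f = numeral k * Abs_fps (\<lambda>n. fps_nth f n div numeral k)"
    using * by (intro fps_ext) (simp add: numeral_fps_const)
  then show "numeral k dvd f" by (metis dvd_triv_left)
qed

text \<open>Invariance under \<open>z \<mapsto> z^2\<close> kills the odd coefficients and equates
  the one at an even \<open>n\<close> with the one at \<open>n / 2\<close>. Identities between digit
  series are proved by showing that the difference is invariant.\<close>

lemma dilate_fixpoint:
  assumes "f = dilate f" "fps_nth f 0 = 0"
  shows "f = 0"
proof (rule fps_ext)
  fix n
  show "fps_nth f n = fps_nth 0 n"
  proof (induction n rule: less_induct)
    case (less n)
    have "fps_nth f n = (if even n then fps_nth f (n div 2) else 0)"
      using dilate_nth[of f n] assms(1) by simp
    then show ?case
      using less[of "n div 2"] assms(2) by (cases "n = 0") auto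
  qed
qed

lemma dilate_fixpoint_mod:
  assumes "numeral k dvd f - dilate f" "fps_nth f 0 = 0"
  shows "numeral k dvd f"
proof -
  have "numeral k dvd fps_nth f n" for n
  proof (induction n rule: less_induct)
    case (less n)
    have d: "numeral k dvd fps_nth f n - (if even n then fps_nth f (n div 2) else 0)"
      using assms(1)[unfolded numeral_dvd_fps_iff, rule_format, of n] by (simp only: fps_sub_nth dilate_nth)
    have "numeral k dvd (if even n then fps_nth f (n div 2) else 0)"
      using less[of "n div 2"] assms(2) by (cases "n = 0") auto
    from dvd_add[OF d this] show ?case by simp
  qed
  then show ?thesis unfolding numeral_dvd_fps_iff by blast
qed

definition weight :: "nat \<Rightarrow> int fps" where
  "weight k = Abs_fps (\<lambda>m. if popcount m = k then 1 else 0)"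

definition triples :: "int fps" where
  "triples = Abs_fps (\<lambda>m. if three_pow2 m then 1 else 0)"

lemma weight_nth: "fps_nth (weight k) m = (if popcount m = k then 1 else 0)"
  by (simp add: weight_def)

lemma parity_cases: obtains m where "n = 2 * m" | m where "n = Suc (2 * m)"
  by (metis evenE oddE Suc_eq_plus1)

text \<open>Split by the last binary digit.\<close>

lemma weight_Suc: "weight (Suc k) = dilate (weight (Suc k)) + fps_X * dilate (weight k)"
proof (rule fps_ext)
  fix n show "fps_nth (weight (Suc k)) n = fps_nth (dilate (weight (Suc k)) + fps_X * dilate (weight k)) n"
    by (cases n rule: parity_cases) (auto simp: weight_nth dilate_nth)
qed

lemma weight_0: "weight 0 = 1"
proof (rule fps_ext)
  fix n show "fps_nth (weight 0) n = fps_nth 1 n"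
  proof (induction n rule: less_induct)
    case (less n)
    then show ?case
      by (cases n rule: parity_cases) (auto simp: weight_nth split: if_splits)
  qed
qed

lemma triples_rec: "triples = dilate triples + fps_X ^ 3"
proof (rule fps_ext)
  fix n show "fps_nth triples n = fps_nth (dilate triples + fps_X ^ 3) n"
  proof (cases n rule: parity_cases)
    case (1 m)
    then have "n \<noteq> 3" by presburger
    with 1 show ?thesis by (simp add: triples_def dilate_nth fps_X_power_nth)
  qed (auto simp: triples_def dilate_nth fps_X_power_nth)
qed

definition Phi :: "int fps" where "Phi = weight 1"

lemma dilate_Phi: "dilate Phi = Phi - fps_X"
  using weight_Suc[of 0] by (simp add: weight_0 Phi_def) (metis add_diff_cancel_right')

lemma dilate_weight2: "dilate (weight 2) = weight 2 - fps_X * (Phi - fps_X)"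
  using weight_Suc[of 1] unfolding Phi_def[symmetric] dilate_Phi
  by (simp add: numeral_2_eq_2) (metis add_diff_cancel_right')

lemma dilate_weight3: "dilate (weight 3) = weight 3 - fps_X * dilate (weight 2)"
  using weight_Suc[of 2] by (simp add: numeral_3_eq_3 numeral_2_eq_2) (metis add_diff_cancel_right')

lemma dilate_triples: "dilate triples = triples - fps_X ^ 3"
  using triples_rec by (metis add_diff_cancel_right')

lemma weight_nth_0: "k > 0 \<Longrightarrow> fps_nth (weight k) 0 = 0" "fps_nth Phi 0 = 0"
  by (simp_all add: weight_nth Phi_def)

text \<open>In the square of \<open>\<Sum> z^(2^k)\<close> the diagonal contributes
  \<open>\<Sum> z^(2^(k+1))\<close>, which is \<open>Phi - fps_X\<close>, and each pair of distinct
  powers occurs twice.\<close>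

lemma Phi_squared: "Phi ^ 2 = Phi - fps_X + 2 * weight 2"
proof -
  define D where "D = Phi ^ 2 - (Phi - fps_X) - 2 * weight 2"
  have "D = dilate D"
    unfolding D_def by (simp add: dilate_Phi dilate_weight2) algebra
  moreover have "fps_nth D 0 = 0"
    by (simp add: D_def weight_nth_0 power2_eq_square fps_mult_nth numeral_fps_const)
  ultimately show ?thesis
    using dilate_fixpoint[of D] by (simp add: D_def algebra_simps)
qed

text \<open>Add \<open>2^u\<close> to \<open>2^s + 2^t\<close> with \<open>t < s\<close>. Distinct
  exponents reach each number of digit sum 3 three times. A coincidence doubles a power and gives
  the terms of \<open>(Phi - fps_X) * Phi\<close>, except that \<open>3 * 2^s\<close> is reached
  once less, whence \<open>triples\<close>.\<close>

lemma Phi_weight2: "Phi * weight 2 = 3 * weight 3 + (Phi - fps_X) * Phi - triples"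
proof -
  define D where "D = Phi * weight 2 - 3 * weight 3 - (Phi - fps_X) * Phi + triples"
  have "D = dilate D"
    unfolding D_def using Phi_squared
    by (simp add: dilate_Phi dilate_weight2 dilate_weight3 dilate_triples) algebra
  moreover have "fps_nth D 0 = 0"
    by (simp add: D_def weight_nth_0 fps_mult_nth numeral_fps_const triples_def)
  ultimately show ?thesis
    using dilate_fixpoint[of D] by (simp add: D_def algebra_simps)
qed

text \<open>Modulo 2, squaring agrees with substituting \<open>z^2\<close>, and the subtracted
  expression is \<open>weight 2\<close> after that substitution.\<close>

lemma weight2_squared: "2 dvd weight 2 ^ 2 - (weight 2 - fps_X * (Phi - fps_X))"
proof -
  define D where "D = weight 2 ^ 2 - dilate (weight 2)"
  have "D - dilate D = 2 * (weight 2 * fps_X * (Phi - fps_X) - fps_X^2 * (Phi - fps_X)^2 + fps_X^2 * dilate (weight 2))"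
    unfolding D_def using Phi_squared
    by (simp add: dilate_Phi dilate_weight2) algebra
  then have "2 dvd D - dilate D" by simp
  moreover have "fps_nth D 0 = 0"
    by (simp add: D_def weight_nth_0 power2_eq_square fps_mult_nth dilate_nth)
  ultimately have "2 dvd D"
    by (rule dilate_fixpoint_mod)
  then show ?thesis by (simp add: D_def dilate_weight2)
qed

definition theta :: "int fps \<Rightarrow> int fps" where
  "theta f = fps_X * fps_deriv f"

lemma theta_nth: "fps_nth (theta f) n = int n * fps_nth f n"
  by (cases n) (simp_all add: theta_def)

text \<open>The chain rule: each dilation contributes a factor 2, so on a threefold dilate the Euler
  operator gives a multiple of 8.\<close>

lemma theta_dilate: "theta (dilate f) = 2 * dilate (theta f)"
proof (rule fps_ext)
  fix n show "fps_nth (theta (dilate f)) n = fps_nth (2 * dilate (theta f)) n"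
    unfolding theta_nth numeral_fps_const fps_mult_left_const_nth dilate_nth by auto
qed

lemma theta_add: "theta (f + g) = theta f + theta g"
  by (simp add: theta_def algebra_simps)

lemma theta_diff: "theta (f - g) = theta f - theta g"
  by (simp add: theta_def algebra_simps)

lemma theta_uminus: "theta (- f) = - theta f"
  by (simp add: theta_def)

lemma theta_mult: "theta (f * g) = theta f * g + f * theta g"
  by (simp add: theta_def algebra_simps)

lemma theta_X: "theta fps_X = fps_X"
  by (simp add: theta_def)

lemma theta_numeral: "theta (numeral k) = 0"
  by (simp add: theta_def numeral_fps_const)

lemma theta_X_power: "theta (fps_X ^ numeral k) = numeral k * fps_X ^ numeral k"
proof (rule fps_ext)
  fix n show "fps_nth (theta (fps_X ^ numeral k)) n = fps_nth (numeral k * fps_X ^ numeral k) n"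
    by (simp add: theta_nth numeral_fps_const fps_X_power_nth)
qed

lemmas theta_simps = theta_add theta_diff theta_uminus theta_mult theta_X theta_numeral theta_X_power

lemma theta_Phi_rec: "theta Phi = fps_X + 2 * dilate (theta Phi)"
proof -
  have "theta Phi = theta (dilate Phi + fps_X)"
    by (simp add: dilate_Phi)
  then show ?thesis
    unfolding theta_add theta_dilate theta_X by (simp add: add.commute)
qed

text \<open>The operator multiplies \<open>z^(2^k)\<close> by \<open>2^k\<close>, so only
  \<open>k = 0, 1, 2\<close> survive modulo 8. A derivative that is a polynomial modulo 8 makes the
  Riccati equation an algebraic condition.\<close>

lemma theta_Phi: "\<exists>R. theta Phi = fps_X + 2 * fps_X^2 + 4 * fps_X^4 + 8 * R"
proof -
  note rec = theta_Phi_rec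
  have 1: "dilate (theta Phi) = fps_X ^ 2 + 2 * dilate (dilate (theta Phi))"
    using arg_cong[OF rec, of dilate] by (simp only: dilate_simps)
  have 2: "dilate (dilate (theta Phi)) = fps_X ^ 4 + 2 * dilate (dilate (dilate (theta Phi)))"
    using arg_cong[OF 1, of dilate] by (simp only: dilate_simps) (simp flip: power_mult)
  show ?thesis
    by (rule exI[of _ "dilate (dilate (dilate (theta Phi)))"]) (use rec 1 2 in algebra)
qed

text \<open>The difference \<open>D\<close> of two solutions satisfies
  \<open>D = h * D + b * theta D\<close> modulo the numeral, with \<open>h\<close> and
  \<open>b\<close> of constant term 0. So each coefficient of \<open>D\<close> depends on lower ones
  only, and all of them vanish.\<close>

lemma riccati_unique_mod:
  fixes f g :: "int fps"
  assumes f: "numeral m dvd c + l * f + b * theta f + a * f^2 - f"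
    and g: "numeral m dvd c + l * g + b * theta g + a * g^2 - g"
    and 0: "fps_nth l 0 = 0" "fps_nth b 0 = 0" "fps_nth f 0 = 0" "fps_nth g 0 = 0"
  shows "numeral m dvd f - g"
proof -
  define D where "D = f - g"
  define h where "h = l + a * (f + g)"
  have h0: "fps_nth h 0 = 0" using 0 by (simp add: h_def)
  have "numeral m dvd h * D + b * theta D - D"
  proof -
    have "h * D + b * theta D - D = (c + l * f + b * theta f + a * f^2 - f) - (c + l * g + b * theta g + a * g^2 - g)"
      by (simp add: D_def h_def theta_diff algebra_simps power2_eq_square)
    then show ?thesis using f g by (metis dvd_diff)
  qed
  then have E: "numeral m dvd fps_nth (h * D) n + fps_nth (b * theta D) n - fps_nth D n" for n
    unfolding numeral_dvd_fps_iff by simp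
  have "numeral m dvd fps_nth D n" for n
  proof (induction n rule: less_induct)
    case (less n)
    have hD: "numeral m dvd fps_nth (h * D) n"
      unfolding fps_mult_nth
    proof (rule dvd_sum)
      fix i assume "i \<in> {0..n}"
      then show "numeral m dvd fps_nth h i * fps_nth D (n - i)"
        using h0 less[of "n - i"] by (cases "i = 0") auto
    qed
    have "numeral m dvd fps_nth (b * theta D) n"
      unfolding fps_mult_nth[of b]
    proof (rule dvd_sum)
      fix i assume "i \<in> {0..n}"
      then show "numeral m dvd fps_nth b i * fps_nth (theta D) (n - i)"
        using 0 less[of "n - i"] by (cases "i = 0") (auto simp: theta_nth)
    qed
    from dvd_diff[OF dvd_add[OF hD this] E[of n]] show ?case by simp
  qed
  then show ?thesis
    unfolding numeral_dvd_fps_iff D_def by blast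
qed

text \<open>The expression is affine in its last two arguments, so changing these by multiples of 8
  changes it by a multiple of 8. The differences in parentheses are the slopes.\<close>

lemma with_poly_deriv_shift:
  fixes z :: "'a::idom"
  shows "with_poly_deriv z X B (X' + 8 * R) (B' + 8 * Q) = with_poly_deriv z X B X' B' +
    8 * ((with_poly_deriv z X B 1 0 - with_poly_deriv z X B 0 0) * R + (with_poly_deriv z X B 0 1 - with_poly_deriv z X B 0 0) * Q)"
  unfolding with_poly_deriv_def by algebra

lemma without_poly_deriv_shift:
  fixes z :: "'a::idom"
  shows "without_poly_deriv z X B (X' + 8 * R) (B' + 8 * Q) = without_poly_deriv z X B X' B' +
    8 * ((without_poly_deriv z X B 1 0 - without_poly_deriv z X B 0 0) * R + (without_poly_deriv z X B 0 1 - without_poly_deriv z X B 0 0) * Q)"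
  unfolding without_poly_deriv_def by algebra

lemma theta_with_poly: "theta (with_poly fps_X f g) = with_poly_deriv fps_X f g (theta f) (theta g)"
  unfolding with_poly_def with_poly_deriv_def theta_simps by algebra

lemma theta_without_poly: "theta (without_poly fps_X f g) = without_poly_deriv fps_X f g (theta f) (theta g)"
  unfolding without_poly_def without_poly_deriv_def theta_simps by algebra

text \<open>By \<open>Phi_squared\<close>, \<open>2 * weight 2\<close> is the value of
  \<open>X^2 - X + z\<close> at \<open>X = Phi\<close>.\<close>

definition with_series :: "int fps" where
  "with_series = with_poly fps_X Phi (2 * weight 2)"

definition without_series :: "int fps" where
  "without_series = without_poly fps_X (dilate (dilate Phi)) (2 * dilate (dilate (weight 2)))"

text \<open>Four times \<open>weight2_squared\<close>, in the form of the third hypothesis of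
  \<open>with_poly_riccati\<close>.\<close>

lemma weight2_relation:
  "\<exists>R. (2 * weight 2)^2 - 2 * (2 * weight 2) + 4 * fps_X * Phi - 4 * fps_X^2 = 8 * R"
proof -
  obtain R where R: "weight 2 ^ 2 - (weight 2 - fps_X * (Phi - fps_X)) = 2 * R"
    using weight2_squared by (elim dvdE)
  have "(2 * weight 2)^2 - 2 * (2 * weight 2) + 4 * fps_X * Phi - 4 * fps_X^2 = 8 * R"
    using R by algebra
  then show ?thesis ..
qed

lemma theta_weight2: "theta (2 * weight 2) = (2 * Phi - 1) * theta Phi + fps_X"
proof -
  have "2 * weight 2 = Phi^2 - Phi + fps_X"
    using Phi_squared by simp
  then have "fps_deriv (2 * weight 2) = fps_deriv (Phi^2 - Phi + fps_X)"
    by (simp only:)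
  also have "\<dots> = 2 * Phi * fps_deriv Phi - fps_deriv Phi + 1"
    by (simp add: power2_eq_square algebra_simps)
  finally show ?thesis
    by (simp only: theta_def) (simp add: algebra_simps)
qed

lemma with_series_riccati: "8 dvd with_operator fps_X with_series (theta with_series)"
proof -
  let ?z = "fps_X :: int fps"
  let ?B = "2 * weight 2"
  let ?X' = "?z + 2 * ?z^2 + 4 * ?z^4"
  let ?B' = "(2 * Phi - 1) * ?X' + ?z"
  obtain R where R: "theta Phi = ?X' + 8 * R" using theta_Phi by blast
  obtain R2 where R2: "?B^2 - 2 * ?B + 4 * ?z * Phi - 4 * ?z^2 = 8 * R2" using weight2_relation by blast
  have tB: "theta ?B = ?B' + 8 * ((2 * Phi - 1) * R)"
    unfolding theta_weight2 R by algebra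
  obtain Q where Q: "theta with_series = with_poly_deriv ?z Phi ?B ?X' ?B' + 8 * Q"
    unfolding with_series_def theta_with_poly R tB with_poly_deriv_shift by blast
  have "Phi^2 - Phi - ?B + ?z = 0" using Phi_squared by simp
  from with_poly_riccati[OF this refl R2 refl refl]
  have "8 dvd with_operator ?z with_series (with_poly_deriv ?z Phi ?B ?X' ?B') + 8 * ((?z^6 - ?z^9) * Q)"
    unfolding with_series_def by (rule dvd_add) (rule dvd_triv_left)
  then show ?thesis
    unfolding Q with_operator_def by (simp add: algebra_simps)
qed

lemma without_series_riccati: "8 dvd without_operator fps_X without_series (theta without_series)"
proof -
  let ?z = "fps_X :: int fps"
  let ?X = "dilate (dilate Phi)"
  let ?B = "2 * dilate (dilate (weight 2))"
  have X: "?X^2 - ?X - ?B + ?z^4 = 0"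
    using arg_cong[OF Phi_squared, of "\<lambda>f. dilate (dilate f)"] by (simp flip: power_mult)
  \<comment> \<open>Two dilations already give a factor 4, so modulo 8 only the first term of
    \<open>theta Phi\<close> remains.\<close>
  have tX: "theta ?X = 4 * ?z^4 + 8 * dilate (dilate (dilate (theta Phi)))"
  proof -
    have "dilate (dilate (theta Phi)) = ?z^4 + 2 * dilate (dilate (dilate (theta Phi)))"
      using arg_cong[OF theta_Phi_rec, of "\<lambda>f. dilate (dilate f)"] by (simp only: dilate_simps) (simp flip: power_mult)
    moreover have "theta ?X = 4 * dilate (dilate (theta Phi))"
      by (simp only: theta_dilate dilate_simps) simp
    ultimately show ?thesis by algebra
  qed
  obtain R where R: "(2 * weight 2)^2 - 2 * (2 * weight 2) + 4 * fps_X * Phi - 4 * fps_X^2 = 8 * R"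
    using weight2_relation by blast
  have R2: "?B^2 - 2 * ?B + 4 * ?z^4 * ?X - 4 * (?z^4)^2 = 8 * dilate (dilate R)"
    using arg_cong[OF R, of "\<lambda>f. dilate (dilate f)"] by (simp flip: power_mult)
  have tB: "theta ?B = ((2 * ?X - 1) * (4 * ?z^4) + 4 * ?z^4) + 8 * ((2 * ?X - 1) * dilate (dilate (dilate (theta Phi))))"
  proof -
    have "?B = ?X^2 - ?X + ?z^4" using X by algebra
    then have "fps_deriv ?B = fps_deriv (?X^2 - ?X + ?z^4)"
      by (simp only:)
    also have "\<dots> = 2 * ?X * fps_deriv ?X - fps_deriv ?X + 4 * ?z^3"
      by (simp add: power2_eq_square algebra_simps eval_nat_numeral)
    finally have "theta ?B = (2 * ?X - 1) * theta ?X + 4 * ?z^4"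
      by (simp only: theta_def) (simp add: algebra_simps eval_nat_numeral)
    then show ?thesis unfolding tX by algebra
  qed
  obtain Q where Q: "theta without_series = without_poly_deriv ?z ?X ?B (4 * ?z^4) ((2 * ?X - 1) * (4 * ?z^4) + 4 * ?z^4) + 8 * Q"
    unfolding without_series_def theta_without_poly tX tB without_poly_deriv_shift by blast
  from without_poly_riccati[OF X refl R2 refl refl]
  have "8 dvd without_operator ?z without_series (without_poly_deriv ?z ?X ?B (4 * ?z^4) ((2 * ?X - 1) * (4 * ?z^4) + 4 * ?z^4))
    + 8 * (4 * ?z^3 * Q)"
    unfolding without_series_def by (rule dvd_add) (rule dvd_triv_left)
  then show ?thesis
    unfolding Q without_operator_def by (simp add: algebra_simps)
qed

section \<open>Transfer of the congruences to the subgroup numbers\<close>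

definition real_fps :: "int fps \<Rightarrow> real fps" where
  "real_fps f = Abs_fps (\<lambda>n. of_int (fps_nth f n))"

lemma real_fps_simps:
  "real_fps (f + g) = real_fps f + real_fps g" "real_fps (f - g) = real_fps f - real_fps g"
  "real_fps (f * g) = real_fps f * real_fps g" "real_fps fps_X = fps_X"
  "real_fps (numeral k) = numeral k" "real_fps (f ^ i) = real_fps f ^ i"
  "real_fps (theta f) = fps_X * fps_deriv (real_fps f)"
proof -
  show *: "real_fps (f * g) = real_fps f * real_fps g" for f g
    by (rule fps_ext) (simp add: real_fps_def fps_mult_nth)
  have one: "real_fps 1 = 1"
    by (rule fps_ext) (simp add: real_fps_def)
  show "real_fps (f ^ i) = real_fps f ^ i"
    by (induction i) (simp_all add: * one)
  show "real_fps (theta f) = fps_X * fps_deriv (real_fps f)"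
  proof (rule fps_ext)
    fix n show "fps_nth (real_fps (theta f)) n = fps_nth (fps_X * fps_deriv (real_fps f)) n"
      by (cases n) (simp_all add: real_fps_def theta_nth)
  qed
qed (auto intro!: fps_ext simp: real_fps_def fps_X_nth numeral_fps_const)

text \<open>Exponential series have denominators, so the logarithmic derivatives are taken over the
  reals. The Riccati equations involve only integer series and are pulled back along this
  embedding.\<close>

lemma real_fps_inject: "real_fps f = real_fps g \<Longrightarrow> f = g"
  by (auto simp: real_fps_def fps_eq_iff)

definition with_gf :: "int fps" where
  "with_gf = Abs_fps (\<lambda>n. int (count_with n))"

definition without_gf :: "int fps" where
  "without_gf = Abs_fps (\<lambda>m. int (count_without (4 * m)))"

lemma with_gf_log_deriv: "fps_X * fps_deriv (hom_series 0) = real_fps with_gf * hom_series 0"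
proof (rule fps_ext)
  fix n
  have l: "fps_nth (fps_X * fps_deriv (hom_series 0)) n = real n * fps_nth (hom_series 0) n"
    by (cases n) simp_all
  have r: "fps_nth (real_fps with_gf * hom_series 0) n = (\<Sum>k=1..n. real (count_with k) * fps_nth (hom_series 0) (n - k))"
    unfolding fps_mult_nth
    by (rule sum.mono_neutral_cong_right) (auto simp: real_fps_def with_gf_def count_with_def)
  show "fps_nth (fps_X * fps_deriv (hom_series 0)) n = fps_nth (real_fps with_gf * hom_series 0) n"
  proof (cases "n = 0")
    case True
    then show ?thesis unfolding l r by simp
  next
    case False
    then show ?thesis
      unfolding l r using recurrence_with_minus_one[of n] by (simp add: fps_nth_hom_series)
  qed
qed

text \<open>The recurrence writes 0 as a sum of natural numbers, and in the term
  \<open>k = n\<close> the number of actions on the empty set is 1.\<close>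

lemma without_minus_one_nondivisible:
  assumes "\<not> 4 dvd n" shows "count_without n = 0"
proof -
  have n: "n > 0" using assms by (cases n) auto
  let ?q = "\<lambda>n. num_involutions False n * num_square_roots n * num_cube_roots n"
  have "(\<Sum>k=1..n. count_without k * (fact (n - 1) div fact (n - k)) * ?q (n - k)) = 0"
    using recurrence_without_minus_one(1)[OF n] q_nondivisible[OF assms] by metis
  then have "\<forall>k\<in>{1..n}. count_without k * (fact (n - 1) div fact (n - k)) * ?q (n - k) = 0"
    by (simp only: sum_eq_0_iff finite_atLeastAtMost)
  then have "count_without n * (fact (n - 1) div fact (n - n)) * ?q (n - n) = 0"
    by (rule bspec) (use n in simp)
  moreover have "?q 0 = 1"
    by (simp add: num_square_roots.simps[of 0] num_cube_roots.simps[of 0])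
  ultimately show ?thesis by simp
qed

lemma without_gf_log_deriv: "4 * (fps_X * fps_deriv free_series) = real_fps without_gf * free_series"
proof (rule fps_ext)
  fix m
  let ?q = "\<lambda>n. num_involutions False n * num_square_roots n * num_cube_roots n"
  have l: "fps_nth (4 * (fps_X * fps_deriv free_series)) m = real (4 * m) * fps_nth free_series m"
    by (cases m) (simp_all add: numeral_fps_const)
  have r: "fps_nth (real_fps without_gf * free_series) m = (\<Sum>j=0..m. real (count_without (4 * j)) * fps_nth free_series (m - j))"
    unfolding fps_mult_nth by (simp add: real_fps_def without_gf_def)
  show "fps_nth (4 * (fps_X * fps_deriv free_series)) m = fps_nth (real_fps without_gf * free_series) m"
  proof (cases "m = 0")
    case True
    then show ?thesis unfolding l r by (simp add: count_without_def)
  next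
    case False
    have "real (4 * m) * fps_nth free_series m = (\<Sum>k=1..4*m. real (count_without k) * (real (?q (4 * m - k)) / fact (4 * m - k)))"
      using recurrence_without_minus_one(2)[of "4 * m"] False unfolding fps_nth_free_series by simp
    also have "\<dots> = (\<Sum>k\<in>(\<lambda>j. 4 * j) ` {0..m}. real (count_without k) * (real (?q (4 * m - k)) / fact (4 * m - k)))"
    proof (rule sum.mono_neutral_cong)
      fix k assume "k \<in> {1..4 * m} - (\<lambda>j. 4 * j) ` {0..m}"
      then have "\<not> 4 dvd k" by (auto elim!: dvdE)
      then show "real (count_without k) * (real (?q (4 * m - k)) / fact (4 * m - k)) = 0"
        by (simp add: without_minus_one_nondivisible)
    next
      fix k assume k: "k \<in> (\<lambda>j. 4 * j) ` {0..m} - {1..4 * m}"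
      then have "k = 0" by auto
      then show "real (count_without k) * (real (?q (4 * m - k)) / fact (4 * m - k)) = 0"
        by (simp add: count_without_def)
    qed auto
    also have "\<dots> = (\<Sum>j=0..m. real (count_without (4 * j)) * fps_nth free_series (m - j))"
      by (subst sum.reindex) (auto simp: inj_on_def fps_nth_free_series diff_mult_distrib2)
    finally show ?thesis unfolding l r .
  qed
qed

lemma with_gf_riccati:
  "with_gf = fps_X + fps_X^2 + 4*fps_X^3 + 4*fps_X^4 - fps_X^5 + 4*fps_X^6 - 2*fps_X^7 - 2*fps_X^9
    + (4*fps_X^3 + 2*fps_X^4 + 3*fps_X^6 - 2*fps_X^7 - 3*fps_X^9) * with_gf
    + (fps_X^6 - fps_X^9) * (theta with_gf + with_gf^2)"
  by (rule real_fps_inject) (use riccati_with_minus_one[OF with_gf_log_deriv] in \<open>simp only: real_fps_simps\<close>)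

lemma without_gf_riccati:
  "without_gf = fps_X + 8 * fps_X^2 + 20 * fps_X^3 + (2 * fps_X^2 + 12 * fps_X^3) * without_gf
    + fps_X^3 * (4 * theta without_gf + without_gf^2)"
  by (rule real_fps_inject) (use riccati_without_minus_one[OF without_gf_log_deriv] in \<open>simp only: real_fps_simps\<close>)

lemma with_gf_mod_8: "8 dvd fps_X^6 * with_gf - with_series"
proof (rule riccati_unique_mod)
  let ?z = "fps_X :: int fps"
  let ?c = "?z^6 * (?z + ?z^2 + 4*?z^3 + 4*?z^4 - ?z^5 + 4*?z^6 - 2*?z^7 - 2*?z^9)"
  \<comment> \<open>The summand with 6 compensates the factor \<open>z^6\<close>, since
    \<open>theta (z^6 * f) = z^6 * (theta f + 6 * f)\<close>.\<close>
  let ?l = "4*?z^3 + 2*?z^4 + 3*?z^6 - 2*?z^7 - 3*?z^9 - 6 * (?z^6 - ?z^9)"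
  let ?b = "?z^6 - ?z^9"
  let ?a = "1 - ?z^3"
  have "?c + ?l * (?z^6 * with_gf) + ?b * theta (?z^6 * with_gf) + ?a * (?z^6 * with_gf)^2 - ?z^6 * with_gf = 0"
    unfolding theta_simps using with_gf_riccati by algebra
  then show "8 dvd ?c + ?l * (?z^6 * with_gf) + ?b * theta (?z^6 * with_gf) + ?a * (?z^6 * with_gf)^2 - ?z^6 * with_gf"
    by simp
  show "8 dvd ?c + ?l * with_series + ?b * theta with_series + ?a * with_series^2 - with_series"
    using with_series_riccati by (simp add: with_operator_def algebra_simps)
qed (simp_all add: with_series_def with_poly_def weight_nth_0 numeral_fps_const fps_X_power_nth)

lemma without_gf_mod_8: "8 dvd fps_X^3 * without_gf - without_series"
proof (rule riccati_unique_mod)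
  let ?z = "fps_X :: int fps"
  let ?f = "?z^3 * without_gf"
  \<comment> \<open>Here the correction for the factor \<open>z^3\<close> cancels the term
    \<open>12 * z^3\<close> of the Riccati equation. The right-hand side collects the multiples of 8
    in the inhomogeneous part.\<close>
  have "?z^4 + 4 * ?z^6 + 2 * ?z^2 * ?f + 4 * ?z^3 * theta ?f + 1 * ?f^2 - ?f = 8 * (0 - ?z^5 - 2 * ?z^6)"
    unfolding theta_simps using without_gf_riccati by algebra
  then show "8 dvd ?z^4 + 4 * ?z^6 + 2 * ?z^2 * ?f + 4 * ?z^3 * theta ?f + 1 * ?f^2 - ?f"
    by (rule dvdI)
  show "8 dvd ?z^4 + 4 * ?z^6 + 2 * ?z^2 * without_series + 4 * ?z^3 * theta without_series + 1 * without_series^2 - without_series"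
    using without_series_riccati by (simp add: without_operator_def)
qed (simp_all add: without_series_def without_poly_def weight_nth_0 dilate_nth numeral_fps_const fps_X_power_nth)

lemma s_SL2Z_mod_8:
  assumes "n > 0"
  shows "[int (s_SL2Z n) = fps_nth with_series (n + 6) + (if 4 dvd n then fps_nth without_series (n div 4 + 3) else 0)] (mod 8)"
proof -
  have a: "[int (count_with n) = fps_nth with_series (n + 6)] (mod 8)"
  proof -
    have "8 dvd fps_nth (fps_X^6 * with_gf - with_series) (n + 6)"
      using with_gf_mod_8 unfolding numeral_dvd_fps_iff by blast
    then show ?thesis
      by (simp add: with_gf_def fps_X_power_mult_nth cong_iff_dvd_diff)
  qed
  have b: "[int (count_without n) = (if 4 dvd n then fps_nth without_series (n div 4 + 3) else 0)] (mod 8)"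
  proof (cases "4 dvd n")
    case True
    have "8 dvd fps_nth (fps_X^3 * without_gf - without_series) (n div 4 + 3)"
      using without_gf_mod_8 unfolding numeral_dvd_fps_iff by blast
    then show ?thesis
      using True by (simp add: without_gf_def fps_X_power_mult_nth cong_iff_dvd_diff)
  qed (simp add: without_minus_one_nondivisible)
  show ?thesis
    using cong_add[OF a b] s_SL2Z_split[OF assms] by simp
qed

section \<open>Binary digit sums and the index sets\<close>

lemma popcount_eq_0 [simp]: "popcount m = 0 \<longleftrightarrow> m = 0"
proof (induction m rule: less_induct)
  case (less m)
  show ?case
  proof (cases m rule: parity_cases)
    case (1 n)
    then show ?thesis using less[of n] by (cases "n = 0") auto
  qed simp
qed

lemma popcount_Suc_0 [simp]: "popcount (Suc 0) = Suc 0"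
  using popcount_odd[of 0] by simp

lemma popcount_pow2 [simp]: "popcount (2 ^ s) = 1"
  by (induction s) simp_all

lemma popcount_div_mod: "popcount m = popcount (m div 2 ^ k) + popcount (m mod 2 ^ k)"
proof (induction k arbitrary: m)
  case (Suc k)
  show ?case
  proof (cases m rule: parity_cases)
    case (1 n)
    then have "m div 2 ^ Suc k = n div 2 ^ k" "m mod 2 ^ Suc k = 2 * (n mod 2 ^ k)"
      by (simp_all add: mod_mult_mult1)
    then show ?thesis using Suc[of n] 1 by simp
  next
    case (2 n)
    then have "m div 2 ^ Suc k = n div 2 ^ k"
      by (simp add: div_mult2_eq)
    moreover have "m mod 2 ^ Suc k = Suc (2 * (n mod 2 ^ k))"
      using 2 by (simp add: mod_mult2_eq)
    ultimately show ?thesis using Suc[of n] 2 by simp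
  qed
qed simp

lemma popcount_shift_add: "c < 2 ^ k \<Longrightarrow> popcount (2 ^ k * p + c) = popcount p + popcount c"
  using popcount_div_mod[of "2 ^ k * p + c" k] by simp

text \<open>Splits off the leading binary digit \<open>2^s\<close>.\<close>

lemma popcount_Suc_iff: "popcount m = Suc k \<longleftrightarrow> (\<exists>s r. m = 2 ^ s + r \<and> r < 2 ^ s \<and> popcount r = k)"
proof
  assume "popcount m = Suc k"
  then have "m > 0" by (cases m) auto
  then obtain s where s: "2 ^ s \<le> m" "m < 2 ^ Suc s"
    using ex_power_ivl1[of 2 m] by auto
  then have "popcount m = 1 + popcount (m - 2 ^ s)"
    using popcount_shift_add[of "m - 2 ^ s" s 1] by simp
  with \<open>popcount m = Suc k\<close> s show "\<exists>s r. m = 2 ^ s + r \<and> r < 2 ^ s \<and> popcount r = k"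
    by (intro exI[of _ s] exI[of _ "m - 2 ^ s"]) auto
next
  assume "\<exists>s r. m = 2 ^ s + r \<and> r < 2 ^ s \<and> popcount r = k"
  then obtain s r where "m = 2 ^ s * 1 + r" "r < 2 ^ s" "popcount r = k" by auto
  then show "popcount m = Suc k"
    using popcount_shift_add[of r s 1] by simp
qed

lemma popcount_1: "popcount m = 1 \<longleftrightarrow> (\<exists>s. m = 2 ^ s)"
  using popcount_Suc_iff[of m 0] by auto

lemma popcount_2: "popcount m = 2 \<longleftrightarrow> (\<exists>s t. t < s \<and> m = 2 ^ s + 2 ^ t)"
proof -
  have "popcount m = 2 \<longleftrightarrow> popcount m = Suc 1" by (simp add: numeral_2_eq_2)
  also have "\<dots> \<longleftrightarrow> (\<exists>s t. t < s \<and> m = 2 ^ s + 2 ^ t)"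
  proof
    assume "popcount m = Suc 1"
    then obtain s t where "m = 2 ^ s + 2 ^ t" "(2::nat) ^ t < 2 ^ s"
      unfolding popcount_Suc_iff[of m 1] popcount_1 by blast
    moreover then have "t < s" by simp
    ultimately show "\<exists>s t. t < s \<and> m = 2 ^ s + 2 ^ t" by blast
  next
    assume "\<exists>s t. t < s \<and> m = 2 ^ s + 2 ^ t"
    then obtain s t where "m = 2 ^ s + 2 ^ t" "(2::nat) ^ t < 2 ^ s" by auto
    then show "popcount m = Suc 1"
      unfolding popcount_Suc_iff[of m 1] popcount_1 by blast
  qed
  finally show ?thesis .
qed

lemma popcount_3: "popcount m = 3 \<longleftrightarrow> (\<exists>s v t. t < v \<and> v < s \<and> m = 2 ^ s + 2 ^ v + 2 ^ t)"
proof
  assume "popcount m = 3"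
  then obtain s r where "m = 2 ^ s + r" "r < 2 ^ s" "popcount r = 2"
    using popcount_Suc_iff[of m 2] by (auto simp: numeral_3_eq_3 numeral_2_eq_2)
  moreover then obtain v t where "t < v" "r = 2 ^ v + 2 ^ t" by (auto simp: popcount_2)
  moreover have "v < s"
  proof (rule ccontr)
    assume "\<not> v < s"
    then have "(2::nat) ^ s \<le> 2 ^ v" by simp
    with \<open>r < 2 ^ s\<close> \<open>r = 2 ^ v + 2 ^ t\<close> show False by simp
  qed
  ultimately show "\<exists>s v t. t < v \<and> v < s \<and> m = 2 ^ s + 2 ^ v + 2 ^ t"
    by (auto simp: add.assoc)
next
  assume "\<exists>s v t. t < v \<and> v < s \<and> m = 2 ^ s + 2 ^ v + 2 ^ t"
  then obtain s v t where *: "t < v" "v < s" "m = 2 ^ s + (2 ^ v + 2 ^ t)" by (auto simp: add.assoc)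
  then have "popcount (2 ^ v + 2 ^ t) = 2" by (auto simp: popcount_2)
  moreover have "(2::nat) ^ v + 2 ^ t < 2 ^ s"
  proof -
    have "(2::nat) ^ t < 2 ^ v" "(2::nat) ^ Suc v \<le> 2 ^ s"
      using * by (simp_all del: power_Suc add: Suc_le_eq power_increasing)
    then show ?thesis unfolding power_Suc by linarith
  qed
  ultimately show "popcount m = 3"
    using popcount_Suc_iff[of m 2] * by (auto simp: numeral_3_eq_3 numeral_2_eq_2)
qed

lemma three_pow2_iff: "three_pow2 m \<longleftrightarrow> (\<exists>s. m = 3 * 2 ^ s)"
proof (induction m rule: less_induct)
  case (less m)
  show ?case
  proof (cases m rule: parity_cases)
    case (1 n)
    show ?thesis
    proof (cases "n = 0")
      case False
      then have IH: "three_pow2 n \<longleftrightarrow> (\<exists>s. n = 3 * 2 ^ s)" using less[of n] 1 by simp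
      have "(\<exists>s. m = 3 * 2 ^ s) \<longleftrightarrow> (\<exists>s. n = 3 * 2 ^ s)"
      proof
        assume "\<exists>s. m = 3 * 2 ^ s"
        then obtain s where "m = 3 * 2 ^ s" by blast
        then show "\<exists>s. n = 3 * 2 ^ s" using 1 by (cases s) (auto, presburger)
      next
        assume "\<exists>s. n = 3 * 2 ^ s"
        then obtain s where "n = 3 * 2 ^ s" by blast
        then show "\<exists>s. m = 3 * 2 ^ s" using 1 by (intro exI[of _ "Suc s"]) simp
      qed
      then show ?thesis using IH 1 by simp
    qed (use 1 in simp)
  next
    case (2 n)
    have "(\<exists>s. m = 3 * 2 ^ s) \<longleftrightarrow> n = 1"
    proof
      assume "\<exists>s. m = 3 * 2 ^ s"
      then obtain s where s: "m = 3 * 2 ^ s" by blast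
      then show "n = 1" using 2 by (cases s) (auto, presburger)
    next
      assume "n = 1" then show "\<exists>s. m = 3 * 2 ^ s" using 2 by (intro exI[of _ 0]) simp
    qed
    then show ?thesis using 2 by simp
  qed
qed

lemma int_eq_int_diff_iff: "int n = int m - int d \<longleftrightarrow> n + d = m"
  and int_eq_int_add_iff: "int n = int m + int d \<longleftrightarrow> d \<le> n \<and> n - d = m"
  by auto

lemma int_eq_diff_iff: "int n = 2 ^ s - int d \<longleftrightarrow> n + d = 2 ^ s"
  and int_eq_diff_three_iff: "int n = 3 * 2 ^ s - int d \<longleftrightarrow> n + d = 3 * 2 ^ s"
  and int_eq_sum2_diff_iff: "int n = 2 ^ s + 2 ^ t - int d \<longleftrightarrow> n + d = 2 ^ s + 2 ^ t"
  and int_eq_sum3_diff_iff: "int n = 2 ^ s + 2 ^ t + 2 ^ v - int d \<longleftrightarrow> n + d = 2 ^ s + 2 ^ t + 2 ^ v"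
  using int_eq_int_diff_iff[of n "2 ^ s" d] int_eq_int_diff_iff[of n "3 * 2 ^ s" d]
    int_eq_int_diff_iff[of n "2 ^ s + 2 ^ t" d] int_eq_int_diff_iff[of n "2 ^ s + 2 ^ t + 2 ^ v" d] by simp_all

lemma int_eq_add_iff: "int n = 2 ^ s + int d \<longleftrightarrow> d \<le> n \<and> n - d = 2 ^ s"
  and int_eq_sum2_add_iff: "int n = 2 ^ s + 2 ^ t + int d \<longleftrightarrow> d \<le> n \<and> n - d = 2 ^ s + 2 ^ t"
  using int_eq_int_add_iff[of n "2 ^ s" d] int_eq_int_add_iff[of n "2 ^ s + 2 ^ t" d] by simp_all

lemma popcount_1_iff: "(\<exists>s. a \<le> s \<and> m = 2 ^ s) \<longleftrightarrow> popcount m = 1 \<and> 2 ^ a \<le> m"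
  unfolding popcount_1 by auto

lemma three_pow2_ge_iff: "(\<exists>s. a \<le> s \<and> m = 3 * 2 ^ s) \<longleftrightarrow> three_pow2 m \<and> 3 * 2 ^ a \<le> m"
  unfolding three_pow2_iff by auto

text \<open>The bound on the larger exponent is a bound on the size of \<open>m\<close>, that on the
  smaller one is divisibility. With \<open>a > 0\<close> the truncated \<open>s - 1\<close> really
  means \<open>t < s\<close>.\<close>

lemma popcount_2_iff:
  assumes "a > 0"
  shows "(\<exists>s t. a \<le> s \<and> b \<le> t \<and> t \<le> s - 1 \<and> m = 2 ^ s + 2 ^ t) \<longleftrightarrow>
    popcount m = 2 \<and> m mod 2 ^ b = 0 \<and> 2 ^ a \<le> m" (is "?L \<longleftrightarrow> ?R")
proof
  assume ?L
  then obtain s t where *: "a \<le> s" "b \<le> t" "t \<le> s - 1" "m = 2 ^ s + 2 ^ t" by blast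
  then have "t < s" using assms by linarith
  moreover have "(2::nat) ^ a \<le> 2 ^ s" using * by simp
  moreover have "(2::nat) ^ b dvd m"
    using * \<open>t < s\<close> by (simp add: le_imp_power_dvd)
  ultimately show ?R using * by (auto simp: popcount_2 intro: trans_le_add1 simp del: power_increasing_iff)
next
  assume R: ?R
  then obtain s t where *: "t < s" "m = 2 ^ s + 2 ^ t" by (auto simp: popcount_2)
  have "a \<le> s"
  proof (rule ccontr)
    assume "\<not> a \<le> s"
    then have "(2::nat) ^ Suc s \<le> 2 ^ a" by (intro power_increasing) auto
    moreover have "(2::nat) ^ t < 2 ^ s" using * by simp
    ultimately show False using R * by simp
  qed
  moreover have "b \<le> t"
  proof (rule ccontr)
    assume "\<not> b \<le> t"
    then have "(2::nat) ^ Suc t dvd 2 ^ b" by (intro le_imp_power_dvd) auto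
    moreover have "2 ^ b dvd m" using R by auto
    moreover have "(2::nat) ^ Suc t dvd 2 ^ s" using * by (intro le_imp_power_dvd) auto
    ultimately have "(2::nat) ^ Suc t dvd 2 ^ t"
      using * by (metis dvd_add_right_iff dvd_trans)
    then show False by (simp add: nat_dvd_not_less)
  qed
  ultimately show ?L using * by (intro exI[of _ s] exI[of _ t]) auto
qed

lemma pow2_sum_unique:
  assumes "t < s" "u < v" "(2::nat) ^ s + 2 ^ t = 2 ^ v + 2 ^ u"
  shows "s = v \<and> t = u"
proof -
  have lt: "s' \<le> v'" if "t' < s'" "u' < v'" "(2::nat) ^ s' + 2 ^ t' = 2 ^ v' + 2 ^ u'" for s' t' u' v' :: nat
  proof (rule ccontr)
    assume "\<not> s' \<le> v'"
    then have "(2::nat) ^ Suc v' \<le> 2 ^ s'" by (intro power_increasing) auto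
    moreover have "(2::nat) ^ u' < 2 ^ v'" using that by simp
    ultimately show False using that by simp
  qed
  have "s = v" using lt[OF assms] lt[OF assms(2,1) assms(3)[symmetric]] by simp
  with assms(3) show ?thesis by simp
qed

text \<open>A gap of at least two excludes exactly \<open>2^(t+1) + 2^t = 3 * 2^t\<close>;
  \<open>a > 1\<close> guards the truncated \<open>s - 2\<close>.\<close>

lemma popcount_2_gap_iff:
  assumes "a > 1"
  shows "(\<exists>s t. a \<le> s \<and> b \<le> t \<and> t \<le> s - 2 \<and> m = 2 ^ s + 2 ^ t) \<longleftrightarrow>
    popcount m = 2 \<and> \<not> three_pow2 m \<and> m mod 2 ^ b = 0 \<and> 2 ^ a \<le> m" (is "?L \<longleftrightarrow> ?R")
proof
  assume ?L
  then obtain s t where *: "a \<le> s" "b \<le> t" "t \<le> s - 2" "m = 2 ^ s + 2 ^ t" by blast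
  have "\<not> three_pow2 m"
  proof
    assume "three_pow2 m"
    then obtain u where u: "m = 2 ^ Suc u + 2 ^ u" by (auto simp: three_pow2_iff)
    have "t < s" using * assms by linarith
    have "s = Suc u \<and> t = u"
      using pow2_sum_unique[OF \<open>t < s\<close>, of u "Suc u"] u * by simp
    then show False using * assms by linarith
  qed
  moreover have "popcount m = 2 \<and> m mod 2 ^ b = 0 \<and> 2 ^ a \<le> m"
  proof -
    have "\<exists>s t. a \<le> s \<and> b \<le> t \<and> t \<le> s - 1 \<and> m = 2 ^ s + 2 ^ t"
      using * by (intro exI[of _ s] exI[of _ t]) auto
    then show ?thesis using popcount_2_iff[of a b m] assms by simp
  qed
  ultimately show ?R by blast
next
  assume R: ?R
  then obtain s t where *: "a \<le> s" "b \<le> t" "t \<le> s - 1" "m = 2 ^ s + 2 ^ t"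
    using popcount_2_iff[of a b m] assms by auto
  have "t \<noteq> s - 1"
  proof
    assume "t = s - 1"
    then have "s = Suc t" using * assms by linarith
    then have "m = 3 * 2 ^ t" using * by simp
    then show False using R by (auto simp: three_pow2_iff)
  qed
  then show ?L using * by (intro exI[of _ s] exI[of _ t]) auto
qed

text \<open>Divisibility by 8 means \<open>t \<ge> 3\<close>, and \<open>v \<ge> 5\<close> means
  that at most one digit lies below 32, hence the condition on \<open>m mod 32\<close>. With digit
  sum 3, \<open>64 \<le> m\<close> forces \<open>s \<ge> 6\<close>.\<close>

lemma popcount_3_iff:
  "(\<exists>s t v. 6 \<le> s \<and> 5 \<le> v \<and> v \<le> s - 1 \<and> 3 \<le> t \<and> t \<le> v - 1 \<and> m = 2 ^ s + 2 ^ t + 2 ^ v) \<longleftrightarrow>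
    popcount m = 3 \<and> m mod 8 = 0 \<and> popcount (m mod 32) \<le> 1 \<and> 64 \<le> m" (is "?L \<longleftrightarrow> ?R")
proof
  assume ?L
  then obtain s t v where *: "6 \<le> s" "5 \<le> v" "v \<le> s - 1" "3 \<le> t" "t \<le> v - 1" "m = 2 ^ s + 2 ^ v + 2 ^ t"
    by auto
  then have "t < v" "v < s" by linarith+
  then have "popcount m = 3" using * by (auto simp: popcount_3)
  moreover have "(2::nat) ^ 3 dvd 2 ^ s" "(2::nat) ^ 3 dvd 2 ^ v" "(2::nat) ^ 3 dvd 2 ^ t"
    using * by (intro le_imp_power_dvd; simp)+
  then have "8 dvd m" unfolding * by simp
  moreover have "(2::nat) ^ 5 dvd 2 ^ s" "(2::nat) ^ 5 dvd 2 ^ v"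
    using * by (intro le_imp_power_dvd; simp)+
  then have "32 dvd 2 ^ s + (2::nat) ^ v" by simp
  then have "m mod 32 = 2 ^ t mod 32" unfolding * by (metis dvd_imp_mod_0 mod_add_left_eq add_0)
  then have "popcount (m mod 32) \<le> 1"
    using popcount_div_mod[of "2 ^ t" 5] by simp
  moreover have "(2::nat) ^ 6 \<le> 2 ^ s" using * by (intro power_increasing) auto
  then have "64 \<le> m" using * by simp
  ultimately show ?R by auto
next
  assume R: ?R
  then obtain s v t where *: "t < v" "v < s" "m = 2 ^ s + 2 ^ v + 2 ^ t" by (auto simp: popcount_3)
  have lt: "(2::nat) ^ t < 2 ^ v" "(2::nat) ^ Suc v \<le> 2 ^ s"
    using * by (simp, intro power_increasing) auto
  have "6 \<le> s"
  proof (rule ccontr)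
    assume "\<not> 6 \<le> s"
    then have "(2::nat) ^ s \<le> 2 ^ 5" by (intro power_increasing) auto
    then have "(2::nat) ^ s \<le> 32" by simp
    moreover have "64 \<le> 2 ^ s + 2 ^ v + (2::nat) ^ t" using R * by simp
    ultimately show False using lt unfolding power_Suc by linarith
  qed
  moreover have "3 \<le> t"
  proof (rule ccontr)
    assume "\<not> 3 \<le> t"
    then have "(2::nat) ^ Suc t dvd 2 ^ 3" by (intro le_imp_power_dvd) auto
    moreover have "2 ^ 3 dvd m" using R by auto
    moreover have "(2::nat) ^ Suc t dvd 2 ^ s" "(2::nat) ^ Suc t dvd 2 ^ v"
      using * by (intro le_imp_power_dvd; simp)+
    then have "(2::nat) ^ Suc t dvd 2 ^ s + 2 ^ v" by (rule dvd_add)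
    moreover have "(2::nat) ^ Suc t dvd (2 ^ s + 2 ^ v) + 2 ^ t"
      using dvd_trans[OF calculation(1,2)] unfolding * .
    ultimately have "(2::nat) ^ Suc t dvd 2 ^ t"
      using dvd_add_right_iff by blast
    then show False by (simp add: nat_dvd_not_less)
  qed
  moreover have "5 \<le> v"
  proof (rule ccontr)
    assume "\<not> 5 \<le> v"
    then have "(2::nat) ^ Suc v \<le> 2 ^ 5" by (intro power_increasing) auto
    then have "(2::nat) * 2 ^ v \<le> 32" by simp
    then have small: "(2::nat) ^ v + 2 ^ t < 32" using lt(1) by linarith
    have "(2::nat) ^ 5 dvd 2 ^ s" using \<open>6 \<le> s\<close> by (intro le_imp_power_dvd) simp
    then have "m mod 32 = (2 ^ v + 2 ^ t) mod 32"
      unfolding * by (simp add: add.assoc) (metis dvd_imp_mod_0 mod_add_left_eq add_0)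
    then have "m mod 32 = 2 ^ v + 2 ^ t" using small by simp
    moreover have "popcount (2 ^ v + 2 ^ t) = 2" using * by (auto simp: popcount_2)
    ultimately show False using R by simp
  qed
  ultimately show ?L using * by (intro exI[of _ s] exI[of _ t] exI[of _ v]) auto
qed

text \<open>Here and in the next four lemmas the integer equations become conditions on the natural
  numbers \<open>n + d\<close> or \<open>n - d\<close>, and the quantified exponents become digit
  conditions that can be evaluated.\<close>

lemma idx_1_iff: "n \<in> idx_1 \<longleftrightarrow> n \<in> {1, 2, 4, 10} \<or> popcount (n + 3) = 1 \<and> 16 \<le> n + 3"
  using int_eq_diff_iff[of n _ 3] popcount_1_iff[of 4 "n + 3"] by (simp add: idx_1_def)

lemma idx_2_iff: "n \<in> idx_2 \<longleftrightarrow> n \<in> {7, 12, 17} \<or> (\<exists>d\<in>{3, 6, 12}. three_pow2 (n + d) \<and> 48 \<le> n + d)"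
  using three_pow2_ge_iff[of 4 "n + 3"] three_pow2_ge_iff[of 4 "n + 6"] three_pow2_ge_iff[of 4 "n + 12"]
    int_eq_diff_three_iff[of n _ 3] int_eq_diff_three_iff[of n _ 6] int_eq_diff_three_iff[of n _ 12]
  by (simp add: idx_2_def conj_disj_distribL ex_disj_distrib)

lemma idx_5_iff: "n \<in> idx_5 \<longleftrightarrow> n = 5 \<or> (\<exists>d\<in>{6, 12}. popcount (n + d) = 1 \<and> 32 \<le> n + d)"
  using popcount_1_iff[of 5 "n + 6"] popcount_1_iff[of 5 "n + 12"]
    int_eq_diff_iff[of n _ 6] int_eq_diff_iff[of n _ 12]
  by (simp add: idx_5_def conj_disj_distribL ex_disj_distrib)

lemma idx_4_iff: "n \<in> idx_4 \<longleftrightarrow> n \<in> {3, 22, 23, 27, 46, 49, 51}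
    \<or> (\<exists>d\<in>{6, 7, 11, 12, 18, 21}. d \<le> n \<and> popcount (n - d) = 1 \<and> 32 \<le> n - d)
    \<or> popcount (n + 2) = 2 \<and> (n + 2) mod 16 = 0 \<and> 64 \<le> n + 2
    \<or> (\<exists>d\<in>{1, 3}. d \<le> n \<and> popcount (n - d) = 2 \<and> (n - d) mod 16 = 0 \<and> 64 \<le> n - d)
    \<or> (\<exists>d\<in>{12, 6, 3}. popcount (n + d) = 3 \<and> (n + d) mod 8 = 0 \<and> popcount ((n + d) mod 32) \<le> 1 \<and> 64 \<le> n + d)"
proof -
  have add: "(\<exists>s::nat. 5 \<le> s \<and> int n = 2 ^ s + int d) \<longleftrightarrow> d \<le> n \<and> popcount (n - d) = 1 \<and> 32 \<le> n - d" for d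
    using popcount_1_iff[of 5 "n - d"] by (auto simp: int_eq_add_iff)
  have sum2: "(\<exists>s t::nat. 6 \<le> s \<and> 4 \<le> t \<and> t \<le> s - 1 \<and> int n = 2 ^ s + 2 ^ t + int d) \<longleftrightarrow>
    d \<le> n \<and> popcount (n - d) = 2 \<and> (n - d) mod 16 = 0 \<and> 64 \<le> n - d" for d
  proof -
    have "(\<exists>s t::nat. 6 \<le> s \<and> 4 \<le> t \<and> t \<le> s - 1 \<and> int n = 2 ^ s + 2 ^ t + int d) \<longleftrightarrow>
      d \<le> n \<and> (\<exists>s t::nat. 6 \<le> s \<and> 4 \<le> t \<and> t \<le> s - 1 \<and> n - d = 2 ^ s + 2 ^ t)"
      unfolding int_eq_sum2_add_iff by blast
    also have "\<dots> \<longleftrightarrow> d \<le> n \<and> popcount (n - d) = 2 \<and> (n - d) mod 16 = 0 \<and> 64 \<le> n - d"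
      using popcount_2_iff[of 6 4 "n - d"] by simp
    finally show ?thesis .
  qed
  have diff2: "(\<exists>s t::nat. 6 \<le> s \<and> 4 \<le> t \<and> t \<le> s - 1 \<and> int n = 2 ^ s + 2 ^ t - int d) \<longleftrightarrow>
    popcount (n + d) = 2 \<and> (n + d) mod 16 = 0 \<and> 64 \<le> n + d" for d
    using popcount_2_iff[of 6 4 "n + d"] by (simp add: int_eq_sum2_diff_iff)
  have diff3: "(\<exists>s t v::nat. 6 \<le> s \<and> 5 \<le> v \<and> v \<le> s - 1 \<and> 3 \<le> t \<and> t \<le> v - 1 \<and> int n = 2 ^ s + 2 ^ t + 2 ^ v - int d) \<longleftrightarrow>
    popcount (n + d) = 3 \<and> (n + d) mod 8 = 0 \<and> popcount ((n + d) mod 32) \<le> 1 \<and> 64 \<le> n + d" for d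
    using popcount_3_iff[of "n + d"] by (simp add: int_eq_sum3_diff_iff)
  show ?thesis
    unfolding idx_4_def mem_Collect_eq conj_disj_distribL ex_disj_distrib
      add[of 6, unfolded of_nat_numeral] add[of 7, unfolded of_nat_numeral] add[of 11, unfolded of_nat_numeral]
      add[of 12, unfolded of_nat_numeral] add[of 18, unfolded of_nat_numeral] add[of 21, unfolded of_nat_numeral]
      diff2[of 2, unfolded of_nat_numeral] sum2[of 1, unfolded of_nat_1] sum2[of 3, unfolded of_nat_numeral]
      diff3[of 12, unfolded of_nat_numeral] diff3[of 6, unfolded of_nat_numeral] diff3[of 3, unfolded of_nat_numeral]
      bex_simps
    by (simp only: disj_assoc simp_thms)
qed

lemma idx_6_iff: "n \<in> idx_6 \<longleftrightarrow> n \<in> {6, 11, 14, 18, 19, 21, 33, 34, 35, 37}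
    \<or> (\<exists>d\<in>{2, 4}. popcount (n + d) = 1 \<and> 32 \<le> n + d)
    \<or> (\<exists>d\<in>{1, 2, 3, 4, 5, 10, 13}. d \<le> n \<and> popcount (n - d) = 1 \<and> 64 \<le> n - d)
    \<or> (\<exists>d\<in>{3, 6, 12}. popcount (n + d) = 2 \<and> \<not> three_pow2 (n + d) \<and> (n + d) mod 32 = 0 \<and> 128 \<le> n + d)"
proof -
  have add: "(\<exists>s::nat. 6 \<le> s \<and> int n = 2 ^ s + int d) \<longleftrightarrow> d \<le> n \<and> popcount (n - d) = 1 \<and> 64 \<le> n - d" for d
    using popcount_1_iff[of 6 "n - d"] by (auto simp: int_eq_add_iff)
  have diff: "(\<exists>s::nat. 5 \<le> s \<and> int n = 2 ^ s - int d) \<longleftrightarrow> popcount (n + d) = 1 \<and> 32 \<le> n + d" for d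
    using popcount_1_iff[of 5 "n + d"] by (simp add: int_eq_diff_iff)
  have diff2: "(\<exists>s t::nat. 7 \<le> s \<and> 5 \<le> t \<and> t \<le> s - 2 \<and> int n = 2 ^ s + 2 ^ t - int d) \<longleftrightarrow>
    popcount (n + d) = 2 \<and> \<not> three_pow2 (n + d) \<and> (n + d) mod 32 = 0 \<and> 128 \<le> n + d" for d
    using popcount_2_gap_iff[of 7 5 "n + d"] by (simp add: int_eq_sum2_diff_iff)
  show ?thesis
    unfolding idx_6_def mem_Collect_eq conj_disj_distribL ex_disj_distrib
      add[of 1, unfolded of_nat_1] add[of 2, unfolded of_nat_numeral] add[of 3, unfolded of_nat_numeral]
      add[of 4, unfolded of_nat_numeral] add[of 5, unfolded of_nat_numeral] add[of 10, unfolded of_nat_numeral]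
      add[of 13, unfolded of_nat_numeral] diff[of 2, unfolded of_nat_numeral] diff[of 4, unfolded of_nat_numeral]
      diff2[of 3, unfolded of_nat_numeral] diff2[of 6, unfolded of_nat_numeral] diff2[of 12, unfolded of_nat_numeral]
      bex_simps
    by (simp only: disj_assoc simp_thms)
qed

section \<open>Linear form of the solutions and its coefficients\<close>

definition with_linear :: "int fps" where
  "with_linear = 3 * fps_X + fps_X^2 + 4 * fps_X^4 + fps_X^5 + 2 * fps_X^7 + 4 * fps_X^9 + 2 * fps_X^10 + 2 *
    fps_X^11 + 4 * fps_X^17 + 4 * fps_X^18 + 4 * fps_X^19 + 4 * fps_X^21 + 4 * fps_X^24 + 4 *
    fps_X^27 + 2 * (fps_X * Phi) + 4 * (fps_X^6 * Phi) + 4 * (fps_X^7 * Phi) + 4 * (fps_X^10 * Phi)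
    + 4 * (fps_X^11 * Phi) + 4 * (fps_X^15 * Phi) + 4 * (fps_X * weight 2) + 4 * (fps_X^2 * weight
    2) + 4 * (fps_X^4 * weight 2) + 4 * (fps_X^5 * weight 2) + 4 * (fps_X^9 * weight 2) + 4 *
    weight 3 + 4 * (fps_X^3 * weight 3) + 4 * triples + 4 * (fps_X^3 * triples) - 2 * fps_X^3 - 2 *
    fps_X^6 - 2 * fps_X^15 - 3 * Phi - 2 * (fps_X^2 * Phi) - 3 * (fps_X^3 * Phi) - 2 * (fps_X^4 *
    Phi) - 2 * (fps_X^5 * Phi) - 2 * (fps_X^9 * Phi) - 2 * weight 2 - 2 * (fps_X^3 * weight 2)"

definition without_linear :: "int fps" where
  "without_linear = 4 * fps_X^4 + 4 * (fps_X^2 * dilate (dilate (weight 2))) + 4 * dilate (dilate (weight 3)) + 4 *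
    dilate (dilate triples) - 3 * dilate (dilate Phi) - 2 * (fps_X^2 * dilate (dilate Phi)) - 2 *
    dilate (dilate (weight 2))"

text \<open>The coefficients of \<open>with_linear\<close>, with its terms in the same order and
  with the case distinctions of the coefficient lemmas, so that \<open>with_linear_nth\<close>
  closes by unfolding.\<close>

definition with_value :: "nat \<Rightarrow> int" where
  "with_value N =
    3 * (if N = 1 then 1 else 0) + (if N = 2 then 1 else 0) + 4 * (if N = 4 then 1 else 0) + (if N
    = 5 then 1 else 0) + 2 * (if N = 7 then 1 else 0) + 4 * (if N = 9 then 1 else 0) + 2 * (if N =
    10 then 1 else 0) + 2 * (if N = 11 then 1 else 0) + 4 * (if N = 17 then 1 else 0) + 4 * (if N =
    18 then 1 else 0) + 4 * (if N = 19 then 1 else 0) + 4 * (if N = 21 then 1 else 0) + 4 * (if N =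
    24 then 1 else 0) + 4 * (if N = 27 then 1 else 0) + 2 * (if N = 0 then 0 else if popcount (N -
    1) = 1 then 1 else 0) + 4 * (if N < 6 then 0 else if popcount (N - 6) = 1 then 1 else 0) + 4 *
    (if N < 7 then 0 else if popcount (N - 7) = 1 then 1 else 0) + 4 * (if N < 10 then 0 else if
    popcount (N - 10) = 1 then 1 else 0) + 4 * (if N < 11 then 0 else if popcount (N - 11) = 1 then
    1 else 0) + 4 * (if N < 15 then 0 else if popcount (N - 15) = 1 then 1 else 0) + 4 * (if N = 0
    then 0 else if popcount (N - 1) = 2 then 1 else 0) + 4 * (if N < 2 then 0 else if popcount (N -
    2) = 2 then 1 else 0) + 4 * (if N < 4 then 0 else if popcount (N - 4) = 2 then 1 else 0) + 4 *
    (if N < 5 then 0 else if popcount (N - 5) = 2 then 1 else 0) + 4 * (if N < 9 then 0 else if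
    popcount (N - 9) = 2 then 1 else 0) + 4 * (if popcount N = 3 then 1 else 0) + 4 * (if N < 3
    then 0 else if popcount (N - 3) = 3 then 1 else 0) + 4 * (if three_pow2 N then 1 else 0) + 4 *
    (if N < 3 then 0 else if three_pow2 (N - 3) then 1 else 0) - 2 * (if N = 3 then 1 else 0) - 2 *
    (if N = 6 then 1 else 0) - 2 * (if N = 15 then 1 else 0) - 3 * (if popcount N = 1 then 1 else
    0) - 2 * (if N < 2 then 0 else if popcount (N - 2) = 1 then 1 else 0) - 3 * (if N < 3 then 0
    else if popcount (N - 3) = 1 then 1 else 0) - 2 * (if N < 4 then 0 else if popcount (N - 4) = 1
    then 1 else 0) - 2 * (if N < 5 then 0 else if popcount (N - 5) = 1 then 1 else 0) - 2 * (if N <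
    9 then 0 else if popcount (N - 9) = 1 then 1 else 0) - 2 * (if popcount N = 2 then 1 else 0) -
    2 * (if N < 3 then 0 else if popcount (N - 3) = 2 then 1 else 0)"

text \<open>Coefficient \<open>n div 4 + 3\<close> of \<open>without_linear\<close>, rescaled by 4
  to the argument \<open>n + 12\<close>; the factor \<open>z^2\<close> turns this into
  \<open>n + 4\<close>. Double dilation demands another divisibility by 4, hence 16, and factors 4
  do not change digit sums. If 4 does not divide \<open>n\<close>, every condition is false and the
  value is 0.\<close>

definition without_value :: "nat \<Rightarrow> int" where
  "without_value n =
    (if (n + 12) mod 16 = 0 \<and> popcount (n + 12) = 1 then - 3 else 0) + (if (n + 4) mod 16 = 0
    \<and> popcount (n + 4) = 1 then - 2 else 0) + (if (n + 12) mod 16 = 0 \<and> popcount (n + 12)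
    = 2 then - 2 else 0) + (if (n + 4) mod 16 = 0 \<and> popcount (n + 4) = 2 then 4 else 0) + (if
    (n + 12) mod 16 = 0 \<and> popcount (n + 12) = 3 then 4 else 0) + (if (n + 12) mod 16 = 0
    \<and> three_pow2 (n + 12) then 4 else 0) + (if n = 4 then 4 else 0)"

lemma fps_nth_numeral_mult: "fps_nth (numeral k * f) n = numeral k * fps_nth f n"
  by (simp add: numeral_fps_const)

text \<open>After the products \<open>Phi^2\<close> and \<open>Phi * weight 2\<close> are replaced
  by the digit identities, only multiples of 8 separate the cubic from its linear form.\<close>

lemma with_series_linear: "8 dvd with_series - with_linear"
proof -
  have "with_series - with_linear =
    8 * (Phi + fps_X^3 * Phi + weight 2 + fps_X^3 * weight 2 + weight 3 + fps_X^3 * weight 3 - fps_X -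
    fps_X^4 - fps_X * Phi - triples - fps_X^3 * triples)
    + (4 + 4 * fps_X^3) * (Phi * weight 2 - (3 * weight 3 + (Phi - fps_X) * Phi - triples))
    + (4 + 4 * fps_X^3) * (Phi^2 - (Phi - fps_X + 2 * weight 2))"
    unfolding with_series_def with_poly_def with_linear_def by algebra
  then show ?thesis
    unfolding Phi_squared Phi_weight2 by simp
qed

lemma without_series_linear: "8 dvd without_series - without_linear"
proof -
  let ?d = "\<lambda>f. dilate (dilate f)"
  have 1: "?d Phi * ?d (weight 2) = 3 * ?d (weight 3) + (?d Phi - fps_X^4) * ?d Phi - ?d triples"
    using arg_cong[OF Phi_weight2, of ?d] by (simp flip: power_mult)
  have 2: "(?d Phi)^2 = ?d Phi - fps_X^4 + 2 * ?d (weight 2)"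
    using arg_cong[OF Phi_squared, of ?d] by (simp flip: power_mult)
  have "without_series - without_linear =
    8 * (dilate (dilate Phi) + dilate (dilate (weight 2)) + dilate (dilate (weight 3)) - fps_X^4 -
    dilate (dilate triples))
    + 4 * (?d Phi * ?d (weight 2) - (3 * ?d (weight 3) + (?d Phi - fps_X^4) * ?d Phi - ?d triples))
    + 4 * ((?d Phi)^2 - (?d Phi - fps_X^4 + 2 * ?d (weight 2)))"
    unfolding without_series_def without_poly_def without_linear_def by algebra
  then show ?thesis
    unfolding 1 2 by simp
qed

lemma Phi_nth: "fps_nth Phi m = (if popcount m = 1 then 1 else 0)"
  by (simp add: Phi_def weight_nth)

lemma triples_nth: "fps_nth triples m = (if three_pow2 m then 1 else 0)"
  by (simp add: triples_def)

lemma dilate_dilate_nth: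
  "fps_nth (dilate (dilate f)) m = (if m mod 4 = 0 then fps_nth f (m div 4) else 0)"
proof (cases "m mod 4 = 0")
  case True
  then have "even m" "even (m div 2)" by presburger+
  with True show ?thesis by (simp add: dilate_nth div_mult2_eq[of m 2 2, simplified])
next
  case False
  then have "odd m \<or> odd (m div 2)" by presburger
  with False show ?thesis by (auto simp: dilate_nth)
qed

lemma numeral_Bit_eq: "(numeral (Num.Bit0 k) :: nat) = 2 * numeral k" "(numeral (Num.Bit1 k) :: nat) = Suc (2 * numeral k)"
  by (simp_all add: numeral_Bit0 numeral_Bit1)

lemma popcount_numeral [simp]:
  "popcount (numeral (Num.Bit0 k)) = popcount (numeral k)"
  "popcount (numeral (Num.Bit1 k)) = Suc (popcount (numeral k))"
  "popcount 1 = 1"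
  by (simp_all only: numeral_Bit_eq[of k] popcount_even popcount_odd popcount_Suc_0 One_nat_def)

lemma three_pow2_numeral [simp]:
  "three_pow2 (numeral (Num.Bit0 k)) = three_pow2 (numeral k)"
  "three_pow2 (numeral (Num.Bit1 k)) \<longleftrightarrow> k = Num.One"
  "\<not> three_pow2 1" "\<not> three_pow2 (Suc 0)"
  by (simp_all only: numeral_Bit_eq[of k] three_pow2_even three_pow2_odd numeral_eq_one_iff) (simp_all add: three_pow2.simps[of "Suc 0"])

lemma popcount_4 [simp]: "popcount (4 * m) = popcount m"
  using popcount_even[of "2 * m"] by simp

lemma three_pow2_4 [simp]: "three_pow2 (4 * m) \<longleftrightarrow> three_pow2 m"
  using three_pow2_even[of "2 * m"] by simp

lemma without_linear_nth:
  assumes "4 dvd n" shows "fps_nth without_linear (n div 4 + 3) = without_value n"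
proof -
  obtain k where k: "n = 4 * k" using assms by (elim dvdE)
  have c: "(4 * k + 12) mod 16 = 0 \<longleftrightarrow> (k + 3) mod 4 = 0" "(4 * k + 4) mod 16 = 0 \<longleftrightarrow> (k + 1) mod 4 = 0"
    by presburger+
  have e: "4 * k + 12 = 4 * (k + 3)" "4 * k + 4 = 4 * (k + 1)" by simp_all
  have pc: "popcount ((k + 3) div 4) = popcount (k + 3) \<and> three_pow2 ((k + 3) div 4) = three_pow2 (k + 3)"
    if "(k + 3) mod 4 = 0"
    using that popcount_4[of "(k + 3) div 4"] three_pow2_4[of "(k + 3) div 4"] by (auto elim!: dvdE)
  have pc1: "popcount ((k + 1) div 4) = popcount (k + 1)" if "(k + 1) mod 4 = 0"
    using that popcount_4[of "(k + 1) div 4"] by (auto elim!: dvdE)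
  have n2: "fps_nth (fps_X^2 * f) (k + 3) = fps_nth f (k + 1)" for f :: "int fps"
    by (simp add: fps_X_power_mult_nth)
  show ?thesis
  proof (cases "k = 1")
    case True
    then show ?thesis
      by (simp add: k without_linear_def without_value_def fps_nth_numeral_mult fps_X_power_mult_nth
        dilate_dilate_nth Phi_nth weight_nth triples_nth fps_X_power_nth)
  next
    case False
    then show ?thesis
      unfolding k without_linear_def without_value_def c
      unfolding e popcount_4 three_pow2_4
      using pc pc1 by (simp add: fps_nth_numeral_mult n2 dilate_dilate_nth Phi_nth weight_nth triples_nth
        fps_X_power_nth)
  qed
qed

lemmas linear_nth = fps_add_nth fps_sub_nth fps_nth_numeral_mult fps_X_power_mult_nth fps_X_mult_nth fps_X_power_nth
  fps_X_nth Phi_nth weight_nth triples_nth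

lemma series_values:
  "[fps_nth with_series (n + 6) + (if 4 dvd n then fps_nth without_series (n div 4 + 3) else 0)
    = fps_nth with_linear (n + 6) + without_value n] (mod 8)"
proof (rule cong_add)
  show "[fps_nth with_series (n + 6) = fps_nth with_linear (n + 6)] (mod 8)"
    using with_series_linear unfolding numeral_dvd_fps_iff cong_iff_dvd_diff by simp
  show "[(if 4 dvd n then fps_nth without_series (n div 4 + 3) else 0) = without_value n] (mod 8)"
  proof (cases "4 dvd n")
    case True
    then show ?thesis
      using without_series_linear without_linear_nth[OF True]
      unfolding numeral_dvd_fps_iff cong_iff_dvd_diff by simp (metis fps_sub_nth)
  next
    case False
    then have "(n + 12) mod 16 \<noteq> 0" "(n + 4) mod 16 \<noteq> 0" "n \<noteq> 4" by presburger+
    with False show ?thesis by (simp add: without_value_def)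
  qed
qed

lemma with_linear_nth: "fps_nth with_linear N = with_value N"
  unfolding with_linear_def with_value_def linear_nth mult_1_right ..

text \<open>The five truth values are those of membership in \<open>idx_1\<close>, \<open>idx_2\<close>, \<open>idx_4\<close>, \<open>idx_5\<close>, \<open>idx_6\<close>.\<close>
definition residue_table :: "bool \<Rightarrow> bool \<Rightarrow> bool \<Rightarrow> bool \<Rightarrow> bool \<Rightarrow> int \<Rightarrow> bool" where
  "residue_table i1 i2 i4 i5 i6 r \<longleftrightarrow>
    (if i1 then \<not> i2 \<and> \<not> i4 \<and> \<not> i5 \<and> \<not> i6 \<and> r = 1
     else if i2 then \<not> i4 \<and> \<not> i5 \<and> \<not> i6 \<and> r = 2
     else if i4 then \<not> i5 \<and> \<not> i6 \<and> r = 4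
     else if i5 then \<not> i6 \<and> r = 5
     else if i6 then r = 6 else r = 0)"

definition residue_correct :: "nat \<Rightarrow> bool" where
  "residue_correct n \<longleftrightarrow> residue_table (n \<in> idx_1) (n \<in> idx_2) (n \<in> idx_4) (n \<in> idx_5) (n \<in> idx_6)
    ((with_value (n + 6) + without_value n) mod 8)"

lemmas idx_iffs = idx_1_iff idx_2_iff idx_4_iff idx_5_iff idx_6_iff

text \<open>Direct evaluation in the range where sporadic indices and lower bounds matter. The list
  starts at 2 because \<open>upt_rec_numeral\<close> wants numeral bounds, which 1 is not.\<close>

lemma residue_correct_small: "n \<in> {2..<128} \<Longrightarrow> residue_correct n" and residue_correct_1: "residue_correct 1"
proof -
  have "\<forall>n\<in>set [2..<128]. residue_correct n"
    by (simp add: upt_rec_numeral del: upt_Suc set_upt, intro conjI;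
      simp add: residue_correct_def idx_iffs with_value_def without_value_def; simp add: residue_table_def)
  then show "n \<in> {2..<128} \<Longrightarrow> residue_correct n"
    unfolding set_upt by blast
  show "residue_correct 1"
    by (simp add: residue_correct_def idx_iffs with_value_def without_value_def; simp add: residue_table_def)
qed

section \<open>Large indices, by their lowest five binary digits\<close>

lemma popcount_32: 
  "c < 32 \<Longrightarrow> popcount (c + 32 * p) = popcount p + popcount c"
  "32 \<le> c \<Longrightarrow> c < 64 \<Longrightarrow> popcount (c + 32 * p) = popcount (Suc p) + popcount (c - 32)"
  "64 \<le> c \<Longrightarrow> c < 96 \<Longrightarrow> popcount (c + 32 * p) = popcount (Suc (Suc p)) + popcount (c - 64)"
  using popcount_shift_add[of c 5 p] popcount_shift_add[of "c - 32" 5 "Suc p"] popcount_shift_add[of "c - 64" 5 "Suc (Suc p)"]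
  by (simp_all add: algebra_simps)

text \<open>A number \<open>3 * 2^s\<close> of size at least 64 has \<open>s \<ge> 5\<close> and is
  divisible by 32. The bound \<open>p \<ge> 2\<close> excludes \<open>48 = 16 + 32\<close>.\<close>

lemma three_pow2_32_aux:
  assumes "c < 32" "p \<ge> 2"
  shows "three_pow2 (c + 32 * p) \<longleftrightarrow> c = 0 \<and> three_pow2 p"
proof (cases "c = 0")
  case True
  have "three_pow2 (2 * (2 * (2 * (2 * (2 * p))))) = three_pow2 p"
    by (simp only: three_pow2_even)
  with True show ?thesis by simp
next
  case False
  have "\<not> three_pow2 (c + 32 * p)"
  proof
    assume "three_pow2 (c + 32 * p)"
    then obtain s where s: "c + 32 * p = 3 * 2 ^ s" by (auto simp: three_pow2_iff)
    have "s \<ge> 5"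
    proof (rule ccontr)
      assume "\<not> 5 \<le> s"
      then have "(2::nat) ^ s \<le> 2 ^ 4" by (intro power_increasing) auto
      then have "(2::nat) ^ s \<le> 16" by simp
      with s assms show False by linarith
    qed
    then have "(2::nat) ^ 5 dvd 2 ^ s" by (rule le_imp_power_dvd)
    then have "32 dvd 3 * (2::nat) ^ s" by simp
    then have "32 dvd c + 32 * p" unfolding s .
    then have "32 dvd c" by presburger
    then show False using assms False by (auto dest: dvd_imp_le)
  qed
  with False show ?thesis by simp
qed

text \<open>As in \<open>popcount_32\<close>, the three ranges of \<open>c\<close> are a carry of 0,
  1 or 2 into the upper digits \<open>p\<close>.\<close>

lemma three_pow2_32:
  "c < 32 \<Longrightarrow> p \<ge> 3 \<Longrightarrow> three_pow2 (c + 32 * p) \<longleftrightarrow> c = 0 \<and> three_pow2 p"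
  "32 \<le> c \<Longrightarrow> c < 64 \<Longrightarrow> p \<ge> 3 \<Longrightarrow> three_pow2 (c + 32 * p) \<longleftrightarrow> c = 32 \<and> three_pow2 (Suc p)"
  "64 \<le> c \<Longrightarrow> c < 96 \<Longrightarrow> p \<ge> 3 \<Longrightarrow> three_pow2 (c + 32 * p) \<longleftrightarrow> c = 64 \<and> three_pow2 (Suc (Suc p))"
  using three_pow2_32_aux[of c p] three_pow2_32_aux[of "c - 32" "Suc p"] three_pow2_32_aux[of "c - 64" "Suc (Suc p)"]
  by (auto simp: algebra_simps)

lemma
  fixes c i p :: nat
  shows diff_32: "i \<le> c \<Longrightarrow> c + 32 * p - i = (c - i) + 32 * p"
    and le_32: "p \<ge> 3 \<Longrightarrow> i \<le> 96 + c \<Longrightarrow> i \<le> c + 32 * p"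
    and neq_32: "p \<ge> 3 \<Longrightarrow> i < 96 + c \<Longrightarrow> c + 32 * p \<noteq> i"
    and nless_32: "p \<ge> 3 \<Longrightarrow> i \<le> 96 + c \<Longrightarrow> \<not> c + 32 * p < i"
  by linarith+

lemma mod_32:
  fixes c p :: nat
  shows "(c + 32 * p) mod 8 = c mod 8" "(c + 32 * p) mod 16 = c mod 16" "(c + 32 * p) mod 32 = c mod 32"
proof -
  have "c + 32 * p = c + 8 * (4 * p)" "c + 32 * p = c + 16 * (2 * p)" by simp_all
  then show "(c + 32 * p) mod 8 = c mod 8" "(c + 32 * p) mod 16 = c mod 16" "(c + 32 * p) mod 32 = c mod 32"
    by (metis mod_mult_self2)+
qed

lemma three_pow2_popcount: "three_pow2 p \<Longrightarrow> popcount p = 2"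
proof -
  assume "three_pow2 p"
  then obtain s where "p = 2 ^ Suc s + 2 ^ s" by (auto simp: three_pow2_iff)
  then show ?thesis unfolding popcount_2 by blast
qed

text \<open>The conditions to be decided compare digit sums with numbers up to 3 or test
  \<open>three_pow2\<close>, so five cases suffice. The four \<open>Suc\<close> let the simplifier
  settle the comparisons in the last one.\<close>

lemma popcount_cases:
  assumes "q > 0"
  obtains "popcount q = 1" "\<not> three_pow2 q" | "popcount q = 2" "three_pow2 q" | "popcount q = 2" "\<not> three_pow2 q"
    | "popcount q = 3" "\<not> three_pow2 q" | x where "popcount q = Suc (Suc (Suc (Suc x)))" "\<not> three_pow2 q"
proof (cases "three_pow2 q")
  case True
  then show ?thesis using that(2) three_pow2_popcount by blast
next
  case False
  have "popcount q \<noteq> 0" using assms by simp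
  then consider "popcount q = 1" | "popcount q = 2" | "popcount q = 3" | x where "popcount q = Suc (Suc (Suc (Suc x)))"
    by (metis One_nat_def numeral_2_eq_2 numeral_3_eq_3 old.nat.exhaust)
  then show ?thesis using that False by cases blast+
qed

lemmas window_simps = with_value_def without_value_def popcount_32 three_pow2_32 diff_32 le_32 neq_32 nless_32 mod_32

context
  fixes p y :: nat
  assumes p: "p \<ge> 3" and y: "popcount p = Suc y"
begin

text \<open>For these \<open>c\<close>, every argument from \<open>n - 21\<close> to
  \<open>n + 12\<close> has \<open>p\<close> or \<open>p + 1\<close> above its lowest five digits.
  Where it is \<open>p\<close>, the low digits are not all 0, and it is enough that the digit sum of
  \<open>p\<close> is positive; so only \<open>Suc p\<close> is split into cases.\<close>

lemma residue_correct_window_low: "\<forall>c\<in>set [32..<52]. residue_correct (c + 32 * p)"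
  by (simp add: upt_rec_numeral del: upt_Suc set_upt, intro conjI;
    simp add: residue_correct_def idx_iffs window_simps p y del: popcount_eq_0 split del: if_split;
    rule popcount_cases[of "Suc p", OF zero_less_Suc];
    use p in \<open>simp add: residue_table_def\<close>)

text \<open>Here \<open>n + 12\<close> carries once more and \<open>p + 2\<close> appears as well,
  hence the second case distinction.\<close>

lemma residue_correct_window_high: "\<forall>c\<in>set [52..<64]. residue_correct (c + 32 * p)"
  by (simp add: upt_rec_numeral del: upt_Suc set_upt, intro conjI;
    simp add: residue_correct_def idx_iffs window_simps p y del: popcount_eq_0 split del: if_split;
    rule popcount_cases[of "Suc p", OF zero_less_Suc]; rule popcount_cases[of "Suc (Suc p)", OF zero_less_Suc];
    use p in \<open>simp add: residue_table_def\<close>)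

end

lemma residue_correct_all: assumes "n \<ge> 1" shows "residue_correct n"
proof (cases "n < 128")
  case True
  then show ?thesis using residue_correct_1 residue_correct_small[of n] assms by (cases "n = 1") auto
next
  case False
  \<comment> \<open>One unit of 32 is borrowed from the quotient: with \<open>c \<ge> 32\<close>,
    subtracting a shift of at most 21 never borrows from \<open>p\<close>. From
    \<open>n \<ge> 128\<close> comes \<open>p \<ge> 3\<close>.\<close>
  define p where "p = n div 32 - 1"
  define c where "c = n mod 32 + 32"
  have "n div 32 \<ge> 4"
    using False by simp
  then have "32 * p + 32 = 32 * (n div 32)" and p: "p \<ge> 3"
    by (simp_all add: p_def)
  then have n: "n = c + 32 * p"
    using div_mult_mod_eq[of n 32] unfolding c_def by linarith
  obtain y where y: "popcount p = Suc y"
    using p by (cases "popcount p") auto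
  have "32 \<le> c" "c < 64"
    by (simp_all add: c_def)
  then have "c \<in> set [32..<52] \<or> c \<in> set [52..<64]"
    unfolding set_upt atLeastLessThan_iff by linarith
  then show ?thesis
    using residue_correct_window_low[OF p y] residue_correct_window_high[OF p y] n by blast
qed

theorem theorem27:
  fixes n :: nat
  assumes "n \<ge> 1"
  shows "([s_SL2Z n = 1] (mod 8) \<longleftrightarrow> n \<in> idx_1)
    \<and> ([s_SL2Z n = 2] (mod 8) \<longleftrightarrow> n \<in> idx_2)
    \<and> ([s_SL2Z n = 4] (mod 8) \<longleftrightarrow> n \<in> idx_4)
    \<and> ([s_SL2Z n = 5] (mod 8) \<longleftrightarrow> n \<in> idx_5)
    \<and> ([s_SL2Z n = 6] (mod 8) \<longleftrightarrow> n \<in> idx_6)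
    \<and> (n \<notin> idx_1 \<union> idx_2 \<union> idx_4 \<union> idx_5 \<union> idx_6 \<longrightarrow> 8 dvd s_SL2Z n)
    \<and> \<not> [s_SL2Z n = 3] (mod 8) \<and> \<not> [s_SL2Z n = 7] (mod 8)"
proof -
  define r where "r = s_SL2Z n mod 8"
  have "[int (s_SL2Z n) = with_value (n + 6) + without_value n] (mod 8)"
    using cong_trans[OF s_SL2Z_mod_8 series_values] assms by (simp add: with_linear_nth)
  then have "int r = (with_value (n + 6) + without_value n) mod 8"
    by (simp add: cong_def r_def zmod_int)
  then have "residue_table (n \<in> idx_1) (n \<in> idx_2) (n \<in> idx_4) (n \<in> idx_5) (n \<in> idx_6) (int r)"
    using residue_correct_all[OF assms] by (simp add: residue_correct_def)
  then show ?thesis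
    unfolding cong_def dvd_eq_mod_eq_0 r_def[symmetric]
    by (auto simp: residue_table_def split: if_splits)
qed

end
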